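(* Let $\Lambda$ be the algebra of symmetric functions over $\mathbb{Q}(\alpha)$, let $A(u)$ be the formal power series in $u^{-1}$ with coefficients in operators on $\Lambda$ which is diagonal in the basis of Jack symmetric functions $J_\lambda$ with $$A(u)J_\lambda=\prod_{i\ge 1}\frac{u+i-1-\alpha\lambda_i}{u+i-1}\cdot J_\lambda .$$ Let $p^{\ast}$ be the infinite column vector with entries $p_1^{\ast},p_2^{\ast},\ldots$ where $p_n^{\ast}=\alpha n\,\partial/\partial p_n$, and let $L=[L_{ij}]_{i,j=1}^{\infty}$ be the infinite matrix of operators on $\Lambda$ with entries $L_{ij}=j(\alpha-1)\delta_{ij}+p_{j-i}$, where $p_{-n}=p_n^{\ast}$ for $n\ge1$ and $p_0=0$. Let $\Psi(u)$ be the infinite column vector with entries $\Psi_1(u),\Psi_2(u),\ldots$ defined by $$\Psi(u)=(u-L)^{-1}p^{\ast}A(u+1),\qquad (u-L)^{-1}=u^{-1}+Lu^{-2}+L^2u^{-3}+\cdots,$$ and let the operators $\Psi_n^{(1)},\Psi_n^{(2)},\ldots$ on $\Lambda$ be determined by the expansion $$\Psi_n(u)=\Psi_n^{(1)}/(u+1)_1+\Psi_n^{(2)}/(u+1)_2+\cdots .$$ Then for any indices $k,n\ge1$ $$\Psi_n^{(k)}=(-1)^{n+k}\sum_{\ell(\lambda)=k}d_\lambda\, e_n^{\perp}(m_\lambda)\,m_\lambda^{\ast},$$ where the sum is over all partitions $\lambda$ of length $k$, and $e_n^{\perp}(m_\lambda)\in\Lambda$ acts by multiplication.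
   Context: $\Lambda$ is the algebra of symmetric functions in infinitely many variables $x_1,x_2,\ldots$ over the field $\mathbb{Q}(\alpha)$, where $\alpha$ is an indeterminate. Partitions are written $\lambda=(\lambda_1\ge\lambda_2\ge\cdots)$; $\ell(\lambda)$ is the number of non-zero parts. If $k_1,k_2,\ldots$ are the multiplicities of the parts $1,2,\ldots$ of $\lambda$, put $d_\lambda=k_1!k_2!\cdots$ and $z_\lambda=1^{k_1}k_1!\,2^{k_2}k_2!\cdots$. $m_\lambda$ is the monomial symmetric function, $e_n=m_{(1^n)}$ the elementary symmetric function, $p_n=x_1^n+x_2^n+\cdots$ for $n\ge1$ the power sum (also denoting the operator of multiplication by $p_n$), and $p_\lambda=p_{\lambda_1}p_{\lambda_2}\cdots p_{\lambda_{\ell(\lambda)}}$. Since $p_1,p_2,\ldots$ are free generators of $\Lambda$, $\partial/\partial p_n$ is partial differentiation on $\Lambda=\mathbb{Q}(\alpha)[p_1,p_2,\ldots]$. Two symmetric bilinear forms on $\Lambda$: $\langle p_\lambda,p_\mu\rangle=z_\lambda\delta_{\lambda\mu}$ and $\langle p_\lambda,p_\mu\rangle_\alpha=\alpha^{\ell(\lambda)}z_\lambda\delta_{\lambda\mu}$. For $f\in\Lambda$, $f^{\perp}$ denotes the conjugate (adjoint) of the operator of multiplication by $f$ relative to $\langle\,,\rangle$, and $f^{\ast}$ its conjugate relative to $\langle\,,\rangle_\alpha$; in particular $p_n^{\ast}=\alpha n\,\partial/\partial p_n$. The natural partial order on partitions of the same number: $\mu\le\lambda$ if $\mu_1+\cdots+\mu_i\le\lambda_1+\cdots+\lambda_i$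 for all $i$. The Jack symmetric functions $J_\lambda$ are the unique family of elements of $\Lambda$ such that $\langle J_\lambda,J_\mu\rangle_\alpha=0$ for $\lambda\ne\mu$ and $J_\lambda$ equals $m_\lambda$ plus a linear combination of $m_\mu$ with $\mu<\lambda$. They form a basis of $\Lambda$. $(u)_k=u(u+1)\cdots(u+k-1)$ is the Pochhammer symbol, so $(u+1)_k=(u+1)(u+2)\cdots(u+k)$. All rational functions of $u$ are expanded as formal power series in $u^{-1}$. Infinite sums of operators on $\Lambda$ make sense because only finitely many summands are non-zero on any subspace of $\Lambda$ of fixed degree in $x_1,x_2,\ldots$ (in a product of matrix entries and $p^{\ast}$, the summation over intermediate indices is performed starting from the rightmost index). *)

theory Defs
  imports
    "HOL-Library.Poly_Mapping"
    "HOL-Computational_Algebra.Fraction_Field"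
    "HOL-Computational_Algebra.Polynomial"
    "HOL-Computational_Algebra.Formal_Power_Series"
begin

type_synonym qalpha = "rat poly fract"

definition alpha :: qalpha where
  "alpha = Fraction_Field.Fract [:0, 1:] 1"

text \<open>
  The exponent \<open>a\<close> stands for the monomial in variables \<open>x\<^sub>i\<close>, \<open>i \<in> \<nat>\<close>, where \<open>x\<^sub>i\<close> has power
  \<open>lookup a i\<close>. A symmetric function is a formal power series (a family of coefficients of
  monomials) of bounded total degree that is invariant under permutations of the variables.
\<close>

type_synonym expo = "nat \<Rightarrow>\<^sub>0 nat"

definition total_degree :: "expo \<Rightarrow> nat" where
  "total_degree a = (\<Sum>i\<in>Poly_Mapping.keys a. Poly_Mapping.lookup a i)"

typedef symfun =
  "{f :: expo \<Rightarrow> qalpha.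
      (\<exists>d. \<forall>a. f a \<noteq> 0 \<longrightarrow> total_degree a \<le> d) \<and>
      (\<forall>\<pi> a. bij \<pi> \<longrightarrow> f (Poly_Mapping.map_key \<pi> a) = f a)}"
  morphisms mcoeff Abs_symfun
  by (rule exI[of _ "\<lambda>_. 0"]) simp

setup_lifting type_definition_symfun

lemma total_degree_superset:
  assumes "finite S" "Poly_Mapping.keys a \<subseteq> S"
  shows "total_degree a = (\<Sum>i\<in>S. Poly_Mapping.lookup a i)"
  unfolding total_degree_def
  by (rule sum.mono_neutral_left) (use assms in \<open>auto simp: in_keys_iff\<close>)

lemma total_degree_add: "total_degree (a + b) = total_degree a + total_degree b"
proof -
  let ?S = "Poly_Mapping.keys a \<union> Poly_Mapping.keys b"
  have "Poly_Mapping.keys (a + b) \<subseteq> ?S"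
    by (rule Poly_Mapping.keys_add)
  then show ?thesis
    by (simp add: total_degree_superset[of ?S] lookup_add sum.distrib)
qed

lemma total_degree_zero [simp]: "total_degree 0 = 0"
  by (simp add: total_degree_def)

definition expo_splits :: "expo \<Rightarrow> (expo \<times> expo) set" where
  "expo_splits c = {(a, b). a + b = c}"

lemma mem_expo_splits [simp]: "(a, b) \<in> expo_splits c \<longleftrightarrow> a + b = c"
  by (simp add: expo_splits_def)

lemma finite_expo_splits [simp]: "finite (expo_splits c)"
proof -
  define B where "B = {a :: expo. \<forall>i. Poly_Mapping.lookup a i \<le> Poly_Mapping.lookup c i}"
  define M where "M = Max (insert 0 (Poly_Mapping.lookup c ` Poly_Mapping.keys c))"
  have M: "Poly_Mapping.lookup c i \<le> M" if "i \<in> Poly_Mapping.keys c" for i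
    unfolding M_def using that by (intro Max_ge) auto
  have "Poly_Mapping.lookup ` B \<subseteq>
      {f. \<forall>i. (i \<in> Poly_Mapping.keys c \<longrightarrow> f i \<in> {..M}) \<and> (i \<notin> Poly_Mapping.keys c \<longrightarrow> f i = 0)}"
  proof (intro image_subsetI CollectI allI conjI impI)
    fix a i
    assume "a \<in> B"
    then have le: "Poly_Mapping.lookup a i \<le> Poly_Mapping.lookup c i"
      by (simp add: B_def)
    show "Poly_Mapping.lookup a i \<in> {..M}" if "i \<in> Poly_Mapping.keys c"
      using order_trans[OF le M[OF that]] by simp
    show "Poly_Mapping.lookup a i = 0" if "i \<notin> Poly_Mapping.keys c"
      using le that by (simp add: in_keys_iff)
  qed
  moreover have "finite {f. \<forall>i. (i \<in> Poly_Mapping.keys c \<longrightarrow> f i \<in> {..M}) \<and>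
      (i \<notin> Poly_Mapping.keys c \<longrightarrow> f i = (0::nat))}"
    by (rule finite_set_of_finite_funs) auto
  ultimately have "finite (Poly_Mapping.lookup ` B)"
    by (rule finite_subset)
  then have "finite B"
    by (rule finite_imageD) (simp add: inj_on_def lookup_inject)
  moreover have "expo_splits c \<subseteq> B \<times> B"
    by (auto simp: expo_splits_def B_def lookup_add)
  ultimately show ?thesis
    by (meson finite_SigmaI finite_subset)
qed

lemma map_key_inverse:
  assumes "bij (\<pi> :: nat \<Rightarrow> nat)"
  shows "Poly_Mapping.map_key \<pi> (Poly_Mapping.map_key (inv \<pi>) a) = a"
    and "Poly_Mapping.map_key (inv \<pi>) (Poly_Mapping.map_key \<pi> a) = a"
proof -
  have inj: "inj \<pi>" "inj (inv \<pi>)"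
    using assms by (simp_all add: bij_is_inj bij_imp_bij_inv)
  have "inv \<pi> \<circ> \<pi> = (\<lambda>x. x)" "\<pi> \<circ> inv \<pi> = (\<lambda>x. x)"
    using assms by (auto simp: fun_eq_iff bij_is_inj bij_is_surj surj_f_inv_f)
  then show "Poly_Mapping.map_key \<pi> (Poly_Mapping.map_key (inv \<pi>) a) = a"
    and "Poly_Mapping.map_key (inv \<pi>) (Poly_Mapping.map_key \<pi> a) = a"
    by (simp_all only: map_key_compose[OF inj] map_key_compose[OF inj(2,1)] map_key_id)
qed

instantiation symfun :: comm_ring_1
begin

lift_definition zero_symfun :: symfun is "\<lambda>_. 0"
  by simp

lift_definition one_symfun :: symfun is "\<lambda>a. if a = 0 then 1 else 0"
proof (intro conjI allI impI)
  show "\<exists>d. \<forall>a. (if a = 0 then 1 else 0 :: qalpha) \<noteq> 0 \<longrightarrow> total_degree a \<le> d"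
    by (rule exI[of _ 0]) auto
next
  fix \<pi> :: "nat \<Rightarrow> nat" and a :: expo
  assume "bij \<pi>"
  then have "Poly_Mapping.map_key \<pi> a = 0 \<longleftrightarrow> a = 0"
    by (metis bij_imp_bij_inv bij_is_inj map_key_inverse(2) map_key_zero)
  then show "(if Poly_Mapping.map_key \<pi> a = 0 then 1 else 0 :: qalpha) = (if a = 0 then 1 else 0)"
    by simp
qed

lift_definition plus_symfun :: "symfun \<Rightarrow> symfun \<Rightarrow> symfun" is "\<lambda>f g a. f a + g a"
proof (intro conjI allI impI; elim conjE exE)
  fix f g :: "expo \<Rightarrow> qalpha" and d e
  assume "\<forall>a. f a \<noteq> 0 \<longrightarrow> total_degree a \<le> d" "\<forall>a. g a \<noteq> 0 \<longrightarrow> total_degree a \<le> e"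
  then show "\<exists>d. \<forall>a. f a + g a \<noteq> 0 \<longrightarrow> total_degree a \<le> d"
    by (intro exI[of _ "max d e"]) (metis add.right_neutral max.coboundedI1 max.coboundedI2)
qed simp

lift_definition uminus_symfun :: "symfun \<Rightarrow> symfun" is "\<lambda>f a. - f a"
  by simp

lift_definition minus_symfun :: "symfun \<Rightarrow> symfun \<Rightarrow> symfun" is "\<lambda>f g a. f a - g a"
proof (intro conjI allI impI; elim conjE exE)
  fix f g :: "expo \<Rightarrow> qalpha" and d e
  assume "\<forall>a. f a \<noteq> 0 \<longrightarrow> total_degree a \<le> d" "\<forall>a. g a \<noteq> 0 \<longrightarrow> total_degree a \<le> e"
  then show "\<exists>d. \<forall>a. f a - g a \<noteq> 0 \<longrightarrow> total_degree a \<le> d"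
    by (intro exI[of _ "max d e"]) (metis diff_zero max.coboundedI1 max.coboundedI2)
qed simp

lift_definition times_symfun :: "symfun \<Rightarrow> symfun \<Rightarrow> symfun" is
  "\<lambda>f g c. \<Sum>(a, b)\<in>expo_splits c. f a * g b"
proof (intro conjI allI impI; elim conjE exE)
  fix f g :: "expo \<Rightarrow> qalpha" and d e
  assume f: "\<forall>a. f a \<noteq> 0 \<longrightarrow> total_degree a \<le> d" and g: "\<forall>a. g a \<noteq> 0 \<longrightarrow> total_degree a \<le> e"
  have "total_degree c \<le> d + e" if nz: "(\<Sum>(a, b)\<in>expo_splits c. f a * g b) \<noteq> 0" for c
  proof -
    obtain ab where "ab \<in> expo_splits c" "(case ab of (a, b) \<Rightarrow> f a * g b) \<noteq> 0"
      using nz by (rule sum.not_neutral_contains_not_neutral)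
    then obtain a b where "a + b = c" "f a * g b \<noteq> 0"
      by (cases ab) auto
    then show ?thesis
      using f g total_degree_add[of a b] by (auto intro!: add_mono)
  qed
  then show "\<exists>d. \<forall>c. (\<Sum>(a, b)\<in>expo_splits c. f a * g b) \<noteq> 0 \<longrightarrow> total_degree c \<le> d"
    by blast
next
  fix f g :: "expo \<Rightarrow> qalpha" and \<pi> :: "nat \<Rightarrow> nat" and c
  assume \<pi>: "bij \<pi>"
    and f: "\<forall>\<pi> a. bij \<pi> \<longrightarrow> f (Poly_Mapping.map_key \<pi> a) = f a"
    and g: "\<forall>\<pi> a. bij \<pi> \<longrightarrow> g (Poly_Mapping.map_key \<pi> a) = g a"
  let ?m = "Poly_Mapping.map_key \<pi>" and ?n = "Poly_Mapping.map_key (inv \<pi>)"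
  have inj: "inj \<pi>" "inj (inv \<pi>)"
    using \<pi> by (simp_all add: bij_is_inj bij_imp_bij_inv)
  show "(\<Sum>(a, b)\<in>expo_splits (?m c). f a * g b) = (\<Sum>(a, b)\<in>expo_splits c. f a * g b)"
    by (rule sum.reindex_bij_witness[where i = "\<lambda>(a, b). (?m a, ?m b)" and j = "\<lambda>(a, b). (?n a, ?n b)"])
      (use \<pi> f g inj in \<open>auto simp: map_key_inverse map_key_plus[symmetric] bij_imp_bij_inv\<close>)
qed

instance
proof
  fix f g h :: symfun
  show "f * g * h = f * (g * h)"
  proof (transfer, rule ext)
    fix f g h :: "expo \<Rightarrow> qalpha" and k
    have "(\<Sum>(x, c)\<in>expo_splits k. (\<Sum>(a, b)\<in>expo_splits x. f a * g b) * h c) =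
        (\<Sum>((x, c), (a, b))\<in>(SIGMA (x, c):expo_splits k. expo_splits x). f a * g b * h c)"
      by (subst sum.Sigma[symmetric]) (auto simp: sum_distrib_right case_prod_beta)
    also have "\<dots> = (\<Sum>((a, y), (b, c))\<in>(SIGMA (a, y):expo_splits k. expo_splits y). f a * (g b * h c))"
      by (rule sum.reindex_bij_witness[where i = "\<lambda>((a, y), (b, c)). ((a + b, c), (a, b))"
            and j = "\<lambda>((x, c), (a, b)). ((a, b + c), (b, c))"])
        (auto simp: ac_simps)
    also have "\<dots> = (\<Sum>(a, y)\<in>expo_splits k. f a * (\<Sum>(b, c)\<in>expo_splits y. g b * h c))"
      by (subst sum.Sigma[symmetric]) (auto simp: sum_distrib_left case_prod_beta)
    finally show "(\<Sum>(x, c)\<in>expo_splits k. (\<Sum>(a, b)\<in>expo_splits x. f a * g b) * h c) =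
        (\<Sum>(a, y)\<in>expo_splits k. f a * (\<Sum>(b, c)\<in>expo_splits y. g b * h c))" .
  qed
  show "f * g = g * f"
  proof (transfer, rule ext)
    fix f g :: "expo \<Rightarrow> qalpha" and c
    show "(\<Sum>(a, b)\<in>expo_splits c. f a * g b) = (\<Sum>(a, b)\<in>expo_splits c. g a * f b)"
      by (rule sum.reindex_bij_witness[where i = prod.swap and j = prod.swap])
        (auto simp: ac_simps)
  qed
  show "1 * f = f"
  proof (transfer, rule ext)
    fix f :: "expo \<Rightarrow> qalpha" and c
    have "(\<Sum>(a, b)\<in>expo_splits c. (if a = 0 then 1 else 0) * f b) =
        (\<Sum>(a, b)\<in>{(0 :: expo, c)}. (if a = 0 then 1 else 0) * f b)"
      by (rule sum.mono_neutral_right) (auto split: if_splits)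
    then show "(\<Sum>(a, b)\<in>expo_splits c. (if a = 0 then 1 else 0) * f b) = f c"
      by simp
  qed
  show "(f + g) * h = f * h + g * h"
    by transfer (auto simp: distrib_right sum.distrib case_prod_beta)
  show "f + g + h = f + (g + h)" "f + g = g + f" "0 + f = f" "- f + f = 0" "f - g = f + - g"
    by (transfer; simp add: ac_simps)+
  show "(0 :: symfun) \<noteq> 1"
    by transfer (auto simp: fun_eq_iff)
qed

end

definition scale :: "qalpha \<Rightarrow> symfun \<Rightarrow> symfun" (infixr "*s" 75) where
  "c *s f = Abs_symfun (\<lambda>a. c * mcoeff f a)"

lemma mcoeff_scale: "mcoeff (c *s f) = (\<lambda>a. c * mcoeff f a)"
  using mcoeff[of f] unfolding scale_def by (subst Abs_symfun_inverse) auto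

global_interpretation symfun: vector_space scale
  by standard (simp_all add: mcoeff_inject[symmetric] mcoeff_scale plus_symfun.rep_eq
      algebra_simps)

text \<open>A partition is the weakly decreasing list of its non-zero parts, so \<open>\<ell>(lam)\<close> is \<open>length\<close>.\<close>

type_synonym partition = "nat list"

definition partitions :: "partition set" where
  "partitions = {lam. sorted_wrt (\<ge>) lam \<and> 0 \<notin> set lam}"

definition part :: "partition \<Rightarrow> nat \<Rightarrow> nat" where
  "part lam i = (if 1 \<le> i \<and> i \<le> length lam then lam ! (i - 1) else 0)"

definition d_coeff :: "partition \<Rightarrow> nat" where
  "d_coeff lam = (\<Prod>i\<in>set lam. fact (count_list lam i))"

definition z_coeff :: "partition \<Rightarrow> nat" where
  "z_coeff lam = (\<Prod>i\<in>set lam. i ^ count_list lam i * fact (count_list lam i))"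

definition expo_type :: "expo \<Rightarrow> nat multiset" where
  "expo_type a = image_mset (Poly_Mapping.lookup a) (mset_set (Poly_Mapping.keys a))"

lemma sum_mset_expo_type: "sum_mset (expo_type a) = total_degree a"
  by (simp add: expo_type_def total_degree_def sum_unfold_sum_mset)

lemma expo_type_map_key:
  assumes "bij \<pi>"
  shows "expo_type (Poly_Mapping.map_key \<pi> a) = expo_type a"
proof -
  have inj: "inj \<pi>" and surj: "surj \<pi>"
    using assms by (simp_all add: bij_is_inj bij_is_surj)
  have "expo_type a = image_mset (Poly_Mapping.lookup a) (mset_set (\<pi> ` (\<pi> -` Poly_Mapping.keys a)))"
    unfolding expo_type_def surj_image_vimage_eq[OF surj] ..
  also have "\<dots> = image_mset (Poly_Mapping.lookup a) (image_mset \<pi> (mset_set (\<pi> -` Poly_Mapping.keys a)))"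
    using inj by (subst image_mset_mset_set) (auto intro: inj_on_subset)
  also have "\<dots> = expo_type (Poly_Mapping.map_key \<pi> a)"
    unfolding expo_type_def keys_map_key[OF inj] map_key.rep_eq[OF inj] multiset.map_comp ..
  finally show ?thesis ..
qed

lift_definition msym :: "partition \<Rightarrow> symfun" is
  "\<lambda>lam a. if expo_type a = mset lam then 1 else 0"
proof (intro conjI allI impI)
  fix lam :: partition
  show "\<exists>d. \<forall>a. (if expo_type a = mset lam then 1 else 0 :: qalpha) \<noteq> 0 \<longrightarrow> total_degree a \<le> d"
    by (rule exI[of _ "sum_list lam"]) (auto simp: sum_mset_expo_type[symmetric] sum_mset_sum_list)
qed (simp add: expo_type_map_key)

definition esym :: "nat \<Rightarrow> symfun" where
  "esym n = msym (replicate n 1)"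

text \<open>For \<open>n \<ge> 1\<close>, \<open>psum n\<close> is the sum of the monomials \<open>x\<^sub>i\<^sup>n\<close>; the index 0 is not used.\<close>

definition psum :: "nat \<Rightarrow> symfun" where
  "psum n = msym [n]"

lemma mcoeff_psum:
  assumes "n \<ge> 1"
  shows "mcoeff (psum n) a = (if \<exists>i. a = Poly_Mapping.single i n then 1 else 0)"
proof -
  have "expo_type a = {#n#} \<longleftrightarrow> (\<exists>i. a = Poly_Mapping.single i n)"
  proof
    assume *: "expo_type a = {#n#}"
    then have "size (expo_type a) = 1"
      by simp
    then have "card (Poly_Mapping.keys a) = 1"
      by (simp add: expo_type_def)
    then obtain i where i: "Poly_Mapping.keys a = {i}"
      by (auto simp: card_1_singleton_iff)
    then have "Poly_Mapping.lookup a i = n"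
      using * by (simp add: expo_type_def)
    then have "a = Poly_Mapping.single i n"
      using i by (intro poly_mapping_eqI) (auto simp: lookup_single when_def in_keys_iff)
    then show "\<exists>i. a = Poly_Mapping.single i n" ..
  next
    assume "\<exists>i. a = Poly_Mapping.single i n"
    then show "expo_type a = {#n#}"
      using assms by (auto simp: expo_type_def)
  qed
  then show ?thesis
    by (simp add: psum_def msym.rep_eq)
qed

definition p_part :: "partition \<Rightarrow> symfun" where
  "p_part lam = prod_list (map psum lam)"

text \<open>The coefficient of \<open>p_part lam\<close> in the expansion of \<open>f\<close> in the basis of power sum products.\<close>

definition p_coeff :: "partition \<Rightarrow> symfun \<Rightarrow> qalpha" where
  "p_coeff lam f = symfun.representation (p_part ` partitions) f (p_part lam)"

text \<open>
  Below, \<open>sum'\<close> and \<open>prod'\<close> are applied to infinite index sets where only finitely many terms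
  differ from 0 or 1, respectively (otherwise they would return 0 or 1). For operators this holds
  after application to a fixed \<open>f\<close>, by degree reasons.

  Partial differentiation on the polynomial ring in the \<open>psum n\<close>: the linear map which sends the
  monomial \<open>p_part lam\<close>, in which \<open>psum n\<close> occurs with power \<open>k = count_list lam n\<close>, to \<open>k\<close> times the
  monomial with one factor \<open>psum n\<close> removed.
\<close>

definition p_diff :: "nat \<Rightarrow> symfun \<Rightarrow> symfun" where
  "p_diff n f =
    sum' (\<lambda>lam. (p_coeff lam f * of_nat (count_list lam n)) *s p_part (remove1 n lam)) partitions"

text \<open>\<open>p_form c\<close> is the form with \<open>\<langle>p\<^sub>\<lambda>, p\<^sub>\<mu>\<rangle> = c\<close> to the power \<open>\<ell>(\<lambda>)\<close> times \<open>z\<^sub>\<lambda> \<delta>\<^sub>\<lambda>\<^sub>\<mu>\<close>.\<close>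

definition p_form :: "qalpha \<Rightarrow> symfun \<Rightarrow> symfun \<Rightarrow> qalpha" where
  "p_form c f g =
    sum' (\<lambda>lam. c ^ length lam * of_nat (z_coeff lam) * p_coeff lam f * p_coeff lam g) partitions"

definition form :: "symfun \<Rightarrow> symfun \<Rightarrow> qalpha" where
  "form = p_form 1"

definition form_alpha :: "symfun \<Rightarrow> symfun \<Rightarrow> qalpha" where
  "form_alpha = p_form alpha"

definition adjoint_wrt ::
  "(symfun \<Rightarrow> symfun \<Rightarrow> qalpha) \<Rightarrow> (symfun \<Rightarrow> symfun) \<Rightarrow> (symfun \<Rightarrow> symfun)" where
  "adjoint_wrt B T = (THE T'. \<forall>f g. B (T' f) g = B f (T g))"

definition perp :: "symfun \<Rightarrow> symfun \<Rightarrow> symfun" where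
  "perp f = adjoint_wrt form (\<lambda>g. f * g)"

definition star :: "symfun \<Rightarrow> symfun \<Rightarrow> symfun" where
  "star f = adjoint_wrt form_alpha (\<lambda>g. f * g)"

definition p_star :: "nat \<Rightarrow> symfun \<Rightarrow> symfun" where
  "p_star n f = (alpha * of_nat n) *s p_diff n f"

definition dominated :: "partition \<Rightarrow> partition \<Rightarrow> bool" where
  "dominated \<mu> lam \<longleftrightarrow>
    sum_list \<mu> = sum_list lam \<and> (\<forall>i. sum_list (take i \<mu>) \<le> sum_list (take i lam))"

definition jack_family :: "(partition \<Rightarrow> symfun) \<Rightarrow> bool" where
  "jack_family J \<longleftrightarrow>
    (\<forall>lam\<in>partitions. \<forall>\<mu>\<in>partitions. lam \<noteq> \<mu> \<longrightarrow> form_alpha (J lam) (J \<mu>) = 0) \<and>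
    (\<forall>lam\<in>partitions.
      J lam - msym lam \<in> symfun.span (msym ` {\<mu> \<in> partitions. dominated \<mu> lam \<and> \<mu> \<noteq> lam}))"

text \<open>
  In all formal power series below the variable \<open>fps_X\<close> is \<open>u\<^sup>-\<^sup>1\<close>; an operator-valued series is
  an element of \<open>(symfun \<Rightarrow> symfun) fps\<close>, whose coefficient at index \<open>r\<close> is that of the power
  \<open>-r\<close> of \<open>u\<close>. The eigenvalue is the product over \<open>i \<ge> 1\<close> of
  \<open>(u + i - 1 - \<alpha> lam\<^sub>i) / (u + i - 1)\<close>, with numerator and denominator divided by \<open>u\<close>.
\<close>

unbundle fps_syntax

definition A_eigenvalue :: "partition \<Rightarrow> qalpha fps" where
  "A_eigenvalue lam =
    prod' (\<lambda>i. (1 + fps_const (of_nat (i - 1) - alpha * of_nat (part lam i)) * fps_X) /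
               (1 + fps_const (of_nat (i - 1)) * fps_X)) {1..}"

definition diagonal_in ::
  "(partition \<Rightarrow> symfun) \<Rightarrow> (partition \<Rightarrow> qalpha fps) \<Rightarrow> (symfun \<Rightarrow> symfun) fps \<Rightarrow> bool" where
  "diagonal_in J c A \<longleftrightarrow>
    (\<forall>r. Vector_Spaces.linear scale scale (A $ r)) \<and>
    (\<forall>r. \<forall>lam\<in>partitions. (A $ r) (J lam) = (c lam $ r) *s J lam)"

text \<open>
  Substitution of \<open>u + 1\<close> for \<open>u\<close>: the inverse of \<open>u + 1\<close> is \<open>fps_X / (1 + fps_X)\<close>, and the
  power \<open>s\<close> of it only contributes to the coefficients at \<open>r \<ge> s\<close>.
\<close>

definition shift_u :: "(symfun \<Rightarrow> symfun) fps \<Rightarrow> (symfun \<Rightarrow> symfun) fps" where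
  "shift_u A =
    Abs_fps (\<lambda>r f. \<Sum>s\<le>r. (((fps_X / (1 + fps_X)) ^ s :: qalpha fps) $ r) *s (A $ s) f)"

text \<open>Row and column indices start from 1, and \<open>p\<^sub>0 = 0\<close> on the diagonal.\<close>

definition Lmat :: "nat \<Rightarrow> nat \<Rightarrow> symfun \<Rightarrow> symfun" where
  "Lmat i j f =
    (if i = j then (of_nat j * (alpha - 1)) *s f
     else if i < j then psum (j - i) * f
     else p_star (i - j) f)"

text \<open>
  \<open>L_power_p_star r i\<close> is entry \<open>i\<close> of the column vector of operators obtained by multiplying
  the column of the \<open>p_star j\<close>, \<open>j \<ge> 1\<close>, from the left by \<open>Lmat\<close>, \<open>r\<close> times; this performs the
  summations over intermediate indices starting from the rightmost one.
\<close>

fun L_power_p_star :: "nat \<Rightarrow> nat \<Rightarrow> symfun \<Rightarrow> symfun" where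
  "L_power_p_star 0 i f = p_star i f"
| "L_power_p_star (Suc r) i f = sum' (\<lambda>j. Lmat i j (L_power_p_star r j f)) {1..}"

text \<open>
  Entry \<open>n\<close> of \<open>(u - L)\<^sup>-\<^sup>1 p\<^sup>* A(u + 1)\<close>; the power \<open>r\<close> of \<open>L\<close> comes with \<open>u\<close> to the power \<open>- r - 1\<close>.
\<close>

definition Psi :: "(symfun \<Rightarrow> symfun) fps \<Rightarrow> nat \<Rightarrow> (symfun \<Rightarrow> symfun) fps" where
  "Psi A n =
    Abs_fps (\<lambda>t f. \<Sum>(r, s) | r + 1 + s = t. L_power_p_star r n ((shift_u A $ s) f))"

definition inverse_shifted_pochhammer :: "nat \<Rightarrow> qalpha fps" where
  "inverse_shifted_pochhammer k = fps_X ^ k / (\<Prod>i=1..k. 1 + fps_const (of_nat i) * fps_X)"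

text \<open>
  \<open>F(u)\<close> is the sum over \<open>k \<ge> 1\<close> of \<open>G k / (u + 1)\<^sub>k\<close>. As \<open>1 / (u + 1)\<^sub>k\<close> starts with the power \<open>k\<close>
  of \<open>u\<^sup>-\<^sup>1\<close>, only \<open>k \<le> t\<close> contribute to the coefficient at \<open>t\<close>.
\<close>

definition pochhammer_expansion ::
  "(symfun \<Rightarrow> symfun) fps \<Rightarrow> (nat \<Rightarrow> symfun \<Rightarrow> symfun) \<Rightarrow> bool" where
  "pochhammer_expansion F G \<longleftrightarrow>
    (\<forall>t f. (F $ t) f = (\<Sum>k=1..t. (inverse_shifted_pochhammer k $ t) *s G k f))"

end

theory Submission
  imports Defs "HOL-Combinatorics.Permutations"
begin

text \<open>
  The proof rests on two facts. The first is that \<open>A(u)\<close> is the sum over \<open>k\<close> of \<open>(-1)\<^sup>k D\<^sub>k / (u)\<^sub>k\<close>, where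
  \<open>D\<^sub>k\<close> is the sum of \<open>d\<^sub>\<lambda> m\<^sub>\<lambda> m\<^sub>\<lambda>\<^sup>*\<close> over \<open>\<ell>(\<lambda>) = k\<close>. Since \<open>D\<^sub>k\<close> is self-adjoint, it is diagonal on the
  Jack functions if it is triangular on the \<open>m\<^sub>\<lambda>\<close>. For an exponent \<open>a\<close> of type \<open>\<lambda>\<close> put \<open>M\<^sub>a = d\<^sub>\<lambda> m\<^sub>\<lambda>\<close>.
  Then \<open>D\<^sub>k f\<close> is the sum over all \<open>k\<close>-sets \<open>I\<close> of variables of \<open>W\<^sub>I f\<close>, the sum of \<open>x\<^sup>a M\<^sub>a\<^sup>* f\<close> over the
  exponents \<open>a\<close> with support \<open>I\<close>. The rule for \<open>p\<^sub>b M\<^sub>a\<close> together with \<open>\<Sum>\<^sub>b x\<^sub>j\<^sup>b p\<^sub>b\<^sup>* = \<alpha> x\<^sub>j \<partial>/\<partial>x\<^sub>j\<close> shows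
  that a new variable \<open>x\<^sub>j\<close> is added to \<open>I\<close> by the Dunkl type operator
  \<open>\<alpha> x\<^sub>j \<partial>/\<partial>x\<^sub>j + \<Sum>\<^sub>s (x\<^sub>j - x\<^sub>s K) / (x\<^sub>j - x\<^sub>s)\<close>, where \<open>s\<close> runs over \<open>I\<close> and \<open>K\<close> exchanges \<open>x\<^sub>s\<close> and \<open>x\<^sub>j\<close>.
  This operator is triangular, and its diagonal entry at \<open>x\<^sup>a\<close> is \<open>\<alpha> a\<^sub>j + |I|\<close> if no \<open>a\<^sub>s\<close> exceeds \<open>a\<^sub>j\<close>.

  The second fact is that the claimed coefficients solve \<open>(u - L) \<Psi>(u) = p\<^sup>* A(u + 1)\<close>. Write
  \<open>E\<^sub>n = (-1)\<^sup>n e\<^sub>n\<^sup>\<bottom>\<close> and compare the coefficients of \<open>1 / (u + 1)\<^sub>k\<close>. Newton's identity, that is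
  \<open>n E\<^sub>n = - \<Sum>\<^sub>r r \<partial>/\<partial>p\<^sub>r E\<^bsub>n-r\<^esub>\<close>, makes \<open>\<alpha>\<close> cancel. What remains is an identity between the
  functions \<open>E\<^sub>j M\<^sub>a\<close>. It follows by induction on the size of the support of \<open>a\<close>, because \<open>- E\<^sub>n M\<^sub>a\<close> for
  \<open>n \<ge> 1\<close> is the sum of \<open>E\<^bsub>n-r\<^esub> M\<^sub>b\<close> over all ways to remove one entry \<open>r\<close> from \<open>a\<close>, leaving \<open>b\<close>.
\<close>

section \<open>Augmented monomial symmetric functions\<close>

abbreviation "keys \<equiv> Poly_Mapping.keys"
abbreviation "lookup \<equiv> Poly_Mapping.lookup"
abbreviation "single \<equiv> Poly_Mapping.single"

lemmas lookup_simps = lookup_add lookup_minus lookup_single when_def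

lemma mcoeff_zero [simp]: "mcoeff 0 a = 0"
  by (simp add: zero_symfun.rep_eq)

lemma mcoeff_add [simp]: "mcoeff (f + g) a = mcoeff f a + mcoeff g a"
  by (simp add: plus_symfun.rep_eq)

lemma mcoeff_diff [simp]: "mcoeff (f - g) a = mcoeff f a - mcoeff g a"
  by (simp add: minus_symfun.rep_eq)

lemma mcoeff_scale_apply [simp]: "mcoeff (c *s f) a = c * mcoeff f a"
  by (simp add: mcoeff_scale)

lemma mcoeff_sum: "mcoeff (sum f S) a = (\<Sum>x\<in>S. mcoeff (f x) a)"
  by (induction S rule: infinite_finite_induct) auto

lemma mcoeff_sum_mset: "mcoeff (\<Sum>x\<in>#A. f x) a = (\<Sum>x\<in>#A. mcoeff (f x) a)"
  by (induction A) auto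

lemma sum_mset_eq_sum_count:
  "(\<Sum>x\<in>#A. f x) = (\<Sum>x\<in>set_mset A. of_nat (count A x) * f x)" for f :: "'a \<Rightarrow> 'b::comm_semiring_1"
proof (induction A)
  case (add x A)
  have "(\<Sum>y\<in>set_mset (add_mset x A). of_nat (count (add_mset x A) y) * f y) =
      (\<Sum>y\<in>insert x (set_mset A). of_nat (count A y) * f y + (if y = x then f y else 0))"
    by (rule sum.cong) (auto simp: distrib_right add.commute)
  also have "\<dots> = (\<Sum>y\<in>insert x (set_mset A). of_nat (count A y) * f y) + f x"
    by (simp add: sum.distrib)
  also have "(\<Sum>y\<in>insert x (set_mset A). of_nat (count A y) * f y) = (\<Sum>y\<in>set_mset A. of_nat (count A y) * f y)"
    by (rule sum.mono_neutral_right) (auto simp: not_in_iff)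
  finally show ?case
    using add by (simp add: add.commute)
qed simp

lemma mcoeff_mult: "mcoeff (f * g) c = (\<Sum>(a, b)\<in>expo_splits c. mcoeff f a * mcoeff g b)"
  by (simp add: times_symfun.rep_eq)

lemma symfun_eqI: "(\<And>a. mcoeff f a = mcoeff g a) \<Longrightarrow> f = g"
  by (simp add: mcoeff_inject[symmetric] fun_eq_iff)

lemma scale_mult_left [simp]: "(c *s f) * g = c *s (f * g)"
  by (rule symfun_eqI) (simp add: mcoeff_mult sum_distrib_left case_prod_beta mult.assoc)

lemma scale_mult_right [simp]: "f * (c *s g) = c *s (f * g)"
  by (metis mult.commute scale_mult_left)

lemma of_nat_mult_eq_scale: "of_nat n * f = of_nat n *s f"
  by (induction n) (simp_all add: algebra_simps symfun.scale_left_distrib)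

lemma minus_one_mult_eq_scale: "(- 1) ^ n * f = ((- 1) ^ n) *s f" for f :: symfun
  by (induction n) (simp_all add: symfun.scale_minus_left flip: symfun.scale_minus_left)

text \<open>Natural subtraction of exponents truncates, so only variables with exponent at least
  \<open>r\<close> may be lowered; \<open>r \<ge> 1\<close> makes their set finite.\<close>

lemma mcoeff_psum_mult:
  assumes "r \<ge> 1"
  shows "mcoeff (psum r * h) d = (\<Sum>i | r \<le> lookup d i. mcoeff h (d - single i r))"
proof -
  have fin: "finite {i. r \<le> lookup d i}"
    by (rule finite_subset[OF _ finite_keys[of d]]) (use assms in \<open>auto simp: in_keys_iff\<close>)
  have "mcoeff (psum r * h) d = (\<Sum>(a, b)\<in>expo_splits d. if \<exists>i. a = single i r then mcoeff h b else 0)"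
    unfolding mcoeff_mult by (intro sum.cong) (auto simp: mcoeff_psum[OF assms])
  also have "\<dots> = (\<Sum>(a, b)\<in>(\<lambda>i. (single i r, d - single i r)) ` {i. r \<le> lookup d i}. mcoeff h b)"
  proof (rule sum.mono_neutral_cong_right)
    show "(\<lambda>i. (single i r, d - single i r)) ` {i. r \<le> lookup d i} \<subseteq> expo_splits d"
      by (auto intro!: poly_mapping_eqI simp: lookup_simps)
    show "\<forall>x\<in>expo_splits d - (\<lambda>i. (single i r, d - single i r)) ` {i. r \<le> lookup d i}.
      (case x of (a, b) \<Rightarrow> if \<exists>i. a = single i r then mcoeff h b else 0) = 0"
      by (fastforce simp: image_iff lookup_add)
  qed auto
  also have "\<dots> = (\<Sum>i | r \<le> lookup d i. mcoeff h (d - single i r))"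
    by (subst sum.reindex)
      (use assms in \<open>auto simp: inj_on_def poly_mapping_eq_iff fun_eq_iff lookup_single when_def split: if_splits\<close>)
  finally show ?thesis .
qed

text \<open>Padding with zeros lets exponents with different supports be compared on one common
  finite set of variables.\<close>

lemma expo_type_superset:
  assumes "finite S" "keys a \<subseteq> S"
  shows "image_mset (lookup a) (mset_set S) = expo_type a + replicate_mset (card (S - keys a)) 0"
proof -
  have "mset_set S = mset_set (keys a) + mset_set (S - keys a)"
    using assms by (metis Diff_disjoint Un_Diff_cancel finite_Diff finite_keys mset_set_Union sup.absorb2)
  moreover have "image_mset (lookup a) (mset_set (S - keys a)) = image_mset (\<lambda>_. 0) (mset_set (S - keys a))"
    by (rule image_mset_cong) (use assms in \<open>auto simp: in_keys_iff\<close>)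
  ultimately show ?thesis
    by (simp add: expo_type_def image_mset_const_eq)
qed

lemma size_expo_type: "size (expo_type a) = card (keys a)"
  by (simp add: expo_type_def)

lemma zero_notin_expo_type [simp]: "0 \<notin># expo_type a"
  by (auto simp: expo_type_def in_keys_iff)

text \<open>Symmetry is invariance under bijections of the variables. Exponents of equal type are
  related by a permutation of the union of their supports, which fixes all other variables.\<close>

lemma mcoeff_expo_type:
  assumes "expo_type a = expo_type b"
  shows "mcoeff f a = mcoeff f b"
proof -
  let ?S = "keys a \<union> keys b"
  have card: "card (keys a) = card (keys b)"
    using assms by (metis size_expo_type)
  have "card (?S - keys a) = card (?S - keys b)"
    using card by (simp add: card_Diff_subset)
  then have "image_mset (lookup a) (mset_set ?S) = image_mset (lookup b) (mset_set ?S)"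
    using assms by (simp add: expo_type_superset)
  then obtain p where p: "p permutes ?S" "\<forall>x\<in>?S. lookup a x = lookup b (p x)"
    by (rule image_mset_eq_implies_permutes[rotated]) auto
  have bij: "bij p"
    using p(1) by (rule permutes_bij)
  have "lookup a x = lookup b (p x)" for x
  proof (cases "x \<in> ?S")
    case False
    then have "p x = x"
      using p(1) by (simp add: permutes_not_in)
    then show ?thesis
      using False by (simp add: in_keys_iff)
  qed (use p in auto)
  then have "a = Poly_Mapping.map_key p b"
    by (intro poly_mapping_eqI) (simp add: map_key.rep_eq bij_is_inj[OF bij])
  then show ?thesis
    using bij mcoeff[of f] by auto
qed

lemma expo_type_add_single_fresh:
  assumes "j \<notin> keys a" "b \<noteq> 0"
  shows "expo_type (a + single j b) = add_mset b (expo_type a)"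
proof -
  have k: "keys (a + single j b) = insert j (keys a)"
    using assms by (auto simp: in_keys_iff lookup_simps split: if_splits)
  have "image_mset (lookup (a + single j b)) (mset_set (keys a)) = image_mset (lookup a) (mset_set (keys a))"
    by (rule image_mset_cong) (use assms in \<open>auto simp: lookup_simps\<close>)
  moreover have "lookup (a + single j b) j = b"
    using assms by (simp add: lookup_add in_keys_iff)
  ultimately show ?thesis
    using assms by (simp add: expo_type_def k)
qed

lemma expo_type_split:
  "expo_type a = (if lookup a j = 0 then {#} else {#lookup a j#}) + expo_type (a - single j (lookup a j))"
proof (cases "lookup a j = 0")
  case False
  have "a = (a - single j (lookup a j)) + single j (lookup a j)"
    by (rule poly_mapping_eqI) (auto simp: lookup_simps)
  moreover have "j \<notin> keys (a - single j (lookup a j))"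
    by (simp add: in_keys_iff lookup_minus)
  ultimately have "expo_type a = add_mset (lookup a j) (expo_type (a - single j (lookup a j)))"
    using False expo_type_add_single_fresh by metis
  then show ?thesis using False by simp
qed simp

lemma expo_type_update:
  assumes "a - single j (lookup a j) = b - single j (lookup b j)" "lookup a j \<noteq> 0" "lookup b j \<noteq> 0"
  shows "expo_type b = expo_type a - {#lookup a j#} + {#lookup b j#}"
  using expo_type_split[of a j] expo_type_split[of b j] assms by simp

lemma expo_type_add_single:
  assumes "s \<in> keys a"
  shows "expo_type (a + single s b) = expo_type a - {#lookup a s#} + {#lookup a s + b#}"
  by (subst expo_type_update[of a s])
    (use assms in \<open>auto simp: lookup_add in_keys_iff intro!: poly_mapping_eqI simp: lookup_simps\<close>)

lemma expo_type_diff_single: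
  assumes "b \<le> lookup a s" "b > 0"
  shows "expo_type (a - single s b) =
    expo_type a - {#lookup a s#} + (if b = lookup a s then {#} else {#lookup a s - b#})"
proof (cases "b = lookup a s")
  case True
  then show ?thesis
    using assms expo_type_split[of a s] by simp
next
  case False
  then show ?thesis
    by (subst expo_type_update[of a s])
      (use assms in \<open>auto simp: lookup_minus in_keys_iff intro!: poly_mapping_eqI simp: lookup_simps\<close>)
qed

lemma ex_expo_type:
  assumes "0 \<notin># A"
  shows "\<exists>a. expo_type a = A"
  using assms
proof (induction A)
  case empty
  have "expo_type 0 = {#}" by (simp add: expo_type_def)
  then show ?case by blast
next
  case (add x A)
  then obtain a where a: "expo_type a = A" by auto
  obtain j where "j \<notin> keys a"
    using ex_new_if_finite[OF infinite_UNIV_nat finite_keys] by blast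
  then show ?case
    using expo_type_add_single_fresh[of j a x] add.prems a by auto
qed

lemma sum_keys_expo_type: "(\<Sum>i\<in>keys a. g (lookup a i)) = (\<Sum>u\<in>#expo_type a. g u)"
  by (simp add: expo_type_def sum_unfold_sum_mset image_mset.compositionality o_def)

section \<open>Partitions as multisets of positive parts\<close>

definition mpart :: "nat multiset \<Rightarrow> partition" where
  "mpart A = rev (sorted_list_of_multiset A)"

lemma mset_mpart [simp]: "mset (mpart A) = A"
  by (simp add: mpart_def)

lemma mpart_mset: "lam \<in> partitions \<Longrightarrow> mpart (mset lam) = lam"
proof -
  assume "lam \<in> partitions"
  then have "sorted (rev lam)"
    by (simp add: partitions_def sorted_wrt_rev)
  then have "sort lam = rev lam"
    by (intro properties_for_sort) auto
  then show ?thesis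
    by (simp add: mpart_def sorted_list_of_multiset_mset)
qed

lemma mpart_partitions: "0 \<notin># A \<Longrightarrow> mpart A \<in> partitions"
  unfolding mpart_def partitions_def by (simp add: sorted_wrt_rev)

lemma length_mpart [simp]: "length (mpart A) = size A"
  by (metis mset_mpart size_mset)

lemma mset_partition_nonzero: "lam \<in> partitions \<Longrightarrow> 0 \<notin># mset lam"
  by (simp add: partitions_def)

lemma partition_eq_iff: "lam \<in> partitions \<Longrightarrow> \<mu> \<in> partitions \<Longrightarrow> lam = \<mu> \<longleftrightarrow> mset lam = mset \<mu>"
  by (metis mpart_mset)

definition dfac :: "nat multiset \<Rightarrow> nat" where
  "dfac A = (\<Prod>i\<in>set_mset A. fact (count A i))"

lemma d_coeff_eq_dfac: "d_coeff lam = dfac (mset lam)"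
  by (simp add: d_coeff_def dfac_def count_mset)

lemma dfac_add_mset: "dfac (add_mset b A) = Suc (count A b) * dfac A"
proof (cases "b \<in># A")
  case True
  then show ?thesis
    by (simp add: dfac_def insert_absorb prod.remove[of "set_mset A" b] algebra_simps)
next
  case False
  have "(\<Prod>i\<in>set_mset A. fact (count (add_mset b A) i)) = (\<Prod>i\<in>set_mset A. fact (count A i) :: nat)"
    by (rule prod.cong) (use False in auto)
  moreover have "count (add_mset b A) b = 1" "count A b = 0"
    using False by (simp_all add: count_eq_zero_iff)
  ultimately show ?thesis
    using False by (simp add: dfac_def del: count_add_mset)
qed

lemma dfac_pos [simp]: "dfac A > 0"
  by (simp add: dfac_def)

text \<open>The sum of \<open>x_{i_1}^{a_1} ... x_{i_k}^{a_k}\<close> over all tuples of distinct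
  indices: each monomial of \<open>m_\<lambda>\<close> arises \<open>d_\<lambda>\<close> times. With
  this normalization the products below carry no multiplicities.\<close>

definition aug :: "nat multiset \<Rightarrow> symfun" where
  "aug A = of_nat (dfac A) *s msym (mpart A)"

lemma mcoeff_msym: "mcoeff (msym lam) a = (if expo_type a = mset lam then 1 else 0)"
  by (simp add: msym.rep_eq)

lemma mcoeff_aug: "mcoeff (aug A) a = (if expo_type a = A then of_nat (dfac A) else 0)"
  by (simp add: aug_def mcoeff_msym)

lemma expo_type_eq_empty_iff [simp]: "expo_type a = {#} \<longleftrightarrow> a = 0"
  by (simp add: expo_type_def mset_set_empty_iff)

lemma aug_empty [simp]: "aug {#} = 1"
  by (rule symfun_eqI) (simp add: mcoeff_aug one_symfun.rep_eq dfac_def)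

lemma psum_eq_aug: "n \<ge> 1 \<Longrightarrow> psum n = aug {#n#}"
  by (rule symfun_eqI) (simp add: mcoeff_aug psum_def mcoeff_msym dfac_def)

text \<open>The variable raised by \<open>psum b\<close> either is new, which gives a part
  \<open>b\<close>, or already carries a part \<open>u\<close>, which becomes \<open>u + b\<close>.
  Comparing coefficients at one exponent turns this into a count with the factors
  \<open>dfac\<close>.\<close>

lemma psum_mult_aug:
  assumes b: "b \<ge> 1" and A: "0 \<notin># A"
  shows "psum b * aug A = aug (add_mset b A) + (\<Sum>u\<in>#A. aug (A - {#u#} + {#u + b#}))"
proof (rule symfun_eqI)
  fix c
  let ?rhs = "aug (add_mset b A) + (\<Sum>u\<in>#A. aug (A - {#u#} + {#u + b#}))"
  define C where "C = expo_type c"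
  define N where "N = (\<lambda>v. of_nat (if C - {#v#} + (if v = b then {#} else {#v - b#}) = A then dfac A else 0) :: qalpha)"
  have "mcoeff (psum b * aug A) c = (\<Sum>i | b \<le> lookup c i. N (lookup c i))"
    unfolding mcoeff_psum_mult[OF b]
    by (rule sum.cong) (use b in \<open>auto simp: N_def C_def mcoeff_aug expo_type_diff_single\<close>)
  also have "\<dots> = (\<Sum>i\<in>keys c. if b \<le> lookup c i then N (lookup c i) else 0)"
    by (rule sum.mono_neutral_cong_left) (use b in \<open>auto simp: in_keys_iff\<close>)
  also have "\<dots> = (\<Sum>v\<in>#C. if b \<le> v then N v else 0)"
    unfolding C_def by (rule sum_keys_expo_type)
  also have "\<dots> = (\<Sum>v\<in>set_mset C. of_nat (count C v) * (if b \<le> v then N v else 0))"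
    by (rule sum_mset_eq_sum_count)
  also have "\<dots> = (\<Sum>v\<in>set_mset C. if v = b then of_nat (count C v) * N v else 0) +
      (\<Sum>v\<in>set_mset C. if b < v then of_nat (count C v) * N v else 0)"
    by (subst sum.distrib[symmetric], rule sum.cong) auto
  \<comment> \<open>Lowering an exponent equal to \<open>b\<close> erases it; the
    \<open>count C b\<close> choices of that variable turn \<open>dfac A\<close> into
    \<open>dfac C\<close>.\<close>
  also have "(\<Sum>v\<in>set_mset C. if v = b then of_nat (count C v) * N v else 0) =
      (if C = add_mset b A then of_nat (dfac C) else 0)"
  proof (cases "b \<in># C")
    case True
    then obtain B where "C = add_mset b B"
      by (metis insert_DiffM)
    then show ?thesis
      by (auto simp: N_def dfac_add_mset distrib_right)
  qed auto
  also have "(\<Sum>v\<in>set_mset C. if b < v then of_nat (count C v) * N v else 0) =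
      (\<Sum>v | v \<in># C \<and> b < v \<and> C - {#v#} + {#v - b#} = A. of_nat (count C v * dfac A))"
    by (rule sum.mono_neutral_cong_right) (auto simp: N_def)
  \<comment> \<open>Passes from the entry \<open>v\<close> of \<open>C\<close> that is lowered to
    the entry \<open>u = v - b\<close> of \<open>A\<close> that is raised. If \<open>B\<close> is
    the common rest, then \<open>count C v * dfac A\<close> and \<open>count A u * dfac C\<close>
    both equal \<open>count C v * count A u * dfac B\<close>.\<close>
  also have "\<dots> = (\<Sum>u | u \<in># A \<and> C = A - {#u#} + {#u + b#}. of_nat (count A u * dfac C))"
  proof (rule sum.reindex_bij_witness[where i = "\<lambda>u. u + b" and j = "\<lambda>v. v - b"])
    fix v assume v: "v \<in> {v. v \<in># C \<and> b < v \<and> C - {#v#} + {#v - b#} = A}"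
    define B where "B = C - {#v#}"
    have B: "C = add_mset v B" "A = add_mset (v - b) B"
      using v by (auto simp: B_def)
    have "v - b + b = v"
      using v by simp
    then show "v - b \<in> {u. u \<in># A \<and> C = A - {#u#} + {#u + b#}}"
      by (simp add: B)
    show "of_nat (count A (v - b) * dfac C) = (of_nat (count C v * dfac A) :: qalpha)"
      unfolding B dfac_add_mset by (simp add: algebra_simps)
  next
    fix u assume u: "u \<in> {u. u \<in># A \<and> C = A - {#u#} + {#u + b#}}"
    then have "u \<noteq> 0" "u \<in># A" and C: "C = A - {#u#} + {#u + b#}"
      using A by (auto intro: gr0I)
    then show "u + b \<in> {v. v \<in># C \<and> b < v \<and> C - {#v#} + {#v - b#} = A}"
      unfolding C by simp
  next
    fix v assume "v \<in> {v. v \<in># C \<and> b < v \<and> C - {#v#} + {#v - b#} = A}"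
    then show "v - b + b = v" by simp
  next
    fix u show "u + b - b = u" by simp
  qed
  also have "\<dots> = (\<Sum>u\<in>set_mset A. of_nat (count A u) * (if C = A - {#u#} + {#u + b#} then of_nat (dfac C) else 0))"
    by (rule sum.mono_neutral_cong_left) auto
  also have "\<dots> = (\<Sum>u\<in>#A. if C = A - {#u#} + {#u + b#} then of_nat (dfac C) else 0)"
    by (rule sum_mset_eq_sum_count[symmetric])
  also have "(if C = add_mset b A then of_nat (dfac C) else 0) + \<dots> =
      mcoeff ?rhs c"
    by (simp add: mcoeff_aug mcoeff_sum_mset C_def[symmetric] if_distrib cong: if_cong)
  finally show "mcoeff (psum b * aug A) c = mcoeff ?rhs c" .
qed

section \<open>Power sums as free generators\<close>

abbreviation lin :: "(symfun \<Rightarrow> symfun) \<Rightarrow> bool" where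
  "lin \<equiv> Vector_Spaces.linear scale scale"

lemma linI:
  assumes "\<And>x y. T (x + y) = T x + T y" "\<And>c x. T (c *s x) = c *s T x"
  shows "lin T"
  by unfold_locales (auto simp: assms)

lemma lin_add: "lin T \<Longrightarrow> T (x + y) = T x + T y"
  and lin_scale: "lin T \<Longrightarrow> T (c *s x) = c *s T x"
  by (auto simp: Vector_Spaces.linear_def module_hom_def module_hom_axioms_def)

lemma lin_zero: "lin T \<Longrightarrow> T 0 = 0"
  using lin_scale[of T 0 0] by simp

lemma lin_uminus: "lin T \<Longrightarrow> T (- x) = - T x"
  using lin_add[of T x "- x"] by (simp add: lin_zero add_eq_0_iff)

lemma lin_diff: "lin T \<Longrightarrow> T (x - y) = T x - T y"
  using lin_add[of T x "- y"] by (simp add: lin_uminus)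

lemma lin_sum: "lin T \<Longrightarrow> T (sum f S) = (\<Sum>x\<in>S. T (f x))"
  by (induction S rule: infinite_finite_induct) (auto simp: lin_zero lin_add)

lemma lin_mult: "lin (\<lambda>g. f * g)"
  by (rule linI) (auto simp: distrib_left)

lemma lin_zero_map: "lin (\<lambda>_. 0)"
  by (rule linI) auto

lemma lin_add_map: "lin S \<Longrightarrow> lin T \<Longrightarrow> lin (\<lambda>x. S x + T x)"
  by (rule linI) (simp_all add: lin_add lin_scale symfun.scale_right_distrib)

lemma lin_scale_map: "lin T \<Longrightarrow> lin (\<lambda>x. c *s T x)"
  by (rule linI) (simp_all add: lin_add lin_scale symfun.scale_right_distrib mult.commute)

lemma lin_sum_map: "(\<And>i. i \<in> S \<Longrightarrow> lin (T i)) \<Longrightarrow> lin (\<lambda>x. \<Sum>i\<in>S. T i x)"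
  by (induction S rule: infinite_finite_induct) (auto intro: lin_zero_map lin_add_map)

lemma lin_span:
  assumes T: "lin T" and S: "\<And>y. y \<in> S \<Longrightarrow> T y \<in> symfun.span S'" and x: "x \<in> symfun.span S"
  shows "T x \<in> symfun.span S'"
  using x
  by (induction rule: symfun.span_induct_alt)
    (auto simp: lin_zero[OF T] lin_add[OF T] lin_scale[OF T] S symfun.span_zero intro!: symfun.span_add symfun.span_scale)

lemma sum_mset_in_span: "(\<And>x. x \<in># A \<Longrightarrow> f x \<in> symfun.span S) \<Longrightarrow> (\<Sum>x\<in>#A. f x) \<in> symfun.span S"
  by (induction A) (auto intro: symfun.span_zero symfun.span_add)

definition power_prod :: "nat multiset \<Rightarrow> symfun" where
  "power_prod A = (\<Prod>i\<in>#A. psum i)"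

lemma power_prod_empty [simp]: "power_prod {#} = 1"
  by (simp add: power_prod_def)

lemma power_prod_add_mset [simp]: "power_prod (add_mset n A) = psum n * power_prod A"
  by (simp add: power_prod_def)

lemma p_part_eq_power_prod: "p_part lam = power_prod (mset lam)"
  by (simp add: p_part_def power_prod_def prod_mset_prod_list[symmetric] del: prod_mset_prod_list)

lemma psum_mult_aug_in_span:
  assumes "b \<ge> 1" "0 \<notin># A"
  shows "psum b * aug A - aug (add_mset b A) \<in>
    symfun.span (aug ` {B. 0 \<notin># B \<and> size B < size (add_mset b A) \<and> sum_mset B = sum_mset (add_mset b A)})"
proof -
  have "(\<Sum>u\<in>#A. aug (A - {#u#} + {#u + b#})) \<in>
    symfun.span (aug ` {B. 0 \<notin># B \<and> size B < size (add_mset b A) \<and> sum_mset B = sum_mset (add_mset b A)})"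
  proof (rule sum_mset_in_span, rule symfun.span_base, rule imageI, safe)
    fix u assume u: "u \<in># A"
    then obtain B where B: "A = add_mset u B"
      by (meson multi_member_split)
    show "size (A - {#u#} + {#u + b#}) < size (add_mset b A)"
      "sum_mset (A - {#u#} + {#u + b#}) = sum_mset (add_mset b A)"
      by (simp_all add: B)
    show False if "0 \<in># A - {#u#} + {#u + b#}"
      using that assms by (auto simp: B)
  qed
  then show ?thesis
    using assms by (simp add: psum_mult_aug)
qed

text \<open>Expanding a product of power sums merges some of the parts. Without merging one gets
  \<open>aug A\<close>; every merging shortens the multiset and preserves its sum.\<close>

lemma power_prod_diff_aug:
  assumes "0 \<notin># A"
  shows "power_prod A - aug A \<in>
    symfun.span (aug ` {B. 0 \<notin># B \<and> size B < size A \<and> sum_mset B = sum_mset A})"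
  using assms
proof (induction A)
  case empty
  then show ?case
    by (simp add: symfun.span_zero)
next
  case (add b A)
  let ?S = "\<lambda>A. aug ` {B. 0 \<notin># B \<and> size B < size A \<and> sum_mset B = sum_mset A}"
  have b: "b \<ge> 1" "0 \<notin># A" and IH: "power_prod A - aug A \<in> symfun.span (?S A)"
    using add by auto
  have "psum b * (power_prod A - aug A) \<in> symfun.span (?S (add_mset b A))"
  proof (rule lin_span[OF lin_mult _ IH])
    fix y assume "y \<in> ?S A"
    then obtain B where B: "y = aug B" "0 \<notin># B" "size B < size A" "sum_mset B = sum_mset A"
      by auto
    have "psum b * aug B - aug (add_mset b B) \<in> symfun.span (?S (add_mset b B))"
      using b B by (intro psum_mult_aug_in_span) auto
    moreover have "symfun.span (?S (add_mset b B)) \<subseteq> symfun.span (?S (add_mset b A))"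
      using B by (intro symfun.span_mono image_mono) auto
    ultimately have "psum b * aug B - aug (add_mset b B) \<in> symfun.span (?S (add_mset b A))"
      by blast
    moreover have "aug (add_mset b B) \<in> symfun.span (?S (add_mset b A))"
      using B b by (intro symfun.span_base) auto
    ultimately have "psum b * aug B - aug (add_mset b B) + aug (add_mset b B) \<in> symfun.span (?S (add_mset b A))"
      by (rule symfun.span_add)
    then show "psum b * y \<in> symfun.span (?S (add_mset b A))"
      using B by simp
  qed
  from symfun.span_add[OF this psum_mult_aug_in_span[OF b]] show ?case
    by (simp add: right_diff_distrib)
qed

text \<open>Inverts the preceding unitriangular relation, by induction on the number of
  parts.\<close>

lemma aug_in_span_power_prod:
  assumes "0 \<notin># A"
  shows "aug A \<in> symfun.span (power_prod ` {B. 0 \<notin># B \<and> sum_mset B = sum_mset A})"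
  using assms
proof (induction "size A" arbitrary: A rule: less_induct)
  case less
  let ?P = "symfun.span (power_prod ` {B. 0 \<notin># B \<and> sum_mset B = sum_mset A})"
  have id: "lin (\<lambda>x. x)"
    by (rule linI) auto
  have "power_prod A - aug A \<in> ?P"
  proof (rule lin_span[OF id _ power_prod_diff_aug[OF less.prems]], safe)
    fix B :: "nat multiset" assume "0 \<notin># B" "size B < size A" "sum_mset B = sum_mset A"
    then show "aug B \<in> ?P"
      using less.hyps[of B] by simp
  qed
  moreover have "power_prod A \<in> ?P"
    using less.prems by (intro symfun.span_base) auto
  ultimately show ?case
    using symfun.span_diff[of "power_prod A" _ "power_prod A - aug A"] by simp
qed

section \<open>Finite expansions and degree bounds\<close>

definition parts_upto :: "nat \<Rightarrow> nat multiset set" where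
  "parts_upto N = {A. 0 \<notin># A \<and> sum_mset A \<le> N}"

lemma size_le_sum_mset: "0 \<notin># A \<Longrightarrow> size A \<le> sum_mset A" for A :: "nat multiset"
  by (induction A) auto

lemma finite_parts_upto [simp]: "finite (parts_upto N)"
proof (rule finite_subset)
  show "parts_upto N \<subseteq> mset ` {xs. set xs \<subseteq> {..N} \<and> length xs \<le> N}"
  proof
    fix A assume A: "A \<in> parts_upto N"
    then have "set_mset A \<subseteq> {..N}"
      by (auto simp: parts_upto_def dest!: multi_member_split)
    moreover have "size A \<le> N"
      using A size_le_sum_mset[of A] by (auto simp: parts_upto_def)
    ultimately have "mpart A \<in> {xs. set xs \<subseteq> {..N} \<and> length xs \<le> N}"
      by (simp flip: set_mset_mset)
    then show "A \<in> mset ` {xs. set xs \<subseteq> {..N} \<and> length xs \<le> N}"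
      by (metis image_eqI mset_mpart)
  qed
qed (auto intro: finite_imageI finite_lists_length_le)

definition expo_of :: "nat multiset \<Rightarrow> expo" where
  "expo_of A = (SOME a. expo_type a = A)"

lemma expo_type_expo_of [simp]: "0 \<notin># A \<Longrightarrow> expo_type (expo_of A) = A"
  unfolding expo_of_def using ex_expo_type by (rule someI_ex)

definition mdeg_le :: "symfun \<Rightarrow> nat \<Rightarrow> bool" where
  "mdeg_le f N \<longleftrightarrow> (\<forall>a. mcoeff f a \<noteq> 0 \<longrightarrow> total_degree a \<le> N)"

lemma ex_mdeg_le: "\<exists>N. mdeg_le f N"
  using mcoeff[of f] by (auto simp: mdeg_le_def)

lemma mcoeff_expansion:
  assumes "mdeg_le f N"
  shows "f = (\<Sum>A\<in>parts_upto N. mcoeff f (expo_of A) *s msym (mpart A))"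
proof (rule symfun_eqI)
  fix a
  have "mcoeff (\<Sum>A\<in>parts_upto N. mcoeff f (expo_of A) *s msym (mpart A)) a =
      (\<Sum>A\<in>parts_upto N. if expo_type a = A then mcoeff f (expo_of A) else 0)"
    by (simp add: mcoeff_sum mcoeff_msym if_distrib cong: if_cong)
  also have "\<dots> = (if expo_type a \<in> parts_upto N then mcoeff f (expo_of (expo_type a)) else 0)"
    by simp
  also have "\<dots> = mcoeff f a"
    using assms mcoeff_expo_type[of "expo_of (expo_type a)" a f]
    by (auto simp: parts_upto_def mdeg_le_def sum_mset_expo_type)
  finally show "mcoeff f a = mcoeff (\<Sum>A\<in>parts_upto N. mcoeff f (expo_of A) *s msym (mpart A)) a" ..
qed

text \<open>The degree filtration. Elements of the ring are not homogeneous in general, so a bound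
  \<open>N\<close> for the degree is carried along; it makes the sums over partitions
  finite.\<close>

definition pow_span :: "nat \<Rightarrow> symfun set" where
  "pow_span N = symfun.span (power_prod ` parts_upto N)"

lemma pow_span_mono: "M \<le> N \<Longrightarrow> pow_span M \<subseteq> pow_span N"
  unfolding pow_span_def by (intro symfun.span_mono image_mono) (auto simp: parts_upto_def)

lemma msym_eq_aug: "msym (mpart A) = (1 / of_nat (dfac A)) *s aug A"
  by (simp add: aug_def dfac_pos[of A, THEN less_imp_neq, symmetric] del: dfac_pos)

lemma mdeg_le_in_pow_span:
  assumes "mdeg_le f N"
  shows "f \<in> pow_span N"
proof -
  have "aug A \<in> pow_span N" if "A \<in> parts_upto N" for A
  proof -
    have "aug A \<in> symfun.span (power_prod ` {B. 0 \<notin># B \<and> sum_mset B = sum_mset A})"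
      using that by (intro aug_in_span_power_prod) (auto simp: parts_upto_def)
    also have "\<dots> \<subseteq> pow_span N"
      unfolding pow_span_def using that by (intro symfun.span_mono image_mono) (auto simp: parts_upto_def)
    finally show ?thesis .
  qed
  then have "(\<Sum>A\<in>parts_upto N. mcoeff f (expo_of A) *s msym (mpart A)) \<in> pow_span N"
    unfolding msym_eq_aug pow_span_def by (intro symfun.span_sum symfun.span_scale) auto
  then show ?thesis
    using mcoeff_expansion[OF assms] by simp
qed

lemma ex_pow_span: "\<exists>N. f \<in> pow_span N"
  using ex_mdeg_le mdeg_le_in_pow_span by blast

lemma pow_span_induct [consumes 1, case_names zero add]:
  assumes "f \<in> pow_span N" "P 0"
    "\<And>c A f. 0 \<notin># A \<Longrightarrow> sum_mset A \<le> N \<Longrightarrow> P f \<Longrightarrow> P (c *s power_prod A + f)"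
  shows "P f"
  using assms(1) unfolding pow_span_def
  by (induction rule: symfun.span_induct_alt) (auto simp: parts_upto_def intro: assms)

text \<open>Power products span the ring, so linear statements can be checked on them. The facts on
  derivatives, forms and adjoints below are mostly proved this way.\<close>

lemma power_prod_induct [case_names base add scale]:
  assumes "\<And>A. 0 \<notin># A \<Longrightarrow> P (power_prod A)" "\<And>f g. P f \<Longrightarrow> P g \<Longrightarrow> P (f + g)" "\<And>c f. P f \<Longrightarrow> P (c *s f)"
  shows "P f"
proof -
  obtain N where "f \<in> pow_span N"
    using ex_pow_span by blast
  then show ?thesis
  proof (induction rule: pow_span_induct)
    case zero
    show ?case
      using assms(3)[OF assms(1)[of "{#}"], of 0] by simp
  qed (auto intro: assms)
qed

text \<open>The corrections to the leading term \<open>aug A\<close> have fewer parts, hence contain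
  no monomial in \<open>size A\<close> or more variables.\<close>

lemma mcoeff_power_prod:
  assumes "0 \<notin># A" "size (expo_type a) \<ge> size A"
  shows "mcoeff (power_prod A) a = (if expo_type a = A then of_nat (dfac A) else 0)"
proof -
  have "mcoeff x a = 0" if "x \<in> symfun.span (aug ` {B. 0 \<notin># B \<and> size B < size A \<and> sum_mset B = sum_mset A})" for x
    using that by (induction rule: symfun.span_induct_alt) (use assms in \<open>auto simp: mcoeff_aug split: if_splits\<close>)
  from this[OF power_prod_diff_aug[OF assms(1)]] show ?thesis
    by (simp add: mcoeff_aug)
qed

lemma power_prod_coeffs_zero:
  assumes "finite S" "\<And>A. A \<in> S \<Longrightarrow> 0 \<notin># A" "(\<Sum>A\<in>S. c A *s power_prod A) = 0" "B \<in> S"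
  shows "c B = 0"
proof (rule ccontr)
  assume nz: "c B \<noteq> 0"
  let ?T = "{A \<in> S. c A \<noteq> 0}"
  have fin: "finite ?T" and "?T \<noteq> {}"
    using assms nz by auto
  \<comment> \<open>Among the products with non-zero coefficient take one with the most parts: its
    leading monomial occurs in no other of these products.\<close>
  define m where "m = Max (size ` ?T)"
  have "m \<in> size ` ?T"
    unfolding m_def by (intro Max_in) (use fin \<open>?T \<noteq> {}\<close> in auto)
  then obtain A where A: "A \<in> S" "c A \<noteq> 0" "size A = m"
    by auto
  have le: "size A' \<le> size A" if "A' \<in> ?T" for A'
    unfolding A m_def using that fin by (intro Max_ge) auto
  obtain a where a: "expo_type a = A"
    using ex_expo_type assms(2) A by blast
  have "0 = mcoeff (\<Sum>A'\<in>S. c A' *s power_prod A') a"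
    using assms by simp
  also have "\<dots> = (\<Sum>A'\<in>S. c A' * mcoeff (power_prod A') a)"
    by (simp add: mcoeff_sum)
  also have "\<dots> = (\<Sum>A'\<in>S. if A' = A then c A * of_nat (dfac A) else 0)"
  proof (rule sum.cong)
    fix A' assume "A' \<in> S"
    then show "c A' * mcoeff (power_prod A') a = (if A' = A then c A * of_nat (dfac A) else 0)"
      using le[of A'] mcoeff_power_prod[of A' a] assms(2) a A by (cases "c A' = 0") auto
  qed simp
  also have "\<dots> = c A * of_nat (dfac A)"
    using assms A by simp
  finally show False
    using A dfac_pos[of A] by simp
qed

lemma inj_power_prod: "inj_on power_prod {A. 0 \<notin># A}"
proof (rule inj_onI, rule ccontr)
  fix A B assume AB: "A \<in> {A. 0 \<notin># A}" "B \<in> {A. 0 \<notin># A}" "power_prod A = power_prod B" "A \<noteq> B"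
  then have "(\<Sum>C\<in>{A, B}. (if C = A then 1 else - 1) *s power_prod C) = 0"
    by simp
  from power_prod_coeffs_zero[OF _ _ this, of A] show False
    using AB by auto
qed

lemma independent_power_prod: "symfun.independent (power_prod ` {A. 0 \<notin># A})"
proof
  assume "symfun.dependent (power_prod ` {A. 0 \<notin># A})"
  then obtain t u v where t: "finite t" "t \<subseteq> power_prod ` {A. 0 \<notin># A}" "(\<Sum>v\<in>t. u v *s v) = 0" "v \<in> t" "u v \<noteq> 0"
    unfolding symfun.dependent_explicit by blast
  then obtain S where S: "S \<subseteq> {A. 0 \<notin># A}" "t = power_prod ` S" "finite S"
    by (meson finite_subset_image)
  have inj: "inj_on power_prod S"
    using inj_power_prod S(1) by (rule inj_on_subset)
  obtain B where B: "B \<in> S" "v = power_prod B"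
    using S t by auto
  have "(\<Sum>A\<in>S. u (power_prod A) *s power_prod A) = 0"
    using t(3) by (simp add: S sum.reindex[OF inj])
  then have "u (power_prod B) = 0"
    using S B by (intro power_prod_coeffs_zero[of S "\<lambda>A. u (power_prod A)"]) auto
  then show False
    using t B by simp
qed

lemma p_part_image: "p_part ` partitions = power_prod ` {A. 0 \<notin># A}"
proof safe
  fix lam assume "lam \<in> partitions"
  then show "p_part lam \<in> power_prod ` {A. 0 \<notin># A}"
    using mset_partition_nonzero by (auto simp: p_part_eq_power_prod)
next
  fix A :: "nat multiset" assume "0 \<notin># A"
  then show "power_prod A \<in> p_part ` partitions"
    using mpart_partitions[of A] by (auto simp: p_part_eq_power_prod image_iff intro!: bexI[of _ "mpart A"])
qed

lemma span_p_part: "symfun.span (p_part ` partitions) = UNIV"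
proof -
  have "f \<in> symfun.span (power_prod ` {A. 0 \<notin># A})" for f
    by (induction f rule: power_prod_induct) (auto intro: symfun.span_base symfun.span_add symfun.span_scale)
  then show ?thesis
    by (auto simp: p_part_image)
qed

lemmas p_part_basis = independent_power_prod[folded p_part_image]

lemma p_coeff_add [simp]: "p_coeff lam (f + g) = p_coeff lam f + p_coeff lam g"
  and p_coeff_scale [simp]: "p_coeff lam (c *s f) = c * p_coeff lam f"
  by (simp_all add: p_coeff_def symfun.representation_add symfun.representation_scale p_part_basis span_p_part)

lemma p_coeff_p_part:
  assumes "lam \<in> partitions" "\<mu> \<in> partitions"
  shows "p_coeff lam (p_part \<mu>) = (if lam = \<mu> then 1 else 0)"
proof -
  have "p_part lam = p_part \<mu> \<longleftrightarrow> lam = \<mu>"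
    using assms inj_power_prod mset_partition_nonzero
    by (auto simp: p_part_eq_power_prod partition_eq_iff inj_on_def)
  then show ?thesis
    using assms by (auto simp: p_coeff_def symfun.representation_basis p_part_basis)
qed

lemma finite_p_coeff: "finite {lam \<in> partitions. p_coeff lam f \<noteq> 0}"
proof (induction f rule: power_prod_induct)
  case (base A)
  then have "power_prod A = p_part (mpart A)" "mpart A \<in> partitions"
    by (simp_all add: p_part_eq_power_prod mpart_partitions)
  then have "{lam \<in> partitions. p_coeff lam (power_prod A) \<noteq> 0} \<subseteq> {mpart A}"
    by (auto simp: p_coeff_p_part split: if_splits)
  then show ?case
    by (rule finite_subset) auto
next
  case (add f g)
  have "{lam \<in> partitions. p_coeff lam (f + g) \<noteq> 0} \<subseteq>
      {lam \<in> partitions. p_coeff lam f \<noteq> 0} \<union> {lam \<in> partitions. p_coeff lam g \<noteq> 0}"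
    by auto
  then show ?case
    using add by (meson finite_UnI finite_subset)
next
  case (scale c f)
  then show ?case
    by (auto intro: finite_subset[rotated])
qed

lemma sum'_single:
  assumes "x \<in> S" "\<And>y. y \<in> S \<Longrightarrow> y \<noteq> x \<Longrightarrow> f y = 0"
  shows "sum' f S = f x"
proof -
  have "sum' f S = sum' f {x}"
    by (rule sum.mono_neutral_right') (use assms in auto)
  then show ?thesis
    by simp
qed

lemma sum'_eq_sum:
  assumes "finite T" "T \<subseteq> S" "\<And>y. y \<in> S \<Longrightarrow> y \<notin> T \<Longrightarrow> f y = 0"
  shows "sum' f S = sum f T"
proof -
  have "sum' f S = sum' f T"
    by (rule sum.mono_neutral_right') (use assms in auto)
  then show ?thesis
    using assms by simp
qed

section \<open>Partial derivatives, bilinear forms and adjoints\<close>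

lemma p_diff_eq_sum:
  assumes "finite T" "T \<subseteq> partitions" "{lam \<in> partitions. p_coeff lam f \<noteq> 0} \<subseteq> T"
  shows "p_diff n f = (\<Sum>lam\<in>T. (p_coeff lam f * of_nat (count_list lam n)) *s p_part (remove1 n lam))"
  unfolding p_diff_def by (rule sum'_eq_sum) (use assms in auto)

lemma lin_p_diff: "lin (p_diff n)"
proof (rule linI)
  fix f g
  let ?T = "{lam \<in> partitions. p_coeff lam f \<noteq> 0} \<union> {lam \<in> partitions. p_coeff lam g \<noteq> 0}"
  have T: "finite ?T" "?T \<subseteq> partitions"
    by (auto simp: finite_p_coeff)
  show "p_diff n (f + g) = p_diff n f + p_diff n g"
    by (subst (1 2 3) p_diff_eq_sum[OF T])
      (auto simp: sum.distrib[symmetric] distrib_right symfun.scale_left_distrib)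
next
  fix c f
  let ?T = "{lam \<in> partitions. p_coeff lam f \<noteq> 0}"
  have T: "finite ?T" "?T \<subseteq> partitions"
    by (auto simp: finite_p_coeff)
  show "p_diff n (c *s f) = c *s p_diff n f"
    by (subst (1 2) p_diff_eq_sum[OF T]) (auto simp: symfun.scale_sum_right mult.assoc)
qed

lemma p_diff_power_prod:
  assumes "0 \<notin># A"
  shows "p_diff n (power_prod A) = of_nat (count A n) *s power_prod (A - {#n#})"
proof -
  have A: "power_prod A = p_part (mpart A)" "mpart A \<in> partitions"
    using assms by (simp_all add: p_part_eq_power_prod mpart_partitions)
  have "p_diff n (p_part (mpart A)) = (p_coeff (mpart A) (p_part (mpart A)) * of_nat (count_list (mpart A) n)) *s
      p_part (remove1 n (mpart A))"
    unfolding p_diff_def by (rule sum'_single) (use A in \<open>auto simp: p_coeff_p_part\<close>)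
  then show ?thesis
    by (simp add: A p_coeff_p_part) (simp add: p_part_eq_power_prod count_mset[symmetric])
qed

lemma p_diff_psum_mult:
  assumes "m \<ge> 1"
  shows "p_diff n (psum m * f) = (if m = n then f else 0) + psum m * p_diff n f"
proof (induction f rule: power_prod_induct)
  case (base A)
  show ?case
  proof (cases "m = n")
    case True
    have "psum n * power_prod (A - {#n#}) = power_prod A" if "n \<in># A"
      using that by (metis insert_DiffM power_prod_add_mset)
    moreover have "count A n = 0" if "n \<notin># A"
      using that by (simp add: not_in_iff)
    ultimately show ?thesis
      using base assms p_diff_power_prod[of "add_mset m A" n] p_diff_power_prod[of A n] True
      by (cases "n \<in># A") (auto simp: symfun.scale_left_distrib)
  next
    case False
    then have "add_mset m A - {#n#} = add_mset m (A - {#n#})"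
      by simp
    then show ?thesis
      using base assms p_diff_power_prod[of "add_mset m A" n] p_diff_power_prod[of A n] False by simp
  qed
next
  case (add f g)
  then show ?case
    by (simp add: distrib_left lin_add[OF lin_p_diff] algebra_simps)
next
  case (scale c f)
  then show ?case
    by (simp add: lin_scale[OF lin_p_diff] symfun.scale_right_distrib)
qed

lemma p_diff_one: "p_diff n 1 = 0"
  using p_diff_power_prod[of "{#}" n] by simp

lemma p_diff_mult: "p_diff n (f * g) = p_diff n f * g + f * p_diff n g"
proof (induction f rule: power_prod_induct)
  case (base A)
  then show ?case
  proof (induction A)
    case (add m A)
    then have "m \<ge> 1" and "0 \<notin># A"
      by auto
    then show ?case
      using add.IH by (simp add: p_diff_psum_mult mult.assoc distrib_left distrib_right add.assoc)
  qed (simp add: p_diff_one)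
qed (simp_all add: distrib_right distrib_left lin_add[OF lin_p_diff] lin_scale[OF lin_p_diff]
    symfun.scale_right_distrib algebra_simps)

section \<open>The bilinear forms\<close>

definition zfac :: "nat multiset \<Rightarrow> nat" where
  "zfac A = (\<Prod>i\<in>set_mset A. i ^ count A i * fact (count A i))"

lemma z_coeff_eq_zfac: "z_coeff lam = zfac (mset lam)"
  by (simp add: z_coeff_def zfac_def count_mset)

lemma zfac_add_mset: "zfac (add_mset b A) = b * Suc (count A b) * zfac A"
proof (cases "b \<in># A")
  case True
  then show ?thesis
    by (simp add: zfac_def insert_absorb prod.remove[of "set_mset A" b] algebra_simps)
next
  case False
  have "(\<Prod>i\<in>set_mset A. i ^ count (add_mset b A) i * fact (count (add_mset b A) i)) =
      (\<Prod>i\<in>set_mset A. i ^ count A i * fact (count A i) :: nat)"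
    by (rule prod.cong) (use False in auto)
  moreover have "count (add_mset b A) b = 1" "count A b = 0"
    using False by (simp_all add: count_eq_zero_iff)
  ultimately show ?thesis
    using False by (simp add: zfac_def del: count_add_mset)
qed

lemma zfac_pos: "0 \<notin># A \<Longrightarrow> zfac A > 0"
  by (auto simp: zfac_def intro!: prod_pos) (metis gr0I)

lemma p_form_eq_sum:
  assumes "finite T" "T \<subseteq> partitions" "{lam \<in> partitions. p_coeff lam f \<noteq> 0} \<subseteq> T"
  shows "p_form c f g = (\<Sum>lam\<in>T. c ^ length lam * of_nat (z_coeff lam) * p_coeff lam f * p_coeff lam g)"
  unfolding p_form_def by (rule sum'_eq_sum) (use assms in auto)

lemma p_form_sym: "p_form c f g = p_form c g f"
  by (simp add: p_form_def mult.commute mult.left_commute)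

lemma p_form_add_right: "p_form c f (g + h) = p_form c f g + p_form c f h"
  and p_form_scale_right: "p_form c f (a *s g) = a * p_form c f g"
proof -
  let ?T = "{lam \<in> partitions. p_coeff lam f \<noteq> 0}"
  have T: "finite ?T" "?T \<subseteq> partitions" "{lam \<in> partitions. p_coeff lam f \<noteq> 0} \<subseteq> ?T"
    by (auto simp: finite_p_coeff)
  show "p_form c f (g + h) = p_form c f g + p_form c f h"
    by (simp add: p_form_eq_sum[OF T] sum.distrib[symmetric] distrib_left)
  show "p_form c f (a *s g) = a * p_form c f g"
    by (simp add: p_form_eq_sum[OF T] sum_distrib_left mult.commute mult.left_commute)
qed

lemma p_form_add_left: "p_form c (f + g) h = p_form c f h + p_form c g h"
  and p_form_scale_left: "p_form c (a *s f) h = a * p_form c f h"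
  by (simp_all add: p_form_sym[of c _ h] p_form_add_right p_form_scale_right)

lemma p_form_zero_right [simp]: "p_form c f 0 = 0"
  using p_form_scale_right[of c f 0 0] by simp

lemma p_form_zero_left [simp]: "p_form c 0 f = 0"
  by (simp add: p_form_sym[of c 0])

lemma p_form_diff_left: "p_form c (f - g) h = p_form c f h - p_form c g h"
  using p_form_add_left[of c "f - g" g h] by simp

lemma p_form_sum_left: "p_form c (sum f S) g = (\<Sum>x\<in>S. p_form c (f x) g)"
  by (induction S rule: infinite_finite_induct) (auto simp: p_form_add_left)

lemma p_form_sum_right: "p_form c g (sum f S) = (\<Sum>x\<in>S. p_form c g (f x))"
  by (simp add: p_form_sym[of c g] p_form_sum_left)

lemma p_form_power_prod:
  assumes "0 \<notin># A"
  shows "p_form c (power_prod A) g = c ^ size A * of_nat (zfac A) * p_coeff (mpart A) g"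
proof -
  have A: "power_prod A = p_part (mpart A)" "mpart A \<in> partitions"
    using assms by (simp_all add: p_part_eq_power_prod mpart_partitions)
  then have T: "finite {mpart A}" "{mpart A} \<subseteq> partitions" "{lam \<in> partitions. p_coeff lam (power_prod A) \<noteq> 0} \<subseteq> {mpart A}"
    by (auto simp: p_coeff_p_part split: if_splits)
  show ?thesis
    by (subst p_form_eq_sum[OF T]) (simp add: p_coeff_p_part A z_coeff_eq_zfac)
qed

lemma p_coeff_power_prod:
  assumes "0 \<notin># A" "0 \<notin># B"
  shows "p_coeff (mpart A) (power_prod B) = (if A = B then 1 else 0)"
proof -
  have "mpart A = mpart B \<longleftrightarrow> A = B"
    by (metis mset_mpart)
  then show ?thesis
    using assms p_coeff_p_part[OF mpart_partitions mpart_partitions, of A B] by (simp add: p_part_eq_power_prod)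
qed

lemma eq_zero_if_p_coeff:
  assumes "\<And>lam. lam \<in> partitions \<Longrightarrow> p_coeff lam f = 0"
  shows "f = 0"
proof -
  have "symfun.representation (p_part ` partitions) f b = 0" for b
    using assms symfun.representation_ne_zero[of "p_part ` partitions" f b] by (auto simp: p_coeff_def)
  then have "(\<Sum>b | symfun.representation (p_part ` partitions) f b \<noteq> 0.
      symfun.representation (p_part ` partitions) f b *s b) = 0"
    by simp
  then show ?thesis
    by (subst (asm) symfun.sum_nonzero_representation_eq) (auto simp: p_part_basis span_p_part)
qed

lemma p_form_nondegenerate:
  assumes "c \<noteq> 0" "\<And>h. p_form c f h = 0"
  shows "f = 0"
proof (rule eq_zero_if_p_coeff)
  fix lam assume lam: "lam \<in> partitions"
  have "p_form c (power_prod (mset lam)) f = 0"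
    using assms(2) by (simp add: p_form_sym[of c _ f])
  then show "p_coeff lam f = 0"
    using lam assms(1) zfac_pos[OF mset_partition_nonzero[OF lam]]
    unfolding p_form_power_prod[OF mset_partition_nonzero[OF lam]] by (simp add: mpart_mset)
qed

lemma p_form_eqI:
  assumes "c \<noteq> 0" "\<And>h. p_form c f h = p_form c g h"
  shows "f = g"
  using p_form_nondegenerate[of c "f - g"] assms by (simp add: p_form_diff_left)

text \<open>On power products both sides vanish unless \<open>A\<close> is \<open>B\<close> with a
  part \<open>n\<close> added. Then \<open>zfac\<close> grows by the factor
  \<open>n * count A n\<close> and the length by 1, which matches the factor
  \<open>c * n * count A n\<close> on the left.\<close>

lemma p_form_p_diff:
  assumes n: "n \<ge> 1"
  shows "p_form c ((c * of_nat n) *s p_diff n f) g = p_form c f (psum n * g)"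
proof (induction f rule: power_prod_induct)
  case (base A)
  show ?case
  proof (induction g rule: power_prod_induct)
    case (base B)
    show ?case
    proof (cases "n \<in># A")
      case True
      define C where "C = A - {#n#}"
      have A: "A = add_mset n C"
        using True by (simp add: C_def)
      then show ?thesis
        using base \<open>0 \<notin># A\<close> n p_coeff_power_prod[of A "add_mset n B"]
        by (auto simp: p_diff_power_prod p_form_scale_left p_form_power_prod p_coeff_power_prod zfac_add_mset mult_ac distrib_left
            simp flip: power_prod_add_mset)
    next
      case False
      then show ?thesis
        using base \<open>0 \<notin># A\<close> n p_coeff_power_prod[of A "add_mset n B"]
        by (auto simp: p_diff_power_prod p_form_scale_left p_form_power_prod not_in_iff simp flip: power_prod_add_mset)
    qed
  qed (simp_all add: distrib_left p_form_add_right p_form_scale_right)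
qed (simp_all add: lin_add[OF lin_p_diff] lin_scale[OF lin_p_diff] p_form_add_left p_form_scale_left
    symfun.scale_right_distrib algebra_simps)

section \<open>Adjoints of multiplication operators, for both forms at once\<close>

definition adj :: "qalpha \<Rightarrow> symfun \<Rightarrow> symfun \<Rightarrow> symfun" where
  "adj c f = adjoint_wrt (p_form c) (\<lambda>g. f * g)"

lemma perp_eq_adj: "perp = adj 1"
  by (simp add: perp_def adj_def form_def fun_eq_iff)

lemma star_eq_adj: "star = adj alpha"
  by (simp add: star_def adj_def form_alpha_def fun_eq_iff)

text \<open>\<open>adjoint_wrt\<close> is a definite description, so an adjoint has to be exhibited:
  for a power product it is a composition of multiples of derivatives. Uniqueness will come from
  nondegeneracy.\<close>

lemma ex_adjoint_mult: "\<exists>T. \<forall>g h. p_form c (T g) h = p_form c g (f * h)"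
proof (induction f rule: power_prod_induct)
  case (base A)
  then show ?case
  proof (induction A)
    case empty
    show ?case
      by (rule exI[of _ "\<lambda>g. g"]) simp
  next
    case (add n A)
    then obtain T where T: "\<forall>g h. p_form c (T g) h = p_form c g (power_prod A * h)"
      by auto
    have "n \<ge> 1"
      using add.prems by auto
    then show ?case
      by (intro exI[of _ "\<lambda>g. T ((c * of_nat n) *s p_diff n g)"]) (simp add: T p_form_p_diff mult.assoc)
  qed
next
  case (add f g)
  then obtain S T where "\<forall>u h. p_form c (S u) h = p_form c u (f * h)" "\<forall>u h. p_form c (T u) h = p_form c u (g * h)"
    by auto
  then show ?case
    by (intro exI[of _ "\<lambda>u. S u + T u"]) (simp add: p_form_add_left p_form_add_right distrib_right)
next
  case (scale a f)
  then obtain S where "\<forall>u h. p_form c (S u) h = p_form c u (f * h)"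
    by auto
  then show ?case
    by (intro exI[of _ "\<lambda>u. a *s S u"]) (simp add: p_form_scale_left p_form_scale_right)
qed

context
  fixes c :: qalpha
  assumes c: "c \<noteq> 0"
begin

lemma p_form_adj: "p_form c (adj c f g) h = p_form c g (f * h)"
proof -
  obtain T where T: "\<forall>g h. p_form c (T g) h = p_form c g (f * h)"
    using ex_adjoint_mult by blast
  have "adj c f = T"
    unfolding adj_def adjoint_wrt_def
  proof (rule the_equality)
    fix T' assume "\<forall>g h. p_form c (T' g) h = p_form c g (f * h)"
    then show "T' = T"
      using T by (intro ext p_form_eqI[OF c]) simp
  qed (rule T)
  then show ?thesis
    using T by simp
qed

lemma adj_eqI: "(\<And>h. p_form c u h = p_form c g (f * h)) \<Longrightarrow> adj c f g = u"
  by (rule p_form_eqI[OF c]) (simp add: p_form_adj)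

lemma lin_adj: "lin (adj c f)"
  by (rule linI; rule adj_eqI) (simp_all add: p_form_add_left p_form_scale_left p_form_adj)

lemma adj_add_left: "adj c (f + g) u = adj c f u + adj c g u"
  by (rule adj_eqI) (simp add: p_form_add_left p_form_add_right p_form_adj distrib_right)

lemma adj_scale_left: "adj c (a *s f) u = a *s adj c f u"
  by (rule adj_eqI) (simp add: p_form_scale_left p_form_scale_right p_form_adj)

lemma lin_adj_left: "lin (\<lambda>f. adj c f u)"
  by (rule linI) (simp_all add: adj_add_left adj_scale_left)

lemma adj_mult: "adj c (f * g) u = adj c f (adj c g u)"
  by (rule adj_eqI) (simp add: p_form_adj mult.assoc mult.left_commute)

lemma adj_one: "adj c 1 u = u"
  by (rule adj_eqI) simp

lemma adj_psum: "n \<ge> 1 \<Longrightarrow> adj c (psum n) u = (c * of_nat n) *s p_diff n u"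
  by (rule adj_eqI) (simp add: p_form_p_diff)

end

lemma alpha_nonzero: "alpha \<noteq> 0"
  by (simp add: alpha_def Zero_fract_def eq_fract)

lemma star_psum: "n \<ge> 1 \<Longrightarrow> star (psum n) = p_star n"
  by (simp add: star_eq_adj adj_psum[OF alpha_nonzero] p_star_def fun_eq_iff)

lemma lin_p_star: "lin (p_star n)"
  unfolding p_star_def[abs_def] by (intro lin_scale_map lin_p_diff)

lemma p_star_mult: "p_star n (f * g) = p_star n f * g + f * p_star n g"
  by (simp add: p_star_def p_diff_mult symfun.scale_right_distrib)

text \<open>Natural subtraction truncates \<open>N - n\<close> to 0, so the case
  \<open>n > N\<close>, in which the derivative vanishes, is stated separately.\<close>

lemma p_diff_pow_span:
  assumes "n \<ge> 1" "f \<in> pow_span N"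
  shows "if n \<le> N then p_diff n f \<in> pow_span (N - n) else p_diff n f = 0"
  using assms(2)
proof (induction rule: pow_span_induct)
  case zero
  show ?case by (simp add: lin_zero[OF lin_p_diff] pow_span_def symfun.span_zero)
next
  case (add c A f)
  have *: "sum_mset (A - {#n#}) = sum_mset A - n \<and> n \<le> N" if mem: "n \<in># A"
  proof -
    obtain B where "A = add_mset n B"
      using mem by (meson multi_member_split)
    then show ?thesis
      using add by simp
  qed
  have "if n \<le> N then p_diff n (power_prod A) \<in> pow_span (N - n) else p_diff n (power_prod A) = 0"
  proof (cases "n \<in># A")
    case True
    then have "A - {#n#} \<in> parts_upto (N - n)"
      using add * by (auto simp: parts_upto_def dest: in_diffD)
    then have "power_prod (A - {#n#}) \<in> pow_span (N - n)"
      by (simp add: pow_span_def symfun.span_base)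
    then show ?thesis
      using add * True by (simp add: p_diff_power_prod pow_span_def symfun.span_scale)
  next
    case False
    then show ?thesis
      using add by (simp add: p_diff_power_prod not_in_iff pow_span_def symfun.span_zero)
  qed
  then show ?case
    using add by (auto simp: lin_add[OF lin_p_diff] lin_scale[OF lin_p_diff] pow_span_def intro: symfun.span_add symfun.span_scale split: if_splits)
qed

lemma p_star_pow_span:
  assumes "n \<ge> 1" "f \<in> pow_span N"
  shows "if n \<le> N then p_star n f \<in> pow_span (N - n) else p_star n f = 0"
  using p_diff_pow_span[OF assms] by (auto simp: p_star_def pow_span_def intro: symfun.span_scale)

lemma star_mult: "star (f * g) u = star f (star g u)"
  by (simp add: star_eq_adj adj_mult alpha_nonzero)

text \<open>The factors \<open>p_star n\<close> lower the degree step by step, until nothing is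
  left. This makes all sums of operators over partitions finite on a given \<open>f\<close>.\<close>

lemma star_power_prod_eq_0:
  assumes "0 \<notin># A" "f \<in> pow_span N" "sum_mset A > N"
  shows "star (power_prod A) f = 0"
  using assms
proof (induction A arbitrary: f N)
  case (add n A)
  then have n: "n \<ge> 1"
    by auto
  have *: "star (power_prod (add_mset n A)) f = star (power_prod A) (p_star n f)"
    by (simp add: mult.commute[of "psum n"] star_mult star_psum[OF n])
  show ?case
  proof (cases "n \<le> N")
    case True
    then have "p_star n f \<in> pow_span (N - n)"
      using p_star_pow_span[OF n add.prems(2)] by simp
    then show ?thesis
      unfolding * using add.prems True by (intro add.IH) auto
  next
    case False
    then have "p_star n f = 0"
      using p_star_pow_span[OF n add.prems(2)] by simp
    then show ?thesis
      unfolding * by (simp add: star_eq_adj lin_zero[OF lin_adj[OF alpha_nonzero]])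
  qed
qed simp

lemma lin_star: "lin (star f)" and lin_star_left: "lin (\<lambda>f. star f u)"
  and lin_perp: "lin (perp f)" and lin_perp_left: "lin (\<lambda>f. perp f u)"
  by (simp_all add: star_eq_adj perp_eq_adj lin_adj lin_adj_left alpha_nonzero)

lemma star_msym_eq_0:
  assumes "0 \<notin># A" "f \<in> pow_span N" "sum_mset A > N"
  shows "star (aug A) f = 0" "star (msym (mpart A)) f = 0"
proof -
  \<comment> \<open>The span of the empty set is 0: \<open>aug A\<close> is a combination of power
    products of the same degree, and each of them gives 0.\<close>
  have "star (aug A) f \<in> symfun.span {}"
    by (rule lin_span[OF lin_star_left _ aug_in_span_power_prod[OF assms(1)]])
      (use assms in \<open>auto simp: star_power_prod_eq_0\<close>)
  then show "star (aug A) f = 0"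
    by simp
  then show "star (msym (mpart A)) f = 0"
    by (simp add: msym_eq_aug lin_scale[OF lin_star_left])
qed

section \<open>Adding a variable\<close>

lemma expo_type_add_single_if:
  "j \<notin> keys a \<Longrightarrow> expo_type (a + single j b) = (if b = 0 then {#} else {#b#}) + expo_type a"
  by (simp add: expo_type_add_single_fresh)

lemma psum_mult_aug_expo:
  assumes "j \<notin> keys a" "b \<ge> 1"
  shows "psum b * aug (expo_type a) =
    aug (expo_type (a + single j b)) + (\<Sum>s\<in>keys a. aug (expo_type (a + single s b)))"
proof -
  have "(\<Sum>s\<in>keys a. aug (expo_type (a + single s b))) =
      (\<Sum>s\<in>keys a. aug (expo_type a - {#lookup a s#} + {#lookup a s + b#}))"
    by (rule sum.cong) (simp_all add: expo_type_add_single)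
  also have "\<dots> = (\<Sum>u\<in>#expo_type a. aug (expo_type a - {#u#} + {#u + b#}))"
    by (rule sum_keys_expo_type)
  finally show ?thesis
    using assms by (simp add: psum_mult_aug expo_type_add_single_fresh)
qed

definition aug_star :: "symfun \<Rightarrow> expo \<Rightarrow> symfun" where
  "aug_star f a = star (aug (expo_type a)) f"

lemma aug_star_zero [simp]: "aug_star f 0 = f"
  by (simp add: aug_star_def expo_type_def star_eq_adj adj_one[OF alpha_nonzero])

text \<open>The product rule for \<open>psum b\<close>, solved for the term with a new variable. It
  is the recursion over the support of the exponent.\<close>

lemma aug_star_add_single:
  assumes "j \<notin> keys a" "b \<ge> 1"
  shows "aug_star f (a + single j b) = p_star b (aug_star f a) - (\<Sum>s\<in>keys a. aug_star f (a + single s b))"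
proof -
  have "p_star b (aug_star f a) = star (psum b * aug (expo_type a)) f"
    using assms by (simp add: aug_star_def star_mult star_psum)
  then show ?thesis
    unfolding psum_mult_aug_expo[OF assms]
    by (simp add: aug_star_def lin_add[OF lin_star_left] lin_sum[OF lin_star_left])
qed

text \<open>The generating series \<open>\<Sum>\<^sub>b x\<^sub>j\<^sup>b p\<^sub>b\<^sup>*\<close> is the operator \<open>\<alpha> x\<^sub>j \<partial>/\<partial>x\<^sub>j\<close>.\<close>

lemma sum_p_star_eq_euler:
  "(\<Sum>b=1..lookup d j. mcoeff (p_star b h) (d - single j b)) = alpha * of_nat (lookup d j) * mcoeff h d"
proof (induction h arbitrary: d rule: power_prod_induct)
  case (base A)
  then show ?case
  proof (induction A arbitrary: d)
    case empty
    have "p_star b 1 = 0" for b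
      by (simp add: p_star_def p_diff_one)
    moreover have "lookup d j \<noteq> 0 \<Longrightarrow> d \<noteq> 0"
      by auto
    ultimately show ?case
      by (auto simp: one_symfun.rep_eq)
  next
    case (add r A)
    then have r: "r \<ge> 1" and IH: "\<And>d. (\<Sum>b=1..lookup d j. mcoeff (p_star b (power_prod A)) (d - single j b)) =
        alpha * of_nat (lookup d j) * mcoeff (power_prod A) d"
      by auto
    let ?h = "power_prod A"
    let ?L = "\<Sum>b=1..lookup d j. \<Sum>i | r \<le> lookup (d - single j b) i. mcoeff (p_star b ?h) (d - single j b - single i r)"
    let ?R = "\<Sum>i | r \<le> lookup d i. \<Sum>b=1..lookup (d - single i r) j. mcoeff (p_star b ?h) (d - single i r - single j b)"
    let ?E = "\<Sum>i | r \<le> lookup d i. alpha * of_nat (lookup (d - single i r) j) * mcoeff ?h (d - single i r)"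
    let ?c = "\<lambda>b. if b = r then alpha * of_nat r * mcoeff ?h (d - single j r) else 0"
    have fin: "finite {i. r \<le> lookup d i}" for d :: expo
      by (rule finite_subset[OF _ finite_keys[of d]]) (use r in \<open>auto simp: in_keys_iff\<close>)
    have comm: "d - single j b - single i r = d - single i r - single j b" for b i
      by (rule poly_mapping_eqI) (simp add: lookup_minus)
    have "(\<Sum>b=1..lookup d j. mcoeff (p_star b (psum r * ?h)) (d - single j b)) =
        (\<Sum>b=1..lookup d j. ?c b) +
        ?L"
    proof (subst sum.distrib[symmetric], rule sum.cong)
      fix b
      have "p_star b (psum r * ?h) = (if b = r then (alpha * of_nat r) *s ?h else 0) + psum r * p_star b ?h"
        using r by (simp add: p_star_def p_diff_psum_mult symfun.scale_right_distrib)
      then show "mcoeff (p_star b (psum r * ?h)) (d - single j b) =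
        ?c b +
        (\<Sum>i | r \<le> lookup (d - single j b) i. mcoeff (p_star b ?h) (d - single j b - single i r))"
        using r by (simp add: mcoeff_psum_mult)
    qed simp
    \<comment> \<open>Lowering \<open>x_j\<close> by \<open>b\<close> and \<open>x_i\<close> by
      \<open>r\<close> commute, so the double sum is reordered to apply the induction hypothesis at
      \<open>d - single i r\<close>.\<close>
    also have "?L =
        ?R"
    proof -
      have "?L =
          (\<Sum>(b, i)\<in>(SIGMA b:{1..lookup d j}. {i. r \<le> lookup (d - single j b) i}). mcoeff (p_star b ?h) (d - single j b - single i r))"
        by (rule sum.Sigma) (use fin in blast)+
      also have "\<dots> = (\<Sum>(i, b)\<in>(SIGMA i:{i. r \<le> lookup d i}. {1..lookup (d - single i r) j}). mcoeff (p_star b ?h) (d - single i r - single j b))"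
        by (rule sum.reindex_bij_witness[where i = prod.swap and j = prod.swap])
          (auto simp: comm, auto simp: lookup_simps split: if_splits)
      also have "\<dots> = ?R"
        by (rule sum.Sigma[symmetric]) (use fin in blast)+
      finally show ?thesis .
    qed
    also have "\<dots> = ?E"
      unfolding IH ..
    also have "(\<Sum>b=1..lookup d j. ?c b) =
        (\<Sum>i | r \<le> lookup d i. if i = j then alpha * of_nat r * mcoeff ?h (d - single i r) else 0)"
      using r fin[of d] by simp
    \<comment> \<open>For \<open>i = j\<close> the Euler operator sees the exponent lowered by
      \<open>r\<close>; the derivative of the factor \<open>psum r\<close> supplies the missing
      \<open>alpha * r\<close>.\<close>
    also have "\<dots> + ?E =
        (\<Sum>i | r \<le> lookup d i. alpha * of_nat (lookup d j) * mcoeff ?h (d - single i r))"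
      unfolding sum.distrib[symmetric]
      by (rule sum.cong) (auto simp: lookup_simps distrib_right[symmetric] distrib_left[symmetric]
          simp flip: of_nat_add)
    also have "\<dots> = alpha * of_nat (lookup d j) * mcoeff (power_prod (add_mset r A)) d"
      using r by (simp add: mcoeff_psum_mult sum_distrib_left)
    finally show ?case
      by simp
  qed
qed (simp_all add: lin_add[OF lin_p_star] lin_scale[OF lin_p_star] sum.distrib distrib_left
    sum_distrib_left[symmetric] mult.left_commute)

section \<open>The operators \<open>W_I\<close> and their recursion\<close>

definition splits_on :: "nat set \<Rightarrow> expo \<Rightarrow> (expo \<times> expo) set" where
  "splits_on I c = {(a, e). a + e = c \<and> keys a = I}"

lemma finite_splits_on [simp]: "finite (splits_on I c)"
  by (rule finite_subset[of _ "expo_splits c"]) (auto simp: splits_on_def)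

text \<open>Coefficients at \<open>x\<^sup>c\<close> of \<open>W\<^sub>I f\<close> and of \<open>(x\<^sub>s K\<^sub>s\<^sub>j - x\<^sub>j) / (x\<^sub>j - x\<^sub>s)\<close> applied to it.\<close>

definition Wcoeff :: "nat set \<Rightarrow> symfun \<Rightarrow> expo \<Rightarrow> qalpha" where
  "Wcoeff I f c = (\<Sum>(a, e)\<in>splits_on I c. mcoeff (aug_star f a) e)"

definition Xcoeff :: "nat set \<Rightarrow> nat \<Rightarrow> nat \<Rightarrow> symfun \<Rightarrow> expo \<Rightarrow> qalpha" where
  "Xcoeff I s j f c =
    (\<Sum>(a, e)\<in>splits_on I c. \<Sum>b=1..lookup e j. mcoeff (aug_star f (a + single s b)) (e - single j b))"

lemma Wcoeff_empty: "Wcoeff {} f c = mcoeff f c"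
proof -
  have "splits_on {} c = {(0, c)}"
    by (auto simp: splits_on_def)
  then show ?thesis
    by (simp add: Wcoeff_def)
qed

text \<open>Split the power \<open>x_j^b\<close> off \<open>x^a\<close> and apply
  \<open>aug_star_add_single\<close>. The first term sums to the Euler operator; the terms in which
  \<open>b\<close> is added to an occupied variable \<open>s\<close> give
  \<open>Xcoeff\<close>.\<close>

lemma Wcoeff_insert:
  assumes j: "j \<notin> I"
  shows "Wcoeff (insert j I) f c =
    alpha * of_nat (lookup c j) * Wcoeff I f c - (\<Sum>s\<in>I. Xcoeff I s j f c)"
proof -
  let ?m = "\<lambda>s a e b. mcoeff (aug_star f (a + single s b)) (e - single j b)"
  let ?S = "SIGMA (a, e):splits_on I c. {1..lookup e j}"
  have "Wcoeff (insert j I) f c =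
      (\<Sum>((a, e), b)\<in>?S. ?m j a e b)"
    unfolding Wcoeff_def
  proof (rule sum.reindex_bij_witness[where
        i = "\<lambda>((a, e), b). (a + single j b, e - single j b)" and
        j = "\<lambda>(a, e). ((a - single j (lookup a j), e + single j (lookup a j)), lookup a j)"], goal_cases)
    case (1 x)
    then show ?case
      by (auto simp: splits_on_def intro!: poly_mapping_eqI simp: lookup_simps)
  next
    case (2 x)
    then obtain a e where x: "x = (a, e)" "a + e = c" "keys a = insert j I"
      by (auto simp: splits_on_def)
    have "keys (a - single j (lookup a j)) = I"
      using x j by (auto simp: set_eq_iff in_keys_iff lookup_simps split: if_splits)
    moreover have "a - single j (lookup a j) + (e + single j (lookup a j)) = c"
      unfolding x(2)[symmetric]
      by (rule poly_mapping_eqI) (simp add: lookup_simps)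
    moreover have "lookup a j \<noteq> 0"
      using x in_keys_iff[of j a] by simp
    ultimately show ?case
      by (auto simp: x splits_on_def lookup_add)
  next
    case (3 y)
    then obtain a e b where y: "y = ((a, e), b)" "a + e = c" "keys a = I" "b \<in> {1..lookup e j}"
      by (auto simp: splits_on_def)
    have "lookup a j = 0"
      using y j in_keys_iff[of j a] by simp
    then show ?case
      using y by (auto intro!: poly_mapping_eqI simp: lookup_simps)
  next
    case (4 y)
    then obtain a e b where y: "y = ((a, e), b)" "a + e = c" "keys a = I" "b \<in> {1..lookup e j}"
      by (auto simp: splits_on_def)
    have "keys (a + single j b) = insert j I"
      using y by (auto simp: set_eq_iff in_keys_iff lookup_simps)
    moreover have "a + single j b + (e - single j b) = c"
      unfolding y(2)[symmetric] using y(4)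
      by (intro poly_mapping_eqI) (auto simp: lookup_simps)
    ultimately show ?case
      by (simp add: y splits_on_def)
  next
    case (5 x)
    then show ?case
      by (auto simp: splits_on_def intro!: arg_cong2[of _ _ _ _ "\<lambda>a e. mcoeff (aug_star f a) e"] poly_mapping_eqI
          simp: lookup_simps)
  qed
  also have "\<dots> = (\<Sum>(a, e)\<in>splits_on I c. \<Sum>b=1..lookup e j. ?m j a e b)"
    by (subst sum.Sigma[symmetric]) (auto simp: case_prod_beta)
  also have "\<dots> = (\<Sum>(a, e)\<in>splits_on I c. alpha * of_nat (lookup c j) * mcoeff (aug_star f a) e -
      (\<Sum>s\<in>I. \<Sum>b=1..lookup e j. ?m s a e b))"
  proof (rule sum.cong, rule refl, safe)
    fix a e assume "(a, e) \<in> splits_on I c"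
    then have ae: "a + e = c" "keys a = I" and aj: "lookup a j = 0"
      using j by (auto simp: splits_on_def in_keys_iff)
    have "(\<Sum>b=1..lookup e j. ?m j a e b) =
      (\<Sum>b=1..lookup e j. mcoeff (p_star b (aug_star f a)) (e - single j b)) -
      (\<Sum>b=1..lookup e j. \<Sum>s\<in>I. ?m s a e b)"
      by (subst sum_subtractf[symmetric], rule sum.cong)
        (use ae j in \<open>simp_all add: aug_star_add_single mcoeff_sum\<close>)
    \<comment> \<open>Since \<open>j\<close> is outside the support of \<open>a\<close>, the
      exponent of \<open>x_j\<close> in \<open>e\<close> is the one in \<open>c\<close>.\<close>
    also have "(\<Sum>b=1..lookup e j. mcoeff (p_star b (aug_star f a)) (e - single j b)) =
        alpha * of_nat (lookup c j) * mcoeff (aug_star f a) e"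
      using sum_p_star_eq_euler[where d = e and j = j and h = "aug_star f a"] aj
      by (simp add: lookup_add flip: ae(1))
    finally show "(\<Sum>b=1..lookup e j. ?m j a e b) =
        alpha * of_nat (lookup c j) * mcoeff (aug_star f a) e -
        (\<Sum>s\<in>I. \<Sum>b=1..lookup e j. ?m s a e b)"
      by (subst (asm) sum.swap)
  qed
  also have "\<dots> = alpha * of_nat (lookup c j) * Wcoeff I f c - (\<Sum>s\<in>I. Xcoeff I s j f c)"
    unfolding Wcoeff_def Xcoeff_def case_prod_beta sum_subtractf sum_distrib_left
    by (subst (2) sum.swap) (rule refl)
  finally show ?thesis .
qed

text \<open>Isolates the variables \<open>x_s\<close> and \<open>x_j\<close>. As \<open>s\<close> is
  in the support of \<open>a\<close>, a power \<open>x \<ge> 1\<close> of \<open>x_s\<close> goes to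
  \<open>a\<close>; as \<open>j\<close> is not, the whole power of \<open>x_j\<close> goes to
  \<open>e\<close>.\<close>

lemma sum_splits_on_two:
  fixes \<phi> :: "expo \<Rightarrow> expo \<Rightarrow> 'a::comm_monoid_add"
  assumes "s \<in> I" "j \<notin> I" "lookup c0 s = 0" "lookup c0 j = 0"
  shows "(\<Sum>(a, e)\<in>splits_on I (c0 + single s p + single j q). \<phi> a e) =
    (\<Sum>x=1..p. \<Sum>(a, e)\<in>splits_on (I - {s}) c0. \<phi> (a + single s x) (e + single s (p - x) + single j q))"
proof -
  have sj: "s \<noteq> j"
    using assms by auto
  let ?c = "c0 + single s p + single j q"
  have "(\<Sum>x=1..p. \<Sum>(a, e)\<in>splits_on (I - {s}) c0. \<phi> (a + single s x) (e + single s (p - x) + single j q)) =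
      (\<Sum>(x, (a, e))\<in>{1..p} \<times> splits_on (I - {s}) c0. \<phi> (a + single s x) (e + single s (p - x) + single j q))"
    by (subst sum.cartesian_product) (simp add: case_prod_beta)
  also have "\<dots> = (\<Sum>(a, e)\<in>splits_on I ?c. \<phi> a e)"
  proof (rule sum.reindex_bij_witness[where
        j = "\<lambda>(x, (a, e)). (a + single s x, e + single s (p - x) + single j q)" and
        i = "\<lambda>(a, e). (lookup a s, (a - single s (lookup a s), e - single s (lookup e s) - single j (lookup e j)))"], goal_cases)
    case (1 y)
    then obtain x a e where y: "y = (x, (a, e))" "a + e = c0" "keys a = I - {s}" "x \<in> {1..p}"
      by (auto simp: splits_on_def)
    have z: "lookup a s = 0" "lookup e s = 0" "lookup a j = 0" "lookup e j = 0"
      using y(2) assms by (auto simp: lookup_add)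
    have "a + single s x - single s x = a"
      by (rule poly_mapping_eqI) (simp add: lookup_add lookup_minus)
    moreover have "e + single s (p - x) + single j q - single s (p - x) - single j q = e"
      by (rule poly_mapping_eqI) (use sj in \<open>simp add: lookup_add lookup_minus\<close>)
    moreover have "lookup (e + single s (p - x) + single j q) s = p - x" "lookup (e + single s (p - x) + single j q) j = q"
      "lookup (a + single s x) s = x"
      using sj z by (auto simp: lookup_simps)
    ultimately show ?case
      by (simp add: y(1))
  next
    case (2 y)
    then obtain x a e where y: "y = (x, (a, e))" "a + e = c0" "keys a = I - {s}" "x \<in> {1..p}"
      by (auto simp: splits_on_def)
    have "keys (a + single s x) = I"
      using y assms by (auto simp: set_eq_iff in_keys_iff lookup_simps)
    moreover have "a + single s x + (e + single s (p - x) + single j q) = ?c"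
      unfolding y(2)[symmetric] using y(4)
      by (intro poly_mapping_eqI) (auto simp: lookup_simps)
    ultimately show ?case
      by (simp add: y(1) splits_on_def)
  next
    case (3 z)
    then obtain a e where z: "z = (a, e)" "a + e = ?c" "keys a = I"
      by (auto simp: splits_on_def)
    have "lookup (a + e) i = lookup ?c i" for i
      using z by simp
    then have l: "lookup a i + lookup e i = lookup c0 i + (if i = s then p else 0) + (if i = j then q else 0)" for i
      by (simp add: lookup_simps eq_commute)
    have aj: "lookup a j = 0"
      using z assms in_keys_iff[of j a] by simp
    have ls: "lookup e s = p - lookup a s" and lj: "lookup e j = q"
      using l[of s] l[of j] assms aj sj by auto
    have "a - single s (lookup a s) + single s (lookup a s) = a"
      by (rule poly_mapping_eqI) (simp add: lookup_simps)
    moreover have "e - single s (lookup e s) - single j (lookup e j) + single s (p - lookup a s) + single j q = e"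
      by (rule poly_mapping_eqI) (use sj ls lj in \<open>auto simp: lookup_simps\<close>)
    ultimately show ?case
      by (simp add: z(1))
  next
    case (4 z)
    then obtain a e where z: "z = (a, e)" "a + e = ?c" "keys a = I"
      by (auto simp: splits_on_def)
    have "lookup (a + e) i = lookup ?c i" for i
      using z by simp
    then have l: "lookup a i + lookup e i = lookup c0 i + (if i = s then p else 0) + (if i = j then q else 0)" for i
      by (simp add: lookup_simps eq_commute)
    have "lookup a s \<noteq> 0"
      using z assms in_keys_iff[of s a] by simp
    moreover have "keys (a - single s (lookup a s)) = I - {s}"
      using z by (auto simp: set_eq_iff in_keys_iff lookup_simps split: if_splits)
    moreover have aj: "lookup a j = 0" and "lookup a s \<le> p"
      using z assms l[of s] sj in_keys_iff[of j a] by auto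
    moreover have "a - single s (lookup a s) + (e - single s (lookup e s) - single j (lookup e j)) = c0"
    proof (rule poly_mapping_eqI)
      fix i
      show "lookup (a - single s (lookup a s) + (e - single s (lookup e s) - single j (lookup e j))) i = lookup c0 i"
        using l[of i] aj assms by (cases "i = s"; cases "i = j") (auto simp: lookup_simps)
    qed
    ultimately show ?case
      by (simp add: z(1) splits_on_def)
  next
    case (5 y)
    then show ?case by auto
  qed
  finally show ?thesis ..
qed

section \<open>Divided differences in two variables\<close>

context
  fixes G :: "nat \<Rightarrow> nat \<Rightarrow> nat \<Rightarrow> 'a::ab_group_add" and X w :: "nat \<Rightarrow> nat \<Rightarrow> 'a"
  assumes sym: "\<And>x y z. G x y z = G x z y"
    and X: "\<And>p q. X p q = (\<Sum>x=1..p. \<Sum>b=1..q. G (x + b) (p - x) (q - b))"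
    and w: "\<And>p q. w p q = (\<Sum>x=1..p. G x (p - x) q)"
begin

text \<open>Coefficientwise form of \<open>X = (x\<^sub>j w - x\<^sub>s K w) / (x\<^sub>s - x\<^sub>j)\<close>, where \<open>K\<close> exchanges \<open>x\<^sub>s\<close> and \<open>x\<^sub>j\<close>.\<close>

lemma divided_difference_rec: "X (Suc p) q = X p (Suc q) - w (Suc p) q + w (Suc q) p"
proof -
  define R where "R = (\<Sum>x<p. \<Sum>b<q. G (x + b + 3) (p - Suc x) (q - Suc b))"
  have "X p (Suc q) = (\<Sum>x<p. G (x + 2) (p - Suc x) q) + R"
    unfolding X R_def One_nat_def sum.atLeast1_atMost_eq sum.lessThan_Suc_shift
    by (simp add: sum.distrib eval_nat_numeral del: sum.lessThan_Suc)
  moreover have "X (Suc p) q = (\<Sum>b<q. G (b + 2) p (q - Suc b)) + R"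
    unfolding X R_def One_nat_def sum.atLeast1_atMost_eq sum.lessThan_Suc_shift
    by (simp add: eval_nat_numeral del: sum.lessThan_Suc)
  moreover have "w (Suc p) q = G 1 p q + (\<Sum>x<p. G (x + 2) (p - Suc x) q)"
    unfolding w One_nat_def sum.atLeast1_atMost_eq sum.lessThan_Suc_shift by (simp add: eval_nat_numeral del: sum.lessThan_Suc)
  moreover have "w (Suc q) p = G 1 p q + (\<Sum>b<q. G (b + 2) p (q - Suc b))"
    unfolding w One_nat_def sum.atLeast1_atMost_eq sum.lessThan_Suc_shift by (simp add: sym eval_nat_numeral del: sum.lessThan_Suc)
  ultimately show ?thesis
    by simp
qed

lemma divided_difference_sym: "X p q = X q p"
  unfolding X by (subst sum.swap) (simp add: sym add.commute)

text \<open>The recursion moves one unit after another from \<open>p\<close> to \<open>q\<close>,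
  until \<open>X 0\<close> is reached, which is an empty sum. The values of \<open>w\<close> met on
  the way all vanish by assumption.\<close>

lemma divided_difference_zero:
  assumes "\<And>r. r \<le> p \<Longrightarrow> w (p - r) (q + r) = 0" "\<And>r. 1 \<le> r \<Longrightarrow> r \<le> p \<Longrightarrow> w (q + r) (p - r) = 0"
  shows "X p q = 0"
  using assms
proof (induction p arbitrary: q)
  case 0
  then show ?case
    by (simp add: X)
next
  case (Suc p)
  have "X p (Suc q) = 0"
  proof (rule Suc.IH)
    fix r assume r: "r \<le> p"
    show "w (p - r) (Suc q + r) = 0"
      using Suc.prems(1)[of "Suc r"] r by simp
    show "w (Suc q + r) (p - r) = 0"
      using Suc.prems(2)[of "Suc r"] r by simp
  qed
  then show ?case
    using Suc.prems(1)[of 0] Suc.prems(2)[of 1] by (simp add: divided_difference_rec)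
qed

text \<open>After one step of the recursion only \<open>- w p q\<close> remains.\<close>

lemma divided_difference_diag:
  assumes "\<And>r. 1 \<le> r \<Longrightarrow> r \<le> p \<Longrightarrow> w (p - r) (q + r) = 0" "\<And>r. 1 \<le> r \<Longrightarrow> r \<le> p \<Longrightarrow> w (q + r) (p - r) = 0"
  shows "X p q = - w p q"
proof (cases p)
  case 0
  then show ?thesis
    by (simp add: X w)
next
  case (Suc p')
  have "X p' (Suc q) = 0"
  proof (rule divided_difference_zero)
    fix r assume r: "r \<le> p'"
    show "w (p' - r) (Suc q + r) = 0"
      using assms(1)[of "Suc r"] r Suc by simp
    show "w (Suc q + r) (p' - r) = 0"
      using assms(2)[of "Suc r"] r Suc by simp
  qed
  then show ?thesis
    using assms(2)[of 1] by (simp add: divided_difference_rec Suc)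
qed

end

text \<open>The order by sums of squares refines the dominance order, and is easier to follow through \<open>W\<^sub>I\<close>.\<close>

definition square_sum :: "nat multiset \<Rightarrow> nat" where
  "square_sum A = (\<Sum>x\<in>#A. x\<^sup>2)"

lemma expo_type_add_two:
  assumes "s \<noteq> j" "lookup c0 s = 0" "lookup c0 j = 0"
  shows "expo_type (c0 + single s p + single j q) =
    (if p = 0 then {#} else {#p#}) + (if q = 0 then {#} else {#q#}) + expo_type c0"
  using assms by (subst expo_type_add_single_if; (subst expo_type_add_single_if)?)
    (auto simp: in_keys_iff lookup_add lookup_single)

lemma square_sum_add_two:
  assumes "s \<noteq> j" "lookup c0 s = 0" "lookup c0 j = 0"
  shows "square_sum (expo_type (c0 + single s p + single j q)) = p\<^sup>2 + q\<^sup>2 + square_sum (expo_type c0)"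
  using assms by (simp add: expo_type_add_two square_sum_def)

text \<open>The facts on divided differences, read in the exponents \<open>p\<close> and
  \<open>q\<close> of \<open>x_s\<close> and \<open>x_j\<close> while the remaining exponent
  \<open>c0\<close> is kept fixed.\<close>

lemma Xcoeff_cases:
  assumes s: "s \<in> I" and j: "j \<notin> I" and c0: "lookup c0 s = 0" "lookup c0 j = 0"
  defines "C \<equiv> \<lambda>p q. c0 + single s p + single j q"
  shows Xcoeff_zero: "\<And>p q. (\<And>r. r \<le> p \<Longrightarrow> Wcoeff I f (C (p - r) (q + r)) = 0) \<Longrightarrow>
      (\<And>r. 1 \<le> r \<Longrightarrow> r \<le> p \<Longrightarrow> Wcoeff I f (C (q + r) (p - r)) = 0) \<Longrightarrow> Xcoeff I s j f (C p q) = 0"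
    and Xcoeff_diag: "\<And>p q. (\<And>r. 1 \<le> r \<Longrightarrow> r \<le> p \<Longrightarrow> Wcoeff I f (C (p - r) (q + r)) = 0) \<Longrightarrow>
      (\<And>r. 1 \<le> r \<Longrightarrow> r \<le> p \<Longrightarrow> Wcoeff I f (C (q + r) (p - r)) = 0) \<Longrightarrow>
      Xcoeff I s j f (C p q) = - Wcoeff I f (C p q)"
    and Xcoeff_sym: "\<And>p q. Xcoeff I s j f (C p q) = Xcoeff I s j f (C q p)"
proof -
  have sj: "s \<noteq> j"
    using s j by auto
  \<comment> \<open>Here \<open>x\<close> is the power of \<open>x_s\<close> taken by
    \<open>x^a\<close>, and \<open>y\<close>, \<open>z\<close> are the powers of \<open>x_s\<close>,
    \<open>x_j\<close> in the symmetric function \<open>aug_star\<close>; hence the symmetry in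
    \<open>y\<close> and \<open>z\<close>.\<close>
  define G where "G x y z = (\<Sum>(a, e)\<in>splits_on (I - {s}) c0.
    mcoeff (aug_star f (a + single s x)) (e + single s y + single j z))" for x y z
  have z: "lookup e s = 0 \<and> lookup e j = 0" if "(a, e) \<in> splits_on (I - {s}) c0" for a e
  proof -
    have "lookup (a + e) s = 0" "lookup (a + e) j = 0"
      using that c0 by (simp_all add: splits_on_def)
    then show ?thesis
      by (simp add: lookup_add)
  qed
  have sym: "G x y z = G x z y" for x y z
    unfolding G_def
  proof (intro sum.cong refl, clarify)
    fix a e assume ae: "(a, e) \<in> splits_on (I - {s}) c0"
    have "expo_type (e + single s y + single j z) = expo_type (e + single s z + single j y)"
      unfolding expo_type_add_two[OF sj conjunct1 conjunct2, OF z[OF ae] z[OF ae]]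
      by (simp only: add.commute)
    then show "mcoeff (aug_star f (a + single s x)) (e + single s y + single j z) =
      mcoeff (aug_star f (a + single s x)) (e + single s z + single j y)"
      by (rule mcoeff_expo_type)
  qed
  have w: "Wcoeff I f (C p q) = (\<Sum>x=1..p. G x (p - x) q)" for p q
    unfolding Wcoeff_def C_def G_def using s j c0 by (rule sum_splits_on_two)
  have X: "Xcoeff I s j f (C p q) = (\<Sum>x=1..p. \<Sum>b=1..q. G (x + b) (p - x) (q - b))" for p q
  proof -
    have "Xcoeff I s j f (C p q) = (\<Sum>x=1..p. \<Sum>(a, e)\<in>splits_on (I - {s}) c0. \<Sum>b=1..q.
      mcoeff (aug_star f (a + single s (x + b))) (e + single s (p - x) + single j (q - b)))"
      unfolding Xcoeff_def C_def sum_splits_on_two[OF s j c0]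
    proof (intro sum.cong refl, clarify)
      fix x a e assume ae: "(a, e) \<in> splits_on (I - {s}) c0"
      have 1: "lookup (e + single s (p - x) + single j q) j = q"
        using z[OF ae] sj by (simp add: lookup_add lookup_single)
      have 2: "e + single s (p - x) + single j q - single j b = e + single s (p - x) + single j (q - b)" if "b \<le> q" for b
        by (rule poly_mapping_eqI) (use that in \<open>auto simp: lookup_simps\<close>)
      show "(\<Sum>b=1..lookup (e + single s (p - x) + single j q) j.
          mcoeff (aug_star f (a + single s x + single s b)) (e + single s (p - x) + single j q - single j b)) =
        (\<Sum>b=1..q. mcoeff (aug_star f (a + single s (x + b))) (e + single s (p - x) + single j (q - b)))"
        unfolding 1 by (rule sum.cong) (simp_all add: 2 add.assoc[of a] flip: single_add)
    qed
    also have "\<dots> = (\<Sum>x=1..p. \<Sum>b=1..q. G (x + b) (p - x) (q - b))"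
      unfolding G_def case_prod_beta by (subst (2) sum.swap) (rule refl)
    finally show ?thesis .
  qed
  define XX where "XX p q = Xcoeff I s j f (C p q)" for p q
  define WW where "WW p q = Wcoeff I f (C p q)" for p q
  have XX: "XX p q = (\<Sum>x=1..p. \<Sum>b=1..q. G (x + b) (p - x) (q - b))" for p q
    unfolding XX_def by (rule X)
  have WW: "WW p q = (\<Sum>x=1..p. G x (p - x) q)" for p q
    unfolding WW_def by (rule w)
  show "Xcoeff I s j f (C p q) = 0"
    if "\<And>r. r \<le> p \<Longrightarrow> Wcoeff I f (C (p - r) (q + r)) = 0"
      "\<And>r. 1 \<le> r \<Longrightarrow> r \<le> p \<Longrightarrow> Wcoeff I f (C (q + r) (p - r)) = 0" for p q
    using divided_difference_zero[of G XX WW, OF sym XX WW] that unfolding XX_def WW_def by metis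
  show "Xcoeff I s j f (C p q) = - Wcoeff I f (C p q)"
    if "\<And>r. 1 \<le> r \<Longrightarrow> r \<le> p \<Longrightarrow> Wcoeff I f (C (p - r) (q + r)) = 0"
      "\<And>r. 1 \<le> r \<Longrightarrow> r \<le> p \<Longrightarrow> Wcoeff I f (C (q + r) (p - r)) = 0" for p q
    using divided_difference_diag[of G XX WW, OF sym XX WW] that unfolding XX_def WW_def by metis
  show "Xcoeff I s j f (C p q) = Xcoeff I s j f (C q p)" for p q
    using divided_difference_sym[of G XX WW, OF sym XX WW] unfolding XX_def by metis
qed

lemma square_spread:
  fixes p q r :: nat
  assumes "p \<le> q" "1 \<le> r" "r \<le> p"
  shows "p\<^sup>2 + q\<^sup>2 < (p - r)\<^sup>2 + (q + r)\<^sup>2"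
proof -
  obtain t where t: "p = r + t"
    using assms le_Suc_ex by blast
  have "r * t < r * q"
    using assms t by simp
  then show ?thesis
    by (auto simp: t power2_eq_square algebra_simps intro!: add_strict_mono)
qed

text \<open>The coefficient at the leading type is left open; it will be the diagonal entry of the
  operator.\<close>

definition supp_le :: "nat multiset \<Rightarrow> (expo \<Rightarrow> qalpha) \<Rightarrow> bool" where
  "supp_le A F \<longleftrightarrow> (\<forall>c. F c \<noteq> 0 \<longrightarrow> expo_type c = A \<or> square_sum (expo_type c) < square_sum A)"

lemma supp_leD: "supp_le A F \<Longrightarrow> expo_type c \<noteq> A \<Longrightarrow> square_sum A \<le> square_sum (expo_type c) \<Longrightarrow> F c = 0"
  unfolding supp_le_def by (meson not_le)

lemma ex_add_two:
  fixes c :: expo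
  assumes "s \<noteq> j"
  shows "\<exists>c0. c = c0 + single s (lookup c s) + single j (lookup c j) \<and> lookup c0 s = 0 \<and> lookup c0 j = 0"
  by (rule exI[of _ "c - single s (lookup c s) - single j (lookup c j)"])
    (use assms in \<open>auto intro!: poly_mapping_eqI simp: lookup_simps\<close>)

lemma Wcoeff_spread_zero:
  assumes W: "supp_le A (Wcoeff I f)"
    and sj: "s \<noteq> j" and c0: "lookup c0 s = 0" "lookup c0 j = 0"
    and ge: "square_sum A \<le> square_sum (expo_type (c0 + single s p + single j q))" and r: "1 \<le> r" "r \<le> p" "p \<le> q"
  shows "Wcoeff I f (c0 + single s (p - r) + single j (q + r)) = 0"
    and "Wcoeff I f (c0 + single s (q + r) + single j (p - r)) = 0"
proof -
  have "square_sum A < square_sum (expo_type (c0 + single s (p - r) + single j (q + r)))"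
    using square_spread[OF r(3,1,2)] ge by (simp add: square_sum_add_two[OF sj c0])
  then show "Wcoeff I f (c0 + single s (p - r) + single j (q + r)) = 0"
    by (intro supp_leD[OF W]) auto
  have "square_sum A < square_sum (expo_type (c0 + single s (q + r) + single j (p - r)))"
    using square_spread[OF r(3,1,2)] ge by (simp add: square_sum_add_two[OF sj c0])
  then show "Wcoeff I f (c0 + single s (q + r) + single j (p - r)) = 0"
    by (intro supp_leD[OF W]) auto
qed

text \<open>If the exponent of \<open>x_s\<close> is at most that of \<open>x_j\<close>, then
  \<open>Xcoeff\<close> at \<open>c\<close> is made of values of \<open>Wcoeff\<close> at
  \<open>c\<close> and at exponents where these two entries are spread further apart. Spreading
  raises \<open>square_sum\<close>, so triangularity survives. The other case follows by
  \<open>Xcoeff_sym\<close>.\<close>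

lemma supp_le_Wcoeff_insert:
  assumes W: "supp_le A (Wcoeff I f)" and j: "j \<notin> I"
  shows "supp_le A (Wcoeff (insert j I) f)"
proof -
  have "Wcoeff (insert j I) f c = 0"
    if ge: "square_sum A \<le> square_sum (expo_type c)" and ne: "expo_type c \<noteq> A" for c
  proof -
    have "Xcoeff I s j f c = 0" if s: "s \<in> I" for s
    proof -
      have sj: "s \<noteq> j"
        using s j by auto
      have le: "Xcoeff I s j f (c0 + single s p + single j q) = 0"
        if c0: "lookup c0 s = 0" "lookup c0 j = 0" and pq: "p \<le> q"
          and ge: "square_sum A \<le> square_sum (expo_type (c0 + single s p + single j q))"
          and ne: "expo_type (c0 + single s p + single j q) \<noteq> A" for c0 p q
      proof (rule Xcoeff_zero[OF s j c0])
        fix r assume r: "r \<le> p"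
        show "Wcoeff I f (c0 + single s (p - r) + single j (q + r)) = 0"
        proof (cases "r = 0")
          case True
          then show ?thesis
            using supp_leD[OF W ne ge] by simp
        next
          case False
          then show ?thesis
            using r by (intro Wcoeff_spread_zero(1)[OF W sj c0 ge _ _ pq]) auto
        qed
        show "Wcoeff I f (c0 + single s (q + r) + single j (p - r)) = 0" if "1 \<le> r"
          using r that by (intro Wcoeff_spread_zero(2)[OF W sj c0 ge _ _ pq]) auto
      qed
      obtain c0 where c: "c = c0 + single s (lookup c s) + single j (lookup c j)" and c0: "lookup c0 s = 0" "lookup c0 j = 0"
        using ex_add_two[OF sj] by blast
      show ?thesis
      proof (cases "lookup c s \<le> lookup c j")
        case True
        then show ?thesis
          using le[OF c0 True] ge ne c by simp
      next
        case False
        have "expo_type (c0 + single s (lookup c j) + single j (lookup c s)) = expo_type c"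
          by (subst (3) c) (simp add: expo_type_add_two[OF sj c0])
        then have "Xcoeff I s j f (c0 + single s (lookup c j) + single j (lookup c s)) = 0"
          using False ge ne by (intro le[OF c0]) auto
        then show ?thesis
          using Xcoeff_sym[OF s j c0, of f "lookup c j" "lookup c s"] c by simp
      qed
    qed
    then show ?thesis
      using supp_leD[OF W ne ge] by (simp add: Wcoeff_insert[OF j])
  qed
  then show ?thesis
    unfolding supp_le_def by (meson not_le)
qed

lemma supp_le_Wcoeff:
  assumes "finite I"
  shows "supp_le (mset lam) (Wcoeff I (msym lam))"
  using assms
proof (induction I)
  case empty
  then show ?case
    by (simp add: supp_le_def Wcoeff_empty mcoeff_msym)
qed (simp add: supp_le_Wcoeff_insert)

text \<open>As \<open>x_j\<close> has the largest exponent, each \<open>s\<close> in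
  \<open>I\<close> contributes \<open>- Xcoeff\<close>, which is \<open>Wcoeff I f c\<close> itself;
  this is the source of the summand \<open>card I\<close>.\<close>

lemma Wcoeff_insert_diag:
  assumes W: "supp_le A (Wcoeff I f)" and j: "j \<notin> I" and c: "expo_type c = A"
    and le: "\<And>s. s \<in> I \<Longrightarrow> lookup c s \<le> lookup c j"
  shows "Wcoeff (insert j I) f c = (alpha * of_nat (lookup c j) + of_nat (card I)) * Wcoeff I f c"
proof -
  have "Xcoeff I s j f c = - Wcoeff I f c" if s: "s \<in> I" for s
  proof -
    have sj: "s \<noteq> j"
      using s j by auto
    obtain c0 where c': "c = c0 + single s (lookup c s) + single j (lookup c j)" and c0: "lookup c0 s = 0" "lookup c0 j = 0"
      using ex_add_two[OF sj] by blast
    have ge: "square_sum A \<le> square_sum (expo_type (c0 + single s (lookup c s) + single j (lookup c j)))"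
      using c c' by simp
    have "Xcoeff I s j f (c0 + single s (lookup c s) + single j (lookup c j)) =
        - Wcoeff I f (c0 + single s (lookup c s) + single j (lookup c j))"
      by (rule Xcoeff_diag[OF s j c0]) (auto intro!: Wcoeff_spread_zero[OF W sj c0 ge] le s)
    then show ?thesis
      using c' by simp
  qed
  then show ?thesis
    by (simp add: Wcoeff_insert[OF j] distrib_right)
qed

text \<open>The variables are added in increasing order, so each new one has the largest exponent so
  far, and the number of variables already present is its rank in \<open>I\<close>.\<close>

lemma Wcoeff_msym_diag:
  assumes "finite I" "expo_type c = mset lam"
    and mono: "\<And>s t. s \<in> I \<Longrightarrow> t \<in> I \<Longrightarrow> s \<le> t \<Longrightarrow> lookup c s \<le> lookup c t"
  shows "Wcoeff I (msym lam) c = (\<Prod>j\<in>I. alpha * of_nat (lookup c j) + of_nat (card {i \<in> I. i < j}))"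
  using assms
proof (induction I rule: finite_linorder_max_induct)
  case empty
  then show ?case
    by (simp add: Wcoeff_empty mcoeff_msym)
next
  case (insert j I)
  then have j: "j \<notin> I"
    by auto
  have "Wcoeff (insert j I) (msym lam) c = (alpha * of_nat (lookup c j) + of_nat (card I)) * Wcoeff I (msym lam) c"
    using insert by (intro Wcoeff_insert_diag[OF supp_le_Wcoeff j]) auto
  also have "Wcoeff I (msym lam) c = (\<Prod>j\<in>I. alpha * of_nat (lookup c j) + of_nat (card {i \<in> I. i < j}))"
    using insert by (intro insert.IH) auto
  also have "\<dots> = (\<Prod>i\<in>I. alpha * of_nat (lookup c i) + of_nat (card {i' \<in> insert j I. i' < i}))"
    by (rule prod.cong) (use insert.hyps in \<open>auto intro!: arg_cong[where f = card] dest: less_asym\<close>)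
  also have "card I = card {i \<in> insert j I. i < j}"
    by (rule arg_cong[where f = card]) (use insert.hyps in auto)
  finally show ?case
    using insert.hyps j by simp
qed

section \<open>Triangularity and self-adjointness\<close>

definition parts_of :: "nat \<Rightarrow> nat \<Rightarrow> nat multiset set" where
  "parts_of N k = {A \<in> parts_upto N. size A = k}"

lemma finite_parts_of [simp]: "finite (parts_of N k)"
  by (simp add: parts_of_def)

text \<open>For the identity this is the operator \<open>D_k\<close>, and for skewing by
  \<open>esym n\<close> the claimed coefficient up to sign, so that both share the arguments on
  finiteness and linearity.\<close>

definition sumop :: "(symfun \<Rightarrow> symfun) \<Rightarrow> nat \<Rightarrow> symfun \<Rightarrow> symfun" where
  "sumop T k f =
    sum' (\<lambda>lam. of_nat (d_coeff lam) *s (T (msym lam) * star (msym lam) f)) {lam \<in> partitions. length lam = k}"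

lemma sumop_eq:
  assumes "lin T" "f \<in> pow_span N"
  shows "sumop T k f = (\<Sum>A\<in>parts_of N k. T (aug A) * star (msym (mpart A)) f)"
proof -
  have inj: "inj_on mpart S" for S
    by (rule inj_onI) (metis mset_mpart)
  have "sumop T k f = (\<Sum>lam\<in>mpart ` parts_of N k. of_nat (d_coeff lam) *s (T (msym lam) * star (msym lam) f))"
    unfolding sumop_def
  proof (rule sum'_eq_sum)
    show "mpart ` parts_of N k \<subseteq> {lam \<in> partitions. length lam = k}"
      by (auto simp: parts_of_def parts_upto_def mpart_partitions)
  next
    fix lam assume lam: "lam \<in> {lam \<in> partitions. length lam = k}" "lam \<notin> mpart ` parts_of N k"
    then have m: "mpart (mset lam) = lam" "0 \<notin># mset lam"
      using mpart_mset mset_partition_nonzero by blast+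
    then have "mset lam \<notin> parts_of N k"
      using lam by (metis imageI)
    then have "sum_mset (mset lam) > N"
      using lam m by (simp add: parts_of_def parts_upto_def)
    then have "star (msym lam) f = 0"
      using star_msym_eq_0(2)[OF m(2) assms(2)] m by simp
    then show "of_nat (d_coeff lam) *s (T (msym lam) * star (msym lam) f) = 0"
      by simp
  qed auto
  also have "\<dots> = (\<Sum>A\<in>parts_of N k. T (aug A) * star (msym (mpart A)) f)"
    by (simp add: sum.reindex[OF inj] aug_def lin_scale[OF assms(1)] d_coeff_eq_dfac)
  finally show ?thesis .
qed

lemma pow_span_max:
  "\<exists>N. f \<in> pow_span N \<and> g \<in> pow_span N"
proof -
  obtain M N where "f \<in> pow_span M" "g \<in> pow_span N"
    using ex_pow_span by blast
  then show ?thesis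
    using pow_span_mono[of M "max M N"] pow_span_mono[of N "max M N"] by (intro exI[of _ "max M N"]) auto
qed

lemma lin_sumop:
  assumes "lin T"
  shows "lin (sumop T k)"
proof (rule linI)
  fix f g
  obtain N where N: "f \<in> pow_span N" "g \<in> pow_span N"
    using pow_span_max by blast
  then have "f + g \<in> pow_span N"
    by (simp add: pow_span_def symfun.span_add)
  with N show "sumop T k (f + g) = sumop T k f + sumop T k g"
    by (simp add: sumop_eq[OF assms] lin_add[OF lin_star] distrib_left sum.distrib)
next
  fix c f
  obtain N where N: "f \<in> pow_span N"
    using ex_pow_span by blast
  then have "c *s f \<in> pow_span N"
    by (simp add: pow_span_def symfun.span_scale)
  with N show "sumop T k (c *s f) = c *s sumop T k f"
    by (simp add: sumop_eq[OF assms] lin_scale[OF lin_star] symfun.scale_sum_right)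
qed

lemma lin_id: "lin (\<lambda>x. x)"
  by (rule linI) auto

abbreviation Dop :: "nat \<Rightarrow> symfun \<Rightarrow> symfun" where
  "Dop \<equiv> sumop (\<lambda>x. x)"

lemma keys_subset_add: "keys a \<subseteq> keys (a + b)" for a b :: expo
  by (auto simp: in_keys_iff lookup_add simp del: lookup_not_eq_zero_eq_in_keys)

text \<open>The factor \<open>aug A\<close> supplies the monomials \<open>x^a\<close> with
  \<open>a\<close> of type \<open>A\<close>. Collecting them by the support \<open>I\<close> of
  \<open>a\<close>, which lies inside that of \<open>c\<close>, gives the operators
  \<open>W_I\<close>.\<close>

lemma mcoeff_Dop:
  "mcoeff (Dop k f) c = (\<Sum>I | I \<subseteq> keys c \<and> card I = k. Wcoeff I f c)"
proof -
  obtain N where N: "f \<in> pow_span N"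
    using ex_pow_span by blast
  let ?X = "{x \<in> expo_splits c. card (keys (fst x)) = k}"
  let ?h = "\<lambda>a e. \<Sum>A\<in>parts_of N k. if expo_type a = A then mcoeff (aug_star f a) e else 0"
  have "mcoeff (Dop k f) c =
      (\<Sum>A\<in>parts_of N k. \<Sum>(a, e)\<in>expo_splits c. if expo_type a = A then mcoeff (aug_star f a) e else 0)"
    unfolding sumop_eq[OF lin_id N] mcoeff_sum mcoeff_mult
    by (intro sum.cong refl) (auto simp: mcoeff_aug mcoeff_msym aug_star_def aug_def lin_scale[OF lin_star_left])
  also have "\<dots> = (\<Sum>(a, e)\<in>expo_splits c. ?h a e)"
    unfolding case_prod_beta by (rule sum.swap)
  also have "\<dots> = (\<Sum>x\<in>?X. mcoeff (aug_star f (fst x)) (snd x))"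
  proof (rule sum.mono_neutral_cong_right)
    show "\<forall>x\<in>expo_splits c - ?X.
       (case x of (a, e) \<Rightarrow> ?h a e) = 0"
      by (auto simp: parts_of_def size_expo_type intro!: sum.neutral split: if_splits)
  next
    fix x assume x: "x \<in> ?X"
    obtain a e where ae: "x = (a, e)"
      by (cases x)
    have "mcoeff (aug_star f a) e = 0" if "expo_type a \<notin> parts_of N k"
    proof -
      have "sum_mset (expo_type a) > N"
        using that x ae by (simp add: parts_of_def parts_upto_def size_expo_type)
      then show ?thesis
        using star_msym_eq_0(1)[OF zero_notin_expo_type N] by (simp add: aug_star_def)
    qed
    then show "(case x of (a, e) \<Rightarrow> ?h a e) =
        mcoeff (aug_star f (fst x)) (snd x)"
      by (simp add: ae)
  qed auto
  also have "\<dots> = (\<Sum>I | I \<subseteq> keys c \<and> card I = k.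
      \<Sum>x\<in>{x \<in> ?X. keys (fst x) = I}. mcoeff (aug_star f (fst x)) (snd x))"
  proof (rule sum.group[symmetric])
    show "(\<lambda>x. keys (fst x)) ` ?X \<subseteq> {I. I \<subseteq> keys c \<and> card I = k}"
      by (auto intro: subsetD[OF keys_subset_add])
  qed auto
  also have "\<dots> = (\<Sum>I | I \<subseteq> keys c \<and> card I = k. Wcoeff I f c)"
    unfolding Wcoeff_def case_prod_beta
    by (intro sum.cong refl) (auto simp: splits_on_def expo_splits_def)
  finally show ?thesis .
qed

section \<open>The diagonal entries of \<open>D_k\<close>\<close>

definition eps :: "nat \<Rightarrow> qalpha list \<Rightarrow> qalpha" where
  "eps k bs = (\<Sum>I | I \<subseteq> {..<length bs} \<and> card I = k. \<Prod>j\<in>I. bs ! j + of_nat (card {i \<in> I. i < j}))"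

definition jack_list :: "partition \<Rightarrow> qalpha list" where
  "jack_list lam = map (\<lambda>x. alpha * of_nat x) (rev lam)"

definition incr_expo :: "partition \<Rightarrow> expo" where
  "incr_expo lam = Poly_Mapping.nth (rev lam)"

lemma lookup_incr_expo: "lookup (incr_expo lam) i = (if i < length lam then rev lam ! i else 0)"
  by (simp add: incr_expo_def nth.rep_eq nth_default_def)

lemma keys_incr_expo:
  assumes "lam \<in> partitions"
  shows "keys (incr_expo lam) = {..<length lam}"
proof -
  have "rev lam ! i \<noteq> 0" if "i < length lam" for i
    using assms nth_mem[of i "rev lam"] that by (intro notI) (auto simp: partitions_def simp del: nth_mem)
  then show ?thesis
    by (auto simp: in_keys_iff lookup_incr_expo split: if_splits)
qed

lemma expo_type_incr_expo:
  assumes "lam \<in> partitions"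
  shows "expo_type (incr_expo lam) = mset lam"
proof -
  have "expo_type (incr_expo lam) = image_mset (\<lambda>i. rev lam ! i) (mset_set {0..<length lam})"
    unfolding expo_type_def keys_incr_expo[OF assms] lessThan_atLeast0
    by (rule image_mset_cong) (simp add: lookup_incr_expo)
  also have "\<dots> = mset (map (\<lambda>i. rev lam ! i) [0..<length (rev lam)])"
    by simp
  also have "\<dots> = mset lam"
    unfolding map_nth by simp
  finally show ?thesis .
qed

lemma incr_expo_mono:
  assumes "lam \<in> partitions" "s \<le> t" "t < length lam"
  shows "lookup (incr_expo lam) s \<le> lookup (incr_expo lam) t"
proof -
  have "sorted (rev lam)"
    using assms by (simp add: partitions_def sorted_wrt_rev)
  then show ?thesis
    using assms by (simp add: lookup_incr_expo sorted_nth_mono)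
qed

text \<open>The coefficient depends on the type only, so it may be taken at the exponent that
  increases along the variables, where \<open>Wcoeff_msym_diag\<close> applies to every
  \<open>I\<close>.\<close>

lemma mcoeff_Dop_msym_diag:
  assumes lam: "lam \<in> partitions" and c: "expo_type c = mset lam"
  shows "mcoeff (Dop k (msym lam)) c = eps k (jack_list lam)"
proof -
  let ?c = "incr_expo lam"
  have "mcoeff (Dop k (msym lam)) c = mcoeff (Dop k (msym lam)) ?c"
    by (rule mcoeff_expo_type) (simp add: c expo_type_incr_expo lam)
  also have "\<dots> = (\<Sum>I | I \<subseteq> {..<length lam} \<and> card I = k. Wcoeff I (msym lam) ?c)"
    by (simp add: mcoeff_Dop keys_incr_expo[OF lam])
  also have "\<dots> = eps k (jack_list lam)"
    unfolding eps_def
  proof (rule sum.cong)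
    fix I assume "I \<in> {I. I \<subseteq> {..<length (jack_list lam)} \<and> card I = k}"
    then have I: "I \<subseteq> {..<length lam}"
      by (simp add: jack_list_def)
    then have "Wcoeff I (msym lam) ?c =
        (\<Prod>j\<in>I. alpha * of_nat (lookup ?c j) + of_nat (card {i \<in> I. i < j}))"
      using lam by (intro Wcoeff_msym_diag incr_expo_mono) (auto simp: expo_type_incr_expo finite_subset)
    also have "\<dots> = (\<Prod>j\<in>I. jack_list lam ! j + of_nat (card {i \<in> I. i < j}))"
      by (rule prod.cong) (use I in \<open>auto simp: jack_list_def lookup_incr_expo\<close>)
    finally show "Wcoeff I (msym lam) ?c = (\<Prod>j\<in>I. jack_list lam ! j + of_nat (card {i \<in> I. i < j}))" .
  qed (simp add: jack_list_def)
  finally show ?thesis .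
qed

definition low_span :: "nat \<Rightarrow> symfun set" where
  "low_span m = symfun.span (msym ` {\<mu> \<in> partitions. square_sum (mset \<mu>) < m})"

lemma low_spanI:
  assumes "\<And>c. mcoeff f c \<noteq> 0 \<Longrightarrow> square_sum (expo_type c) < m"
  shows "f \<in> low_span m"
proof -
  obtain N where N: "mdeg_le f N"
    using ex_mdeg_le by blast
  have "mcoeff f (expo_of A) *s msym (mpart A) \<in> low_span m" if "A \<in> parts_upto N" for A
  proof (cases "mcoeff f (expo_of A) = 0")
    case False
    then have "mpart A \<in> {\<mu> \<in> partitions. square_sum (mset \<mu>) < m}"
      using that assms[of "expo_of A"] by (simp add: parts_upto_def mpart_partitions)
    then show ?thesis
      unfolding low_span_def by (intro symfun.span_scale symfun.span_base imageI)
  qed (simp add: low_span_def symfun.span_zero)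
  then show ?thesis
    by (subst mcoeff_expansion[OF N]) (auto simp: low_span_def intro!: symfun.span_sum)
qed

lemma Dop_msym_triangular:
  assumes lam: "lam \<in> partitions"
  shows "Dop k (msym lam) - eps k (jack_list lam) *s msym lam \<in> low_span (square_sum (mset lam))"
proof (rule low_spanI, rule ccontr)
  fix c assume nz: "mcoeff (Dop k (msym lam) - eps k (jack_list lam) *s msym lam) c \<noteq> 0"
    and ge: "\<not> square_sum (expo_type c) < square_sum (mset lam)"
  show False
  proof (cases "expo_type c = mset lam")
    case True
    then show False
      using nz by (simp add: mcoeff_Dop_msym_diag[OF lam True] mcoeff_msym)
  next
    case False
    have "Wcoeff I (msym lam) c = 0" if "I \<subseteq> keys c" for I
      using that False ge by (intro supp_leD[OF supp_le_Wcoeff]) (auto intro: finite_subset)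
    then show False
      using nz False by (simp add: mcoeff_Dop mcoeff_msym)
  qed
qed

text \<open>Each summand is a multiple of multiplication by \<open>m_\<lambda>\<close> composed with
  its own adjoint.\<close>

lemma Dop_self_adjoint: "form_alpha (Dop k f) g = form_alpha f (Dop k g)"
proof -
  obtain N where N: "f \<in> pow_span N" "g \<in> pow_span N"
    using pow_span_max by blast
  have *: "p_form alpha (aug A * star (msym (mpart A)) f) g = p_form alpha f (aug A * star (msym (mpart A)) g)" for A
    unfolding aug_def
    by (simp add: p_form_scale_left p_form_scale_right star_eq_adj p_form_adj[OF alpha_nonzero, symmetric])
      (simp add: p_form_sym[of alpha _ g] p_form_sym[of alpha _ "adj alpha _ g"] p_form_adj[OF alpha_nonzero])
  show ?thesis
    using N by (simp add: form_alpha_def sumop_eq[OF lin_id] p_form_sum_left p_form_sum_right *)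
qed

section \<open>Sums of squares and the dominance order\<close>

definition nth0 :: "nat list \<Rightarrow> nat \<Rightarrow> int" where
  "nth0 xs i = (if i < length xs then int (xs ! i) else 0)"

lemma sum_nth0:
  fixes g :: "int \<Rightarrow> int"
  assumes "length xs \<le> n"
  shows "(\<Sum>i<n. g (nth0 xs i)) = (\<Sum>x\<leftarrow>xs. g (int x)) + of_nat (n - length xs) * g 0"
proof -
  have "(\<Sum>i<n. g (nth0 xs i)) = (\<Sum>i\<in>{..<length xs} \<union> {length xs..<n}. g (nth0 xs i))"
    using assms by (intro sum.cong) auto
  also have "\<dots> = (\<Sum>i<length xs. g (nth0 xs i)) + (\<Sum>i=length xs..<n. g (nth0 xs i))"
    by (rule sum.union_disjoint) auto
  also have "(\<Sum>i<length xs. g (nth0 xs i)) = (\<Sum>x\<leftarrow>xs. g (int x))"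
    by (simp add: sum_list_sum_nth nth0_def lessThan_atLeast0)
  also have "(\<Sum>i=length xs..<n. g (nth0 xs i)) = of_nat (n - length xs) * g 0"
    by (simp add: nth0_def)
  finally show ?thesis .
qed

lemma sum_nth0_take: "(\<Sum>i<n. nth0 xs i) = int (sum_list (take n xs))"
proof (induction n)
  case (Suc n)
  then show ?case
    by (cases "n < length xs") (simp_all add: take_Suc_conv_app_nth nth0_def)
qed simp

lemma nth0_antimono: "lam \<in> partitions \<Longrightarrow> nth0 lam (Suc i) \<le> nth0 lam i"
  by (auto simp: partitions_def nth0_def dest!: sorted_wrt_nth_less[of _ _ i "Suc i"])

text \<open>Summation by parts against the decreasing weights \<open>b\<close>; keeping the boundary
  term on the left lets the induction go through.\<close>

lemma abel_sum_nonneg: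
  fixes b d :: "nat \<Rightarrow> int"
  assumes "\<And>i. b (Suc i) \<le> b i" "\<And>i. (\<Sum>j<i. d j) \<ge> 0"
  shows "b n * (\<Sum>j<n. d j) \<le> (\<Sum>i<n. b i * d i)"
proof (induction n)
  case (Suc n)
  have "b (Suc n) * (\<Sum>j<Suc n. d j) \<le> b n * (\<Sum>j<Suc n. d j)"
    using assms by (intro mult_right_mono)
  also have "\<dots> \<le> (\<Sum>i<Suc n. b i * d i)"
    using Suc by (simp add: distrib_left)
  finally show ?case .
qed simp

lemma nth0_eqD:
  assumes "lam \<in> partitions" "\<mu> \<in> partitions" "\<And>i. nth0 lam i = nth0 \<mu> i"
  shows "lam = \<mu>"
proof (rule nth_equalityI)
  have pos: "nth0 xs i = 0 \<longleftrightarrow> i \<ge> length xs" if "xs \<in> partitions" for xs i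
  proof -
    have "xs ! i \<noteq> 0" if "i < length xs"
      using \<open>xs \<in> partitions\<close> nth_mem[OF that] by (intro notI) (simp add: partitions_def)
    then show ?thesis
      by (auto simp: nth0_def)
  qed
  show len: "length lam = length \<mu>"
    using pos[OF assms(1)] pos[OF assms(2)] assms(3) by (metis le_antisym order_refl)
  show "lam ! i = \<mu> ! i" if "i < length lam" for i
    using assms(3)[of i] that len by (simp add: nth0_def)
qed

text \<open>\<open>\<Sum> a^2 - \<Sum> b^2 = \<Sum> (a - b)^2 + 2 \<Sum> b (a - b)\<close>. The
  first sum on the right is positive since the partitions differ. The second is non-negative by
  summation by parts, because dominance makes the partial sums of \<open>a - b\<close>
  non-negative.\<close>

lemma dominated_square_sum:
  assumes lam: "lam \<in> partitions" and \<mu>: "\<mu> \<in> partitions" and dom: "dominated \<mu> lam" and ne: "\<mu> \<noteq> lam"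
  shows "square_sum (mset \<mu>) < square_sum (mset lam)"
proof -
  let ?a = "nth0 lam" and ?b = "nth0 \<mu>"
  define n where "n = max (length lam) (length \<mu>)"
  have D: "(\<Sum>j<i. ?a j - ?b j) \<ge> 0" for i
    using dom by (simp add: sum_subtractf sum_nth0_take dominated_def)
  have "?b n * (\<Sum>j<n. ?a j - ?b j) \<le> (\<Sum>i<n. ?b i * (?a i - ?b i))"
    by (rule abel_sum_nonneg) (use nth0_antimono[OF \<mu>] D in auto)
  moreover have "?b n * (\<Sum>j<n. ?a j - ?b j) \<ge> 0"
    using D by (intro mult_nonneg_nonneg) (auto simp: nth0_def)
  ultimately have abel: "0 \<le> (\<Sum>i<n. ?b i * (?a i - ?b i))"
    by simp
  obtain i where i: "?a i \<noteq> ?b i"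
    using nth0_eqD[OF lam \<mu>] ne by blast
  then have "i < n"
    by (auto simp: n_def nth0_def split: if_splits)
  then have "0 < (\<Sum>i<n. (?a i - ?b i)\<^sup>2)"
    using i by (intro sum_pos2[of _ i]) auto
  moreover have "(\<Sum>i<n. (?a i)\<^sup>2) - (\<Sum>i<n. (?b i)\<^sup>2) = (\<Sum>i<n. (?a i - ?b i)\<^sup>2) + 2 * (\<Sum>i<n. ?b i * (?a i - ?b i))"
    unfolding sum_distrib_left sum.distrib[symmetric] sum_subtractf[symmetric]
    by (rule sum.cong) (auto simp: power2_eq_square algebra_simps)
  ultimately have "(\<Sum>i<n. (?b i)\<^sup>2) < (\<Sum>i<n. (?a i)\<^sup>2)"
    using abel by linarith
  moreover have "(\<Sum>i<n. (nth0 xs i)\<^sup>2) = int (square_sum (mset xs))" if "length xs \<le> n" for xs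
    using sum_nth0[OF that, of "\<lambda>x. x\<^sup>2"]
    by (simp add: square_sum_def sum_mset_sum_list[symmetric] mset_map[symmetric] of_nat_sum_mset del: mset_map)
      (simp add: sum_mset_sum_list o_def image_mset.compositionality)
  ultimately show ?thesis
    by (simp add: n_def)
qed

section \<open>Eigenvalues on Jack symmetric functions\<close>

text \<open>\<open>inv_poch v k\<close> is \<open>1 / (u + v)\<^sub>k\<close> expanded in \<open>u\<^sup>-\<^sup>1\<close>.\<close>

definition inv_poch :: "qalpha \<Rightarrow> nat \<Rightarrow> qalpha fps" where
  "inv_poch v k = (\<Prod>i<k. fps_X * inverse (1 + fps_const (v + of_nat i) * fps_X))"

lemma inv_poch_Suc: "inv_poch v (Suc k) = fps_X * inverse (1 + fps_const v * fps_X) * inv_poch (v + 1) k"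
  unfolding inv_poch_def prod.lessThan_Suc_shift by (simp add: add_ac)

text \<open>For \<open>v = w = 0\<close> and \<open>jack_list lam\<close> this is the sum over
  \<open>k\<close> of \<open>(-1)^k eps k / (u)_k\<close>. The shifts serve the recursion, where
  taking the first entry into \<open>I\<close> raises both by 1.\<close>

definition alt_sum :: "qalpha \<Rightarrow> qalpha \<Rightarrow> qalpha list \<Rightarrow> qalpha fps" where
  "alt_sum v w bs = (\<Sum>I\<in>Pow {..<length bs}. (- 1) ^ card I * inv_poch v (card I) *
    fps_const (\<Prod>j\<in>I. bs ! j + w + of_nat (card {i \<in> I. i < j})))"

lemma alt_sum_Nil: "alt_sum v w [] = 1"
  by (simp add: alt_sum_def inv_poch_def)

lemma Pow_lessThan_Suc:
  "Pow {..<Suc n} = (image Suc) ` Pow {..<n} \<union> (\<lambda>I. insert 0 (Suc ` I)) ` Pow {..<n}"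
proof safe
  fix I assume I: "I \<subseteq> {..<Suc n}" "I \<notin> (\<lambda>I. insert 0 (Suc ` I)) ` Pow {..<n}"
  define I' where "I' = Suc -` I"
  have I': "I' \<subseteq> {..<n}"
    using I by (auto simp: I'_def)
  have "Suc ` I' = I - {0}"
    by (auto simp: I'_def image_iff gr0_conv_Suc)
  moreover from this have "0 \<notin> I"
    using I(2) I' by (metis (no_types, lifting) PowI image_eqI insert_Diff)
  ultimately show "I \<in> (image Suc) ` Pow {..<n}"
    using I' by auto
qed auto

lemma card_less_Suc_image: "card {i \<in> Suc ` I. i < Suc j} = card {i \<in> I. i < j}"
proof -
  have "{i \<in> Suc ` I. i < Suc j} = Suc ` {i \<in> I. i < j}"
    by auto
  then show ?thesis
    by (simp add: card_image)
qed

lemma card_less_insert_Suc_image: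
  assumes "finite I"
  shows "card {i \<in> insert 0 (Suc ` I). i < Suc j} = Suc (card {i \<in> I. i < j})"
proof -
  have "{i \<in> insert 0 (Suc ` I). i < Suc j} = insert 0 (Suc ` {i \<in> I. i < j})"
    by auto
  then show ?thesis
    using assms by (simp add: card_image)
qed

text \<open>The smallest part has rank 0 in every subset which contains it, and raises all other ranks by 1.\<close>

lemma alt_sum_Cons:
  "alt_sum v w (b # bs) = alt_sum v w bs -
    fps_const (b + w) * fps_X * inverse (1 + fps_const v * fps_X) * alt_sum (v + 1) (w + 1) bs"
proof -
  define h where "h I = (- 1) ^ card I * inv_poch v (card I) *
    fps_const (\<Prod>j\<in>I. (b # bs) ! j + w + of_nat (card {i \<in> I. i < j}))" for I
  let ?P = "Pow {..<length bs}"
  let ?c = "fps_const (b + w) * fps_X * inverse (1 + fps_const v * fps_X)"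
  let ?r = "\<lambda>I j. card {i \<in> insert 0 (Suc ` I). i < j}"
  let ?q = "\<lambda>I. \<Prod>j\<in>I. bs ! j + (w + 1) + of_nat (card {i \<in> I. i < j})"
  have "alt_sum v w (b # bs) = sum h ((image Suc) ` ?P \<union> (\<lambda>I. insert 0 (Suc ` I)) ` ?P)"
    by (simp add: alt_sum_def h_def Pow_lessThan_Suc)
  also have "\<dots> = sum h ((image Suc) ` ?P) + sum h ((\<lambda>I. insert 0 (Suc ` I)) ` ?P)"
    by (rule sum.union_disjoint) auto
  also have "sum h ((image Suc) ` ?P) = (\<Sum>I\<in>?P. h (Suc ` I))"
    by (rule sum.reindex_cong[where l = "image Suc"]) (auto simp: inj_on_def)
  also have "\<dots> = alt_sum v w bs"
    unfolding alt_sum_def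
  proof (rule sum.cong)
    fix I assume "I \<in> ?P"
    have "(\<Prod>j\<in>Suc ` I. (b # bs) ! j + w + of_nat (card {i \<in> Suc ` I. i < j})) =
        (\<Prod>j\<in>I. bs ! j + w + of_nat (card {i \<in> I. i < j}))"
      by (subst prod.reindex) (auto simp: card_less_Suc_image)
    then show "h (Suc ` I) = (- 1) ^ card I * inv_poch v (card I) *
        fps_const (\<Prod>j\<in>I. bs ! j + w + of_nat (card {i \<in> I. i < j}))"
      by (simp add: h_def card_image)
  qed simp
  also have "sum h ((\<lambda>I. insert 0 (Suc ` I)) ` ?P) = (\<Sum>I\<in>?P. h (insert 0 (Suc ` I)))"
  proof (rule sum.reindex_cong[where l = "\<lambda>I. insert 0 (Suc ` I)"])
    show "inj_on (\<lambda>I. insert 0 (Suc ` I)) ?P"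
    proof (rule inj_onI)
      fix I K assume "insert 0 (Suc ` I) = insert 0 (Suc ` K)"
      then have "Suc -` insert 0 (Suc ` I) = Suc -` insert 0 (Suc ` K)"
        by simp
      then show "I = K"
        by (auto simp: vimage_def)
    qed
  qed auto
  also have "\<dots> = (\<Sum>I\<in>?P. - (?c *
      ((- 1) ^ card I * inv_poch (v + 1) (card I) *
        fps_const (?q I))))"
  proof (rule sum.cong)
    fix I assume I: "I \<in> ?P"
    then have fin: "finite I"
      by (auto intro: finite_subset)
    have "(\<Prod>j\<in>insert 0 (Suc ` I). (b # bs) ! j + w + of_nat (?r I j)) =
        (b + w) * (\<Prod>j\<in>Suc ` I. (b # bs) ! j + w + of_nat (?r I j))"
      using fin by (subst prod.insert) auto
    also have "(\<Prod>j\<in>Suc ` I. (b # bs) ! j + w + of_nat (?r I j)) =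
        (?q I)"
      by (subst prod.reindex) (simp_all add: card_less_insert_Suc_image[OF fin] add_ac del: insert_iff)
    finally have 1: "(\<Prod>j\<in>insert 0 (Suc ` I). (b # bs) ! j + w + of_nat (?r I j)) =
        (b + w) * (?q I)" .
    have 2: "card (insert 0 (Suc ` I)) = Suc (card I)"
      using fin by (simp add: card_image)
    show "h (insert 0 (Suc ` I)) = - (?c *
      ((- 1) ^ card I * inv_poch (v + 1) (card I) *
        fps_const (?q I)))"
      unfolding h_def 1 2 inv_poch_Suc fps_const_mult[symmetric] power_Suc by (simp only: mult_ac mult_minus_left mult_minus_right mult_1_left mult_1_right)
  qed simp
  also have "\<dots> = - (?c * alt_sum (v + 1) (w + 1) bs)"
    by (simp add: alt_sum_def sum_negf sum_distrib_left)
  finally show ?thesis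
    by simp
qed

text \<open>Multiplication by the full denominator turns the recursion into a polynomial identity:
  the two sums in it have as denominators the full one without its last and without its first
  factor, respectively.\<close>

lemma alt_sum_mult_denominator:
  "alt_sum v w bs * (\<Prod>i<length bs. 1 + fps_const (v + of_nat i) * fps_X) =
    (\<Prod>j<length bs. 1 + fps_const (v + of_nat (length bs - Suc j) - bs ! j - w) * fps_X)"
proof (induction bs arbitrary: v w)
  case Nil
  then show ?case
    by (simp add: alt_sum_Nil)
next
  case (Cons b bs)
  let ?n = "length bs"
  let ?N = "\<Prod>j<?n. 1 + fps_const (v + of_nat (?n - Suc j) - bs ! j - w) * fps_X"
  have unit: "inverse (1 + fps_const v * fps_X) * (1 + fps_const v * fps_X) = 1"
    by (rule inverse_mult_eq_1) simp
  have d1: "(\<Prod>i<Suc ?n. 1 + fps_const (v + of_nat i) * fps_X) =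
      (\<Prod>i<?n. 1 + fps_const (v + of_nat i) * fps_X) * (1 + fps_const (v + of_nat ?n) * fps_X)"
    by simp
  have d2: "(\<Prod>i<Suc ?n. 1 + fps_const (v + of_nat i) * fps_X) =
      (1 + fps_const v * fps_X) * (\<Prod>i<?n. 1 + fps_const (v + 1 + of_nat i) * fps_X)"
    unfolding prod.lessThan_Suc_shift by (simp add: add_ac)
  have "alt_sum v w (b # bs) * (\<Prod>i<Suc ?n. 1 + fps_const (v + of_nat i) * fps_X) =
      alt_sum v w bs * (\<Prod>i<Suc ?n. 1 + fps_const (v + of_nat i) * fps_X) -
      fps_const (b + w) * fps_X * inverse (1 + fps_const v * fps_X) * alt_sum (v + 1) (w + 1) bs *
        (\<Prod>i<Suc ?n. 1 + fps_const (v + of_nat i) * fps_X)"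
    by (simp only: alt_sum_Cons left_diff_distrib)
  also have "alt_sum v w bs * (\<Prod>i<Suc ?n. 1 + fps_const (v + of_nat i) * fps_X) =
      ?N * (1 + fps_const (v + of_nat ?n) * fps_X)"
    unfolding d1 mult.assoc[symmetric] Cons.IH ..
  also have "fps_const (b + w) * fps_X * inverse (1 + fps_const v * fps_X) * alt_sum (v + 1) (w + 1) bs *
        (\<Prod>i<Suc ?n. 1 + fps_const (v + of_nat i) * fps_X) =
      fps_const (b + w) * fps_X * (inverse (1 + fps_const v * fps_X) * (1 + fps_const v * fps_X)) *
        (alt_sum (v + 1) (w + 1) bs * (\<Prod>i<?n. 1 + fps_const (v + 1 + of_nat i) * fps_X))"
    unfolding d2 by (simp only: mult_ac)
  \<comment> \<open>\<open>v\<close> and \<open>w\<close> enter the numerator only through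
    \<open>v - w\<close>, so raising both by 1 reproduces \<open>?N\<close>.\<close>
  also have "\<dots> = fps_const (b + w) * fps_X * ?N"
    unfolding unit Cons.IH by (simp add: algebra_simps)
  also have "?N * (1 + fps_const (v + of_nat ?n) * fps_X) - fps_const (b + w) * fps_X * ?N =
      (1 + fps_const (v + of_nat ?n - b - w) * fps_X) * ?N"
    by (simp add: algebra_simps flip: fps_const_add fps_const_sub)
  also have "\<dots> = (\<Prod>j<Suc ?n. 1 + fps_const (v + of_nat (Suc ?n - Suc j) - (b # bs) ! j - w) * fps_X)"
    unfolding prod.lessThan_Suc_shift by simp
  finally show ?case
    by simp
qed

lemma A_eigenvalue_eq_alt_sum:
  "A_eigenvalue lam = alt_sum 0 0 (jack_list lam)"
proof -
  let ?n = "length lam"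
  let ?t = "\<lambda>i. (1 + fps_const (of_nat (i - 1) - alpha * of_nat (part lam i)) * fps_X) /
    (1 + fps_const (of_nat (i - 1)) * fps_X)"
  let ?num = "\<lambda>i. 1 + fps_const (of_nat i - alpha * of_nat (lam ! i)) * fps_X"
  let ?den = "\<lambda>i. 1 + fps_const (of_nat i) * fps_X :: qalpha fps"
  have den: "?den i * inverse (?den i) = 1" for i
    using inverse_mult_eq_1'[of "?den i"] by simp
  have div: "f / ?den i = f * inverse (?den i)" for f i
    by (rule fps_divide_unit) simp
  have "A_eigenvalue lam = (\<Prod>i=1..?n. ?t i)"
    unfolding A_eigenvalue_def
  proof -
    have "prod' ?t {1..} =
        prod' ?t {1..?n}"
    proof (rule prod.mono_neutral_right', safe)
      fix i assume "i \<ge> 1" "i \<notin> {1..?n}"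
      then have "part lam i = 0"
        by (simp add: part_def)
      then show "?t i = 1"
        using div[of "?den (i - 1)" "i - 1"] den[of "i - 1"] by simp
    qed auto
    then show "prod' ?t {1..} =
      (\<Prod>i=1..?n. ?t i)"
      by simp
  qed
  also have "\<dots> = (\<Prod>i<?n. ?num i * inverse (?den i))"
    unfolding One_nat_def prod.atLeast1_atMost_eq by (rule prod.cong) (auto simp: part_def div)
  also have "\<dots> = (\<Prod>i<?n. ?num i) * (\<Prod>i<?n. inverse (?den i))"
    by (rule prod.distrib)
  \<comment> \<open>\<open>jack_list\<close> runs from the smallest part to the largest, hence the
    reversal of the index.\<close>
  also have "(\<Prod>i<?n. ?num i) = (\<Prod>j<?n. ?num (?n - Suc j))"
    by (rule prod.nat_diff_reindex[symmetric])
  also have "\<dots> = alt_sum 0 0 (jack_list lam) * (\<Prod>i<?n. ?den i)"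
    using alt_sum_mult_denominator[of 0 0 "jack_list lam"]
    by (simp add: jack_list_def rev_nth)
  also have "\<dots> * (\<Prod>i<?n. inverse (?den i)) = alt_sum 0 0 (jack_list lam) * (\<Prod>i<?n. ?den i * inverse (?den i))"
    by (simp only: prod.distrib mult.assoc)
  finally show ?thesis
    by (simp add: den)
qed

lemma inv_poch_eq: "inv_poch v k = fps_X ^ k * (\<Prod>i<k. inverse (1 + fps_const (v + of_nat i) * fps_X))"
  by (simp add: inv_poch_def prod.distrib)

lemma inv_poch_nth_eq_0: "s < k \<Longrightarrow> inv_poch v k $ s = 0"
  by (simp add: inv_poch_eq fps_X_power_mult_nth)

lemma inv_poch_nth_nonzeroD: "inv_poch v k $ s \<noteq> 0 \<Longrightarrow> k \<le> s"
  by (rule ccontr) (simp add: inv_poch_nth_eq_0)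

lemma A_eigenvalue_nth:
  "A_eigenvalue lam $ s = (\<Sum>k\<le>s. (- 1) ^ k * inv_poch 0 k $ s * eps k (jack_list lam))"
proof -
  let ?bs = "jack_list lam"
  define g where "g I = (\<Prod>j\<in>I. ?bs ! j + of_nat (card {i \<in> I. i < j}))" for I
  let ?h = "\<lambda>I. (- 1) ^ card I * inv_poch 0 (card I) $ s * g I"
  let ?S = "{I \<in> Pow {..<length ?bs}. card I \<le> s}"
  have nth: "((- 1) ^ k * f * fps_const a) $ s = (- 1) ^ k * f $ s * a" for k a and f :: "qalpha fps"
    by (induction k) (simp_all add: mult.assoc)
  have "A_eigenvalue lam $ s = (\<Sum>I\<in>Pow {..<length ?bs}. ?h I)"
    unfolding A_eigenvalue_eq_alt_sum alt_sum_def fps_sum_nth nth g_def by simp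
  \<comment> \<open>\<open>1 / (u)_k\<close> starts with the power \<open>k\<close> of
    \<open>u^-1\<close>, so larger subsets do not contribute.\<close>
  also have "\<dots> = (\<Sum>I\<in>?S. ?h I)"
    by (rule sum.mono_neutral_right) (auto intro: inv_poch_nth_nonzeroD)
  also have "\<dots> = (\<Sum>k\<le>s. \<Sum>I\<in>{I \<in> ?S. card I = k}. ?h I)"
    by (rule sum.group[symmetric]) auto
  also have "\<dots> = (\<Sum>k\<le>s. (- 1) ^ k * inv_poch 0 k $ s * eps k ?bs)"
  proof (rule sum.cong)
    fix k assume "k \<in> {..s}"
    then have "{I \<in> ?S. card I = k} = {I. I \<subseteq> {..<length ?bs} \<and> card I = k}"
      by auto
    then show "(\<Sum>I\<in>{I \<in> ?S. card I = k}. ?h I) =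
        (- 1) ^ k * inv_poch 0 k $ s * eps k ?bs"
      unfolding eps_def sum_distrib_left g_def by (intro sum.cong) auto
  qed simp
  finally show ?thesis .
qed

lemma low_span_mono: "m \<le> n \<Longrightarrow> low_span m \<subseteq> low_span n"
  unfolding low_span_def by (intro symfun.span_mono image_mono) auto

lemma low_span_closed:
  shows low_span_add: "f \<in> low_span m \<Longrightarrow> g \<in> low_span m \<Longrightarrow> f + g \<in> low_span m"
    and low_span_diff: "f \<in> low_span m \<Longrightarrow> g \<in> low_span m \<Longrightarrow> f - g \<in> low_span m"
    and low_span_scale: "f \<in> low_span m \<Longrightarrow> c *s f \<in> low_span m"
  by (simp_all add: low_span_def symfun.span_add symfun.span_diff symfun.span_scale)

section \<open>Jack symmetric functions as eigenvectors\<close>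

context
  fixes J :: "partition \<Rightarrow> symfun"
  assumes J: "jack_family J"
begin

lemma jack_orthogonal:
  "lam \<in> partitions \<Longrightarrow> \<mu> \<in> partitions \<Longrightarrow> lam \<noteq> \<mu> \<Longrightarrow> form_alpha (J lam) (J \<mu>) = 0"
  using J by (simp add: jack_family_def)

lemma jack_unitriangular:
  assumes "lam \<in> partitions"
  shows "J lam - msym lam \<in> low_span (square_sum (mset lam))"
proof -
  have "J lam - msym lam \<in> symfun.span (msym ` {\<mu> \<in> partitions. dominated \<mu> lam \<and> \<mu> \<noteq> lam})"
    using J assms by (simp add: jack_family_def)
  also have "\<dots> \<subseteq> low_span (square_sum (mset lam))"
    unfolding low_span_def
    by (intro symfun.span_mono image_mono) (use dominated_square_sum[OF assms] in blast)
  finally show ?thesis .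
qed

lemma msym_in_low_span:
  "lam \<in> partitions \<Longrightarrow> square_sum (mset lam) < m \<Longrightarrow> msym lam \<in> low_span m"
  unfolding low_span_def by (intro symfun.span_base) auto

text \<open>Inverts the unitriangular expansion of the Jack functions, by induction on the
  bound.\<close>

lemma low_span_subset_jack:
  "low_span m \<subseteq> symfun.span (J ` {\<mu> \<in> partitions. square_sum (mset \<mu>) < m})"
proof (induction m rule: less_induct)
  case (less m)
  let ?S = "symfun.span (J ` {\<mu> \<in> partitions. square_sum (mset \<mu>) < m})"
  have "msym lam \<in> ?S" if lam: "lam \<in> partitions" "square_sum (mset lam) < m" for lam
  proof -
    have "J lam - msym lam \<in> symfun.span (J ` {\<mu> \<in> partitions. square_sum (mset \<mu>) < square_sum (mset lam)})"
      using less.IH[OF lam(2)] jack_unitriangular[OF lam(1)] by blast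
    also have "\<dots> \<subseteq> ?S"
      by (intro symfun.span_mono image_mono) (use lam in auto)
    finally have "J lam - msym lam \<in> ?S" .
    moreover have "J lam \<in> ?S"
      using lam by (intro symfun.span_base) auto
    ultimately show ?thesis
      using symfun.span_diff[of "J lam" _ "J lam - msym lam"] by simp
  qed
  then show ?case
    unfolding low_span_def by (intro symfun.span_minimal) auto
qed

lemma span_jack: "f \<in> symfun.span (J ` partitions)"
proof -
  obtain N where N: "mdeg_le f N"
    using ex_mdeg_le by blast
  have "msym (mpart A) \<in> symfun.span (J ` partitions)" if "A \<in> parts_upto N" for A
  proof -
    have "msym (mpart A) \<in> symfun.span (J ` {\<mu> \<in> partitions. square_sum (mset \<mu>) < Suc (square_sum A)})"
      using that low_span_subset_jack by (intro subsetD[OF low_span_subset_jack] msym_in_low_span) (auto simp: parts_upto_def mpart_partitions)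
    then show ?thesis
      by (rule rev_subsetD) (intro symfun.span_mono image_mono, auto)
  qed
  then show ?thesis
    by (subst mcoeff_expansion[OF N]) (auto intro!: symfun.span_sum symfun.span_scale)
qed

lemma jack_eqI:
  assumes "lin S" "lin T" "\<And>lam. lam \<in> partitions \<Longrightarrow> S (J lam) = T (J lam)"
  shows "S f = T f"
  using span_jack[of f]
  by (induction rule: symfun.span_induct_alt)
    (auto simp: assms lin_zero lin_add lin_scale)

lemma form_alpha_span_zero:
  assumes "x \<in> symfun.span S" "\<And>y. y \<in> S \<Longrightarrow> form_alpha y z = 0"
  shows "form_alpha x z = 0"
  using assms(1)
  by (induction rule: symfun.span_induct_alt)
    (auto simp: form_alpha_def p_form_add_left p_form_scale_left assms(2)[unfolded form_alpha_def])

lemma form_alpha_sym: "form_alpha f g = form_alpha g f"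
  by (simp add: form_alpha_def p_form_sym)

text \<open>The difference of both sides lies in the span of the \<open>J \<mu>\<close> with smaller
  \<open>square_sum\<close>, and it turns out to be orthogonal to every \<open>J \<mu>\<close>; by
  nondegeneracy it is 0.\<close>

lemma jack_eigenvector:
  assumes T: "lin T" and self_adj: "\<And>f g. form_alpha (T f) g = form_alpha f (T g)"
    and tri: "\<And>lam. lam \<in> partitions \<Longrightarrow> T (msym lam) - c lam *s msym lam \<in> low_span (square_sum (mset lam))"
    and lam: "lam \<in> partitions"
  shows "T (J lam) = c lam *s J lam"
proof -
  let ?J = "\<lambda>\<mu>. symfun.span (J ` {\<nu> \<in> partitions. square_sum (mset \<nu>) < square_sum (mset \<mu>)})"
  have low: "T x \<in> low_span m" if x: "x \<in> low_span m" for x m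
    unfolding low_span_def
  proof (rule lin_span[OF T _ x[unfolded low_span_def]])
    fix y assume "y \<in> msym ` {\<mu> \<in> partitions. square_sum (mset \<mu>) < m}"
    then obtain \<mu> where \<mu>: "y = msym \<mu>" "\<mu> \<in> partitions" "square_sum (mset \<mu>) < m"
      by auto
    have "T y - c \<mu> *s y \<in> low_span m"
      using tri[OF \<mu>(2)] low_span_mono[of "square_sum (mset \<mu>)" m] \<mu> by auto
    moreover have "c \<mu> *s y \<in> low_span m"
      using \<mu> by (auto intro: low_span_scale msym_in_low_span)
    ultimately have "T y - c \<mu> *s y + c \<mu> *s y \<in> low_span m"
      by (rule low_span_add)
    then show "T y \<in> symfun.span (msym ` {\<mu> \<in> partitions. square_sum (mset \<mu>) < m})"
      by (simp add: low_span_def)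
  qed
  have tri_J: "T (J \<mu>) - c \<mu> *s J \<mu> \<in> low_span (square_sum (mset \<mu>))" if \<mu>: "\<mu> \<in> partitions" for \<mu>
  proof -
    have "T (J \<mu> - msym \<mu>) + (T (msym \<mu>) - c \<mu> *s msym \<mu>) - c \<mu> *s (J \<mu> - msym \<mu>) \<in> low_span (square_sum (mset \<mu>))"
      by (rule low_span_diff[OF low_span_add[OF low[OF jack_unitriangular[OF \<mu>]] tri[OF \<mu>]]
            low_span_scale[OF jack_unitriangular[OF \<mu>]]])
    then show ?thesis
      by (simp add: lin_diff[OF T] symfun.scale_right_diff_distrib algebra_simps)
  qed
  let ?x = "T (J lam) - c lam *s J lam"
  have x: "?x \<in> ?J lam"
    using tri_J[OF lam] low_span_subset_jack by blast
  \<comment> \<open>For lower \<open>\<mu>\<close> the operator is moved to \<open>J \<mu>\<close>,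
    whose image involves only \<open>J \<mu>\<close> and lower functions, all orthogonal to
    \<open>J lam\<close>. Otherwise the functions whose span contains \<open>?x\<close> all have
    indices other than \<open>\<mu>\<close>, hence are orthogonal to \<open>J \<mu>\<close>.\<close>
  have "form_alpha ?x (J \<mu>) = 0" if \<mu>: "\<mu> \<in> partitions" for \<mu>
  proof (cases "square_sum (mset \<mu>) < square_sum (mset lam)")
    case True
    then have ne: "\<mu> \<noteq> lam"
      by auto
    have "T (J \<mu>) - c \<mu> *s J \<mu> \<in> ?J \<mu>"
      using tri_J[OF \<mu>] low_span_subset_jack by blast
    then have "form_alpha (T (J \<mu>) - c \<mu> *s J \<mu>) (J lam) = 0"
    proof (rule form_alpha_span_zero, safe)
      fix \<nu> assume "\<nu> \<in> partitions" "square_sum (mset \<nu>) < square_sum (mset \<mu>)"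
      then show "form_alpha (J \<nu>) (J lam) = 0"
        using True lam by (intro jack_orthogonal) auto
    qed
    then have "form_alpha (T (J \<mu>)) (J lam) = 0"
      using jack_orthogonal[OF \<mu> lam ne] by (simp add: form_alpha_def p_form_diff_left p_form_scale_left)
    then have "form_alpha (T (J lam)) (J \<mu>) = 0"
      using self_adj[of "J lam" "J \<mu>"] by (simp add: form_alpha_sym)
    then show ?thesis
      using jack_orthogonal[OF lam \<mu>] ne by (simp add: form_alpha_def p_form_diff_left p_form_scale_left)
  next
    case False
    show ?thesis
    proof (rule form_alpha_span_zero[OF x], safe)
      fix \<nu> assume "\<nu> \<in> partitions" "square_sum (mset \<nu>) < square_sum (mset lam)"
      then show "form_alpha (J \<nu>) (J \<mu>) = 0"
        using False \<mu> by (intro jack_orthogonal) auto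
    qed
  qed
  then have orth: "form_alpha (J \<mu>) ?x = 0" if "\<mu> \<in> partitions" for \<mu>
    using that by (subst form_alpha_sym)
  have "form_alpha y ?x = 0" for y
    by (rule form_alpha_span_zero[OF span_jack]) (use orth in blast)
  then have "?x = 0"
    by (intro p_form_nondegenerate[OF alpha_nonzero]) (simp add: form_alpha_def p_form_sym[of alpha ?x])
  then show ?thesis
    by simp
qed

lemma Dop_jack: "lam \<in> partitions \<Longrightarrow> Dop k (J lam) = eps k (jack_list lam) *s J lam"
  by (rule jack_eigenvector[OF lin_sumop[OF lin_id] Dop_self_adjoint Dop_msym_triangular])

text \<open>Both sides are linear in \<open>f\<close> and agree on the Jack functions, which span
  the ring.\<close>

lemma diagonal_in_jack_nth:
  assumes "diagonal_in J A_eigenvalue A"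
  shows "(A $ s) f = (\<Sum>k\<le>s. ((- 1) ^ k * inv_poch 0 k $ s) *s Dop k f)"
proof (rule jack_eqI[where S = "A $ s" and T = "\<lambda>f. \<Sum>k\<le>s. ((- 1) ^ k * inv_poch 0 k $ s) *s Dop k f"])
  show "lin (A $ s)"
    using assms by (simp add: diagonal_in_def)
  show "lin (\<lambda>f. \<Sum>k\<le>s. ((- 1) ^ k * inv_poch 0 k $ s) *s Dop k f)"
    by (intro lin_sum_map lin_scale_map lin_sumop lin_id)
  fix lam assume lam: "lam \<in> partitions"
  then have "(A $ s) (J lam) = (A_eigenvalue lam $ s) *s J lam"
    using assms by (simp add: diagonal_in_def)
  then show "(A $ s) (J lam) = (\<Sum>k\<le>s. ((- 1) ^ k * inv_poch 0 k $ s) *s Dop k (J lam))"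
    by (simp add: A_eigenvalue_nth Dop_jack[OF lam] symfun.scale_sum_left)
qed

end

section \<open>The substitution of \<open>u + 1\<close> for \<open>u\<close>\<close>

lemma inverse_shifted_pochhammer_eq: "inverse_shifted_pochhammer k = inv_poch 1 k"
proof -
  have "(\<Prod>i=1..k. 1 + fps_const (of_nat i) * fps_X) $ 0 = (1 :: qalpha)"
    by (induction k) simp_all
  then have "inverse_shifted_pochhammer k = fps_X ^ k * inverse (\<Prod>i=1..k. 1 + fps_const (of_nat i) * fps_X)"
    unfolding inverse_shifted_pochhammer_def by (intro fps_divide_unit) simp
  also have "inverse (\<Prod>i=1..k. 1 + fps_const (of_nat i) * fps_X :: qalpha fps) =
      (\<Prod>i<k. inverse (1 + fps_const (1 + of_nat i) * fps_X))"
    unfolding One_nat_def prod.atLeast1_atMost_eq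
    by (induction k) (simp_all add: fps_inverse_mult mult.commute)
  finally show ?thesis
    by (simp add: inv_poch_eq)
qed

lemma inv_poch_compose: "inv_poch 0 k oo (fps_X / (1 + fps_X)) = inv_poch 1 k"
proof -
  define Y where "Y = fps_X * inverse (1 + fps_X :: qalpha fps)"
  have Y0: "Y $ 0 = 0"
    by (simp add: Y_def)
  have unit: "inverse (1 + fps_X) * (1 + fps_X :: qalpha fps) = 1"
    by (rule inverse_mult_eq_1) simp
  have "(fps_X * inverse (1 + fps_const (of_nat i) * fps_X)) oo Y =
      fps_X * inverse (1 + fps_const (1 + of_nat i) * fps_X)" for i
  proof -
    have "(1 + fps_const (1 + of_nat i) * fps_X) * inverse (1 + fps_X) =
        inverse (1 + fps_X) * (1 + fps_X) + fps_const (of_nat i) * (fps_X * inverse (1 + fps_X :: qalpha fps))"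
      by (simp add: algebra_simps flip: fps_const_add)
    \<comment> \<open>\<open>u^-1\<close> becomes \<open>Y = X / (1 + X)\<close>, and
      \<open>1 + i Y\<close> has the same denominator \<open>1 + X\<close>, which cancels in the
      quotient and leaves the factor for \<open>i + 1\<close>.\<close>
    then have Y: "1 + fps_const (of_nat i) * Y = (1 + fps_const (1 + of_nat i) * fps_X) * inverse (1 + fps_X)"
      by (simp add: unit Y_def)
    have "(fps_X * inverse (1 + fps_const (of_nat i) * fps_X)) oo Y = Y * inverse (1 + fps_const (of_nat i) * Y)"
      using Y0 by (simp add: fps_compose_mult_distrib fps_inverse_compose fps_compose_add_distrib fps_X_fps_compose_startby0)
    also have "\<dots> = fps_X * inverse (1 + fps_const (1 + of_nat i) * fps_X) * (inverse (1 + fps_X) * (1 + fps_X))"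
      unfolding Y by (simp add: fps_inverse_mult Y_def mult_ac)
    finally show ?thesis
      by (simp add: unit)
  qed
  then have "inv_poch 0 k oo Y = inv_poch 1 k"
    using Y0 by (simp add: inv_poch_def fps_compose_prod_distrib)
  moreover have "fps_X / (1 + fps_X) = Y"
    unfolding Y_def by (rule fps_divide_unit) simp
  ultimately show ?thesis
    by simp
qed

text \<open>\<open>shift_u\<close> is coefficientwise the composition with
  \<open>X / (1 + X)\<close>, so each \<open>1 / (u)_k\<close> turns into
  \<open>1 / (u + 1)_k\<close>.\<close>

lemma shift_u_nth:
  assumes J: "jack_family J" and A: "diagonal_in J A_eigenvalue A"
  shows "(shift_u A $ r) f = (\<Sum>k\<le>r. ((- 1) ^ k * inv_poch 1 k $ r) *s Dop k f)"
proof -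
  let ?Y = "fps_X / (1 + fps_X) :: qalpha fps"
  have "(shift_u A $ r) f = (\<Sum>s\<le>r. ((?Y ^ s) $ r) *s (\<Sum>k\<le>s. ((- 1) ^ k * inv_poch 0 k $ s) *s Dop k f))"
    by (simp add: shift_u_def diagonal_in_jack_nth[OF J A])
  also have "\<dots> = (\<Sum>s\<le>r. \<Sum>k\<le>s. ((- 1) ^ k * (inv_poch 0 k $ s * (?Y ^ s) $ r)) *s Dop k f)"
    by (simp add: symfun.scale_sum_right mult_ac)
  also have "\<dots> = (\<Sum>s\<le>r. \<Sum>k\<le>r. ((- 1) ^ k * (inv_poch 0 k $ s * (?Y ^ s) $ r)) *s Dop k f)"
    by (intro sum.cong refl sum.mono_neutral_left) (auto simp: inv_poch_nth_eq_0)
  also have "\<dots> = (\<Sum>k\<le>r. \<Sum>s\<le>r. ((- 1) ^ k * (inv_poch 0 k $ s * (?Y ^ s) $ r)) *s Dop k f)"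
    by (rule sum.swap)
  also have "\<dots> = (\<Sum>k\<le>r. ((- 1) ^ k * (inv_poch 0 k oo ?Y) $ r) *s Dop k f)"
    by (simp add: fps_compose_nth symfun.scale_sum_left sum_distrib_left atLeast0AtMost)
  finally show ?thesis
    by (simp add: inv_poch_compose)
qed

section \<open>Skewing by elementary symmetric functions\<close>

text \<open>The coefficient of \<open>t^n\<close> in the product of all
  \<open>1 - x_i t\<close>.\<close>

definition alt_esym :: "nat \<Rightarrow> symfun" where
  "alt_esym n = (- 1) ^ n *s esym n"

lemma dfac_replicate_mset: "dfac (replicate_mset n b) = fact n"
proof (induction n)
  case (Suc n)
  then show ?case
    by (simp add: dfac_add_mset)
qed (simp add: dfac_def)

lemma esym_eq_aug: "esym n = (1 / fact n) *s aug (replicate_mset n 1)"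
proof -
  have "mpart (replicate_mset n 1) = replicate n 1"
    using mpart_mset[of "replicate n 1"] by (simp add: partitions_def sorted_wrt_iff_nth_less)
  then show ?thesis
    by (simp add: esym_def aug_def dfac_replicate_mset)
qed

lemma esym_0: "esym 0 = 1"
  by (simp add: esym_eq_aug)

text \<open>\<open>b r n\<close> is \<open>m_(r,1^n)\<close> if \<open>r \<ge> 2\<close>, whereas
  \<open>b 1 n\<close> is \<open>(n + 1) e_(n+1)\<close>, because there the first part cannot be
  told from the others.\<close>

lemma psum_mult_esym:
  assumes "r \<ge> 1"
  defines "b \<equiv> \<lambda>r n. (1 / fact n) *s aug (add_mset r (replicate_mset n 1))"
  shows "psum r * esym 0 = b r 0"
    and "psum r * esym (Suc n) = b r (Suc n) + b (Suc r) n"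
    and "of_nat (Suc n) *s esym (Suc n) = b 1 n"
proof -
  have aug: "psum r * aug (replicate_mset n 1) = aug (add_mset r (replicate_mset n 1)) +
      of_nat n *s aug (add_mset (Suc r) (replicate_mset (n - 1) 1))" for n
  proof (cases n)
    case (Suc m)
    have "(\<Sum>u\<in>#replicate_mset n 1. aug (replicate_mset n 1 - {#u#} + {#u + r#})) =
        of_nat n * aug (replicate_mset n 1 - {#1#} + {#1 + r#})"
      by (simp only: image_replicate_mset sum_mset_replicate_mset)
    also have "\<dots> = of_nat n *s aug (add_mset (Suc r) (replicate_mset m 1))"
      unfolding of_nat_mult_eq_scale by (simp add: Suc)
    finally show ?thesis
      using assms(1) Suc psum_mult_aug[of r "replicate_mset n 1"] by simp
  qed (use assms(1) in \<open>simp add: psum_eq_aug\<close>)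
  show "psum r * esym 0 = b r 0"
    using aug[of 0] by (simp add: esym_eq_aug b_def)
  show "psum r * esym (Suc n) = b r (Suc n) + b (Suc r) n"
    using aug[of "Suc n"] by (simp add: esym_eq_aug b_def symfun.scale_right_distrib field_simps del: replicate_mset_Suc of_nat_Suc)
  show "of_nat (Suc n) *s esym (Suc n) = b 1 n"
    by (simp add: esym_eq_aug b_def field_simps del: of_nat_Suc)
qed

text \<open>In the alternating sum neighbouring terms \<open>b r\<close> cancel, so a partial sum
  keeps only its two ends.\<close>

lemma newton_identity_partial:
  assumes "m \<le> n"
  defines "b \<equiv> \<lambda>r n. (1 / fact n) *s aug (add_mset r (replicate_mset n 1))"
  shows "(\<Sum>r=1..m. (- 1) ^ r *s (psum r * esym (Suc n - r))) = - b 1 n + (- 1) ^ m *s b (Suc m) (n - m)"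
  using assms(1)
proof (induction m)
  case 0
  then show ?case
    by simp
next
  case (Suc m)
  define l where "l = n - Suc m"
  have l: "Suc n - Suc m = Suc l" "n - m = Suc l"
    using Suc.prems by (auto simp: l_def)
  have "psum (Suc m) * esym (Suc l) = b (Suc m) (Suc l) + b (Suc (Suc m)) l"
    unfolding b_def by (rule psum_mult_esym) simp
  moreover have "(\<Sum>r=1..m. (- 1) ^ r *s (psum r * esym (Suc n - r))) = - b 1 n + (- 1) ^ m *s b (Suc m) (Suc l)"
    using Suc l by simp
  ultimately show ?case
    unfolding sum.atLeast_Suc_atMost[symmetric]
    by (simp add: l l_def[symmetric] symfun.scale_right_distrib symfun.scale_minus_left del: replicate_mset_Suc)
qed

lemma newton_identity: "of_nat n *s alt_esym n = - (\<Sum>r=1..n. psum r * alt_esym (n - r))"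
proof (cases n)
  case (Suc m)
  define b where "b r n = (1 / fact n) *s aug (add_mset r (replicate_mset n 1))" for r n
  have "(\<Sum>r=1..Suc m. (- 1) ^ r *s (psum r * esym (Suc m - r))) =
      (\<Sum>r=1..m. (- 1) ^ r *s (psum r * esym (Suc m - r))) + (- 1) ^ Suc m *s (psum (Suc m) * esym 0)"
    by simp
  also have "\<dots> = - b 1 m"
    using newton_identity_partial[of m m] psum_mult_esym(1)[of "Suc m"]
    by (simp add: b_def symfun.scale_minus_left)
  also have "\<dots> = - (of_nat n *s esym n)"
    unfolding Suc b_def by (subst psum_mult_esym(3)[of 1]) simp_all
  finally have *: "(\<Sum>r=1..n. (- 1) ^ r *s (psum r * esym (n - r))) = - (of_nat n *s esym n)"
    using Suc by simp
  have "(\<Sum>r=1..n. psum r * alt_esym (n - r)) = (- 1) ^ n *s (\<Sum>r=1..n. (- 1) ^ r *s (psum r * esym (n - r)))"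
    unfolding symfun.scale_sum_right
  proof (rule sum.cong)
    fix r assume r: "r \<in> {1..n}"
    then have "(- 1) ^ n * (- 1) ^ r = ((- 1) ^ (n - r) :: qalpha)"
      by (cases "even r"; cases "even n") auto
    then show "psum r * alt_esym (n - r) = (- 1) ^ n *s (- 1) ^ r *s (psum r * esym (n - r))"
      by (simp add: alt_esym_def)
  qed simp
  then show ?thesis
    unfolding * by (simp add: alt_esym_def mult.commute symfun.scale_minus_right)
qed simp

definition Eop :: "nat \<Rightarrow> symfun \<Rightarrow> symfun" where
  "Eop n = perp (alt_esym n)"

lemma lin_Eop: "lin (Eop n)"
  unfolding Eop_def by (rule lin_perp)

lemma Eop_eq: "Eop n f = (- 1) ^ n *s perp (esym n) f"
  by (simp add: Eop_def alt_esym_def lin_scale[OF lin_perp_left])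

lemma Eop_0 [simp]: "Eop 0 f = f"
  by (simp add: Eop_eq esym_0 perp_eq_adj adj_one)

lemma Eop_rec: "of_nat n *s Eop n f = - (\<Sum>r=1..n. of_nat r *s p_diff r (Eop (n - r) f))"
proof -
  have "of_nat n *s Eop n f = perp (of_nat n *s alt_esym n) f"
    by (simp add: Eop_def lin_scale[OF lin_perp_left])
  also have "\<dots> = - (\<Sum>r=1..n. perp (psum r * alt_esym (n - r)) f)"
    unfolding newton_identity by (simp add: lin_uminus[OF lin_perp_left] lin_sum[OF lin_perp_left])
  also have "(\<Sum>r=1..n. perp (psum r * alt_esym (n - r)) f) = (\<Sum>r=1..n. of_nat r *s p_diff r (Eop (n - r) f))"
    by (rule sum.cong) (auto simp: perp_eq_adj adj_mult adj_psum Eop_def)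
  finally show ?thesis .
qed

lemma Eop_one: "n \<ge> 1 \<Longrightarrow> Eop n 1 = 0"
proof (induction n rule: less_induct)
  case (less n)
  have "of_nat r *s p_diff r (Eop (n - r) 1) = 0" if r: "r \<in> {1..n}" for r
  proof (cases "r = n")
    case True
    then show ?thesis
      by (simp add: p_diff_one)
  next
    case False
    then have "Eop (n - r) 1 = 0"
      using r by (intro less.IH) auto
    then show ?thesis
      by (simp add: lin_zero[OF lin_p_diff])
  qed
  then have "of_nat n *s Eop n 1 = 0"
    unfolding Eop_rec by (simp only: sum.neutral_const cong: sum.cong) simp
  then show ?case
    using less.prems by simp
qed

text \<open>The generating series of the \<open>Eop n\<close> in \<open>t\<close> is the exponential
  of minus the sum of all \<open>t^r \<partial>/\<partial>p_r\<close>, that is, the substitution of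
  \<open>p_b - t^b\<close> for \<open>p_b\<close>. The proof stays with coefficients and argues by
  induction through \<open>Eop_rec\<close>.\<close>

lemma Eop_psum_mult:
  assumes b: "b \<ge> 1"
  shows "Eop n (psum b * f) = psum b * Eop n f - (if b \<le> n then Eop (n - b) f else 0)"
proof (induction n rule: less_induct)
  case (less n)
  show ?case
  proof (cases "n = 0")
    case True
    then show ?thesis
      using b by simp
  next
    case False
    let ?d = "\<lambda>r g. of_nat r *s p_diff r g"
    let ?p = "\<lambda>r. if r = b then of_nat b *s Eop (n - b) f else 0"
    let ?q = "\<lambda>r. if r + b \<le> n then ?d r (Eop (n - b - r) f) else 0"
    have "of_nat n *s Eop n (psum b * f) = - (\<Sum>r=1..n. ?d r (Eop (n - r) (psum b * f)))"
      by (rule Eop_rec)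
    also have "(\<Sum>r=1..n. ?d r (Eop (n - r) (psum b * f))) =
        (\<Sum>r=1..n. ?p r + psum b * ?d r (Eop (n - r) f) -
          ?q r)"
    proof (rule sum.cong)
      fix r assume r: "r \<in> {1..n}"
      have "?d r (Eop (n - r) (psum b * f)) = ?d r (psum b * Eop (n - r) f) -
          ?d r (if b \<le> n - r then Eop (n - r - b) f else 0)"
        using r less.IH[of "n - r"] by (simp add: lin_diff[OF lin_p_diff] symfun.scale_right_diff_distrib)
      also have "?d r (psum b * Eop (n - r) f) = ?p r + psum b * ?d r (Eop (n - r) f)"
        using b by (simp add: p_diff_psum_mult symfun.scale_right_distrib)
      also have "?d r (if b \<le> n - r then Eop (n - r - b) f else 0) =
          ?q r"
      proof -
        have eq: "n - r - b = n - b - r" and iff: "b \<le> n - r \<longleftrightarrow> r + b \<le> n"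
          using r by auto
        show ?thesis
          unfolding eq iff by (cases "r + b \<le> n") (simp_all add: lin_zero[OF lin_p_diff])
      qed
      finally show "?d r (Eop (n - r) (psum b * f)) = ?p r + psum b * ?d r (Eop (n - r) f) -
          ?q r" .
    qed simp
    also have "\<dots> = (\<Sum>r=1..n. ?p r) + psum b * (\<Sum>r=1..n. ?d r (Eop (n - r) f)) -
          (\<Sum>r=1..n. ?q r)"
      by (simp only: sum_subtractf sum.distrib sum_distrib_left)
    also have "(\<Sum>r=1..n. ?p r) = (if b \<le> n then of_nat b *s Eop (n - b) f else 0)"
      using b by simp
    also have "(\<Sum>r=1..n. ?d r (Eop (n - r) f)) = - (of_nat n *s Eop n f)"
      by (simp only: Eop_rec minus_minus)
    also have "(\<Sum>r=1..n. ?q r) = (\<Sum>r=1..n - b. ?d r (Eop (n - b - r) f))"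
      by (rule sum.mono_neutral_cong_right) auto
    also have "\<dots> = - (of_nat (n - b) *s Eop (n - b) f)"
      by (simp only: Eop_rec minus_minus)
    finally have "of_nat n *s Eop n (psum b * f) = of_nat n *s (psum b * Eop n f) -
        ((if b \<le> n then of_nat b *s Eop (n - b) f else 0) + of_nat (n - b) *s Eop (n - b) f)"
      by (simp add: algebra_simps)
    \<comment> \<open>The weights \<open>b\<close> and \<open>n - b\<close> add up to
      \<open>n\<close>, which can then be cancelled.\<close>
    also have "(if b \<le> n then of_nat b *s Eop (n - b) f else 0) + of_nat (n - b) *s Eop (n - b) f =
        of_nat n *s (if b \<le> n then Eop (n - b) f else 0)"
      by (auto simp: symfun.scale_left_distrib[symmetric] simp flip: of_nat_add)
    finally show ?thesis
      using False by (simp only: symfun.scale_right_diff_distrib[symmetric] symfun.scale_cancel_left of_nat_eq_0_iff) simp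
  qed
qed

text \<open>Extending the index to negative integers, with value 0, removes all side conditions from the recursions.\<close>

definition EI :: "int \<Rightarrow> symfun \<Rightarrow> symfun" where
  "EI z f = (if z < 0 then 0 else Eop (nat z) f)"

lemma lin_EI: "lin (EI z)"
  by (rule linI) (auto simp: EI_def lin_add[OF lin_Eop] lin_scale[OF lin_Eop])

lemma EI_psum_mult:
  assumes "b \<ge> 1"
  shows "EI z (psum b * f) = psum b * EI z f - EI (z - int b) f"
  using assms by (auto simp: EI_def Eop_psum_mult nat_diff_distrib)

section \<open>Skewed augmented monomials\<close>

definition del :: "expo \<Rightarrow> nat \<Rightarrow> expo" where
  "del a i = a - single i (lookup a i)"

lemma keys_del [simp]: "keys (del a i) = keys a - {i}"
  by (auto simp: del_def lookup_simps set_eq_iff in_keys_iff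
      simp del: lookup_not_eq_zero_eq_in_keys split: if_splits)

lemma lookup_del: "lookup (del a i) j = (if j = i then 0 else lookup a j)"
  by (simp add: del_def lookup_minus lookup_single)

lemma expo_type_del: "i \<in> keys a \<Longrightarrow> expo_type a = add_mset (lookup a i) (expo_type (del a i))"
  unfolding del_def using expo_type_split[of a i] by (simp add: in_keys_iff)

text \<open>The series of the \<open>Eop n\<close> removes one variable \<open>t\<close> from the
  alphabet. In \<open>M_a\<close> that variable carries no entry of \<open>a\<close> or exactly one,
  so \<open>M_a\<close> is the skewed \<open>M_a\<close> plus, for each entry, \<open>t\<close> to
  the power of the entry times the skewed function without it. Formally, one entry \<open>b\<close>
  is split off by the product rule, with induction on the support.\<close>

lemma EI_aug_rec:
  "EI z (aug (expo_type a)) + (\<Sum>i\<in>keys a. EI (z - int (lookup a i)) (aug (expo_type (del a i)))) =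
    (if z = 0 then aug (expo_type a) else 0)"
proof (induction "card (keys a)" arbitrary: a z)
  case 0
  then have "a = 0"
    by simp
  moreover have "nat z \<ge> 1" if "z \<ge> 0" "z \<noteq> 0"
    using that by simp
  ultimately show ?case
    using Eop_one[of "nat z"] by (auto simp: EI_def expo_type_def)
next
  case (Suc k a)
  obtain j where j: "j \<in> keys a"
    using Suc.hyps(2) by (metis card_eq_0_iff empty_iff ex_in_conv nat.distinct(1))
  define b where "b = lookup a j"
  define c where "c = del a j"
  let ?M = "\<lambda>a. aug (expo_type a)"
  let ?e = "\<lambda>i. EI (z - int (lookup a i)) (?M (del a i))"
  let ?h = "\<lambda>i s. EI (z - int (lookup c i)) (?M (del c i + single s b))"
  have b: "b \<ge> 1"
    using j by (simp add: b_def in_keys_iff)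
  have jc: "j \<notin> keys c" and kc: "keys a = insert j (keys c)" and card: "card (keys c) = k"
    using j Suc.hyps(2) by (auto simp: c_def)
  have a: "a = c + single j b"
    by (rule poly_mapping_eqI) (simp add: c_def b_def del_def lookup_simps)
  have Ma: "?M (c' + single j b) = psum b * ?M c' - (\<Sum>s\<in>keys c'. ?M (c' + single s b))" if "j \<notin> keys c'" for c'
    using psum_mult_aug_expo[OF that b] by simp
  have E: "EI z (?M (c' + single j b)) = psum b * EI z (?M c') - EI (z - int b) (?M c') - (\<Sum>s\<in>keys c'. EI z (?M (c' + single s b)))"
    if "j \<notin> keys c'" for c' z
    unfolding Ma[OF that] by (simp add: lin_diff[OF lin_EI] lin_sum[OF lin_EI] EI_psum_mult[OF b])
  define \<delta> where "\<delta> g = (if z = 0 then g else (0 :: symfun))" for g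
  have IH: "EI z (?M c') = \<delta> (?M c') - (\<Sum>i\<in>keys c'. EI (z - int (lookup c' i)) (?M (del c' i)))" if "card (keys c') = k" for c'
    using Suc.hyps(1)[of c' z] that by (simp add: \<delta>_def algebra_simps)
  \<comment> \<open>Adding \<open>b\<close> to an occupied variable keeps the support, so the
    induction hypothesis also covers the correction terms of the product rule.\<close>
  have keys_s: "keys (c + single s b) = keys c" if "s \<in> keys c" for s
    using that by (auto simp: set_eq_iff in_keys_iff lookup_simps simp del: lookup_not_eq_zero_eq_in_keys)
  have IHs: "EI z (?M (c + single s b)) = \<delta> (?M (c + single s b)) -
      ((\<Sum>i\<in>keys c - {s}. ?h i s) + EI (z - int (lookup c s) - int b) (?M (del c s)))"
    if s: "s \<in> keys c" for s
  proof -
    have "(\<Sum>i\<in>keys (c + single s b). EI (z - int (lookup (c + single s b) i)) (?M (del (c + single s b) i))) =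
        EI (z - int (lookup (c + single s b) s)) (?M (del (c + single s b) s)) +
        (\<Sum>i\<in>keys c - {s}. EI (z - int (lookup (c + single s b) i)) (?M (del (c + single s b) i)))"
      unfolding keys_s[OF s] using s by (intro sum.remove) auto
    also have "del (c + single s b) s = del c s"
      by (rule poly_mapping_eqI) (simp add: lookup_del lookup_add lookup_single)
    also have "(\<Sum>i\<in>keys c - {s}. EI (z - int (lookup (c + single s b) i)) (?M (del (c + single s b) i))) =
        (\<Sum>i\<in>keys c - {s}. ?h i s)"
    proof (rule sum.cong)
      fix i assume i: "i \<in> keys c - {s}"
      then have "del (c + single s b) i = del c i + single s b"
        by (intro poly_mapping_eqI) (auto simp: lookup_del lookup_add lookup_single)
      then show "EI (z - int (lookup (c + single s b) i)) (?M (del (c + single s b) i)) =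
          ?h i s"
        using i by (simp add: lookup_add lookup_single)
    qed simp
    finally show ?thesis
      using IH[of "c + single s b"] card by (simp add: keys_s[OF s] lookup_add lookup_single algebra_simps)
  qed
  have D: "(\<Sum>i\<in>keys c. ?e i) =
      (\<Sum>i\<in>keys c. psum b * EI (z - int (lookup c i)) (?M (del c i)) - EI (z - int (lookup c i) - int b) (?M (del c i)) -
        (\<Sum>s\<in>keys c - {i}. ?h i s))"
  proof (rule sum.cong)
    fix i assume i: "i \<in> keys c"
    then have ij: "i \<noteq> j"
      using jc by auto
    have "del a i = del c i + single j b"
      using ij by (intro poly_mapping_eqI) (auto simp: a lookup_del lookup_add lookup_single)
    moreover have "lookup a i = lookup c i"
      using ij by (simp add: a lookup_add lookup_single)
    ultimately show "?e i = psum b * EI (z - int (lookup c i)) (?M (del c i)) - EI (z - int (lookup c i) - int b) (?M (del c i)) -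
        (\<Sum>s\<in>keys c - {i}. ?h i s)"
      using E[of "del c i" "z - int (lookup c i)"] jc by simp
  qed simp
  have swap: "(\<Sum>i\<in>keys c. \<Sum>s\<in>keys c - {i}. ?h i s) =
      (\<Sum>s\<in>keys c. \<Sum>i\<in>keys c - {s}. ?h i s)"
  proof -
    have "(\<Sum>i\<in>keys c. \<Sum>s\<in>keys c - {i}. ?h i s) =
        (\<Sum>i\<in>keys c. \<Sum>s\<in>keys c. if s \<noteq> i then ?h i s else 0)"
      by (intro sum.cong refl sum.mono_neutral_cong_left) auto
    also have "\<dots> = (\<Sum>s\<in>keys c. \<Sum>i\<in>keys c. if s \<noteq> i then ?h i s else 0)"
      by (rule sum.swap)
    also have "\<dots> = (\<Sum>s\<in>keys c. \<Sum>i\<in>keys c - {s}. ?h i s)"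
      by (intro sum.cong refl sum.mono_neutral_cong_right) auto
    finally show ?thesis .
  qed
  \<comment> \<open>\<open>U\<close>, \<open>V\<close> and \<open>Q\<close> occur in both halves
    with opposite signs and cancel; \<open>psum b * \<delta> (?M c)\<close> and \<open>R\<close>
    recombine to \<open>\<delta> (?M a)\<close>.\<close>
  define U where "U = (\<Sum>s\<in>keys c. EI (z - int (lookup c s) - int b) (?M (del c s)))"
  define V where "V = (\<Sum>s\<in>keys c. \<Sum>i\<in>keys c - {s}. ?h i s)"
  define Q where "Q = (\<Sum>i\<in>keys c. psum b * EI (z - int (lookup c i)) (?M (del c i)))"
  define R where "R = (\<Sum>s\<in>keys c. \<delta> (?M (c + single s b)))"
  have "(\<Sum>i\<in>keys a. ?e i) = EI (z - int b) (?M c) + (Q - U - V)"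
    using sum.remove[OF finite_keys j, of "\<lambda>i. ?e i"] D
    unfolding sum_subtractf swap Q_def U_def V_def by (simp add: b_def c_def)
  moreover have "EI z (?M a) = psum b * EI z (?M c) - EI (z - int b) (?M c) - (\<Sum>s\<in>keys c. EI z (?M (c + single s b)))"
    unfolding a by (rule E[OF jc])
  moreover have "psum b * EI z (?M c) = psum b * \<delta> (?M c) - Q"
    unfolding IH[OF card] Q_def by (simp add: right_diff_distrib sum_distrib_left)
  moreover have "(\<Sum>s\<in>keys c. EI z (?M (c + single s b))) = R - (V + U)"
    unfolding R_def V_def U_def by (simp add: IHs sum_subtractf sum.distrib)
  moreover have "\<delta> (?M a) = psum b * \<delta> (?M c) - R"
    unfolding a R_def using Ma[OF jc] by (simp add: \<delta>_def)
  ultimately have "EI z (?M a) + (\<Sum>i\<in>keys a. ?e i) = \<delta> (?M a)"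
    by simp
  then show ?case
    by (simp add: \<delta>_def)
qed

text \<open>
  The terms of \<open>(u - L) \<Psi>(u)\<close> which come from the entries of \<open>L\<close> above and below the diagonal. They are
  studied for all integers \<open>z\<close>, because the recursion over the variables lowers \<open>z\<close> below 0.
\<close>

definition raise_sum :: "int \<Rightarrow> int \<Rightarrow> expo \<Rightarrow> symfun" where
  "raise_sum z N a = (\<Sum>j\<in>{z<..N}. psum (nat (j - z)) * EI j (aug (expo_type a)))"

definition lower_sum :: "int \<Rightarrow> expo \<Rightarrow> symfun" where
  "lower_sum z a = (\<Sum>i\<in>keys a. \<Sum>r=1..<lookup a i. EI (z - int r) (aug (expo_type (a - single i r))))"

text \<open>The scalar \<open>k - z\<close>, with \<open>k\<close> the size of the support, is what
  the index of the Pochhammer symbol and the diagonal of \<open>L\<close> leave once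
  \<open>alpha\<close> has cancelled.\<close>

definition lax_sum :: "int \<Rightarrow> int \<Rightarrow> expo \<Rightarrow> symfun" where
  "lax_sum z N a = of_int (int (card (keys a)) - z) *s EI z (aug (expo_type a)) + raise_sum z N a + lower_sum z a"

lemma EI_aug_eq:
  "EI z (aug (expo_type a)) = (if z = 0 then aug (expo_type a) else 0) -
    (\<Sum>l\<in>keys a. EI (z - int (lookup a l)) (aug (expo_type (del a l))))"
  using EI_aug_rec[of z a] by (simp add: eq_diff_eq)

lemma raise_sum_rec:
  assumes "int (total_degree a) \<le> N"
  shows "raise_sum z N a = (if z < 0 then psum (nat (- z)) * aug (expo_type a) else 0) -
    (\<Sum>l\<in>keys a. raise_sum (z - int (lookup a l)) (N - int (lookup a l)) (del a l))"
proof -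
  let ?h = "\<lambda>j l. psum (nat (j - z)) * EI (j - int (lookup a l)) (aug (expo_type (del a l)))"
  let ?p = "psum (nat (- z)) * aug (expo_type a)"
  have "raise_sum z N a = (\<Sum>j\<in>{z<..N}. if j = 0 then ?p else 0) -
      (\<Sum>j\<in>{z<..N}. \<Sum>l\<in>keys a. ?h j l)"
    unfolding raise_sum_def sum_subtractf[symmetric]
  proof (rule sum.cong)
    fix j
    show "psum (nat (j - z)) * EI j (aug (expo_type a)) = (if j = 0 then ?p else 0) -
      (\<Sum>l\<in>keys a. ?h j l)"
      by (subst EI_aug_eq) (simp add: right_diff_distrib sum_distrib_left)
  qed simp
  \<comment> \<open>As \<open>N\<close> bounds a degree it is non-negative, so the index 0 lies in
    the range exactly if \<open>z < 0\<close>.\<close>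
  also have "(\<Sum>j\<in>{z<..N}. if j = 0 then ?p else 0) =
      (if z < 0 then ?p else 0)"
    using assms by simp
  also have "(\<Sum>j\<in>{z<..N}. \<Sum>l\<in>keys a. ?h j l) =
      (\<Sum>l\<in>keys a. \<Sum>j\<in>{z<..N}. ?h j l)"
    by (rule sum.swap)
  also have "\<dots> = (\<Sum>l\<in>keys a. raise_sum (z - int (lookup a l)) (N - int (lookup a l)) (del a l))"
    unfolding raise_sum_def
  proof (rule sum.cong)
    fix l
    show "(\<Sum>j\<in>{z<..N}. ?h j l) =
        (\<Sum>j\<in>{z - int (lookup a l)<..N - int (lookup a l)}. psum (nat (j - (z - int (lookup a l)))) * EI j (aug (expo_type (del a l))))"
      by (rule sum.reindex_bij_witness[where i = "\<lambda>j. j + int (lookup a l)" and j = "\<lambda>j. j - int (lookup a l)"]) auto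
  qed simp
  finally show ?thesis .
qed

lemma keys_diff_single: "r < lookup a i \<Longrightarrow> keys (a - single i r) = keys a" for a :: expo
  by (auto simp: set_eq_iff in_keys_iff lookup_simps simp del: lookup_not_eq_zero_eq_in_keys)

text \<open>\<open>EI_aug_eq\<close> is applied to \<open>a\<close> with entry \<open>i\<close>
  lowered by \<open>r\<close>. Removing the lowered entry gives a term independent of
  \<open>r\<close>, hence the factor \<open>lookup a l - 1\<close>; removing another entry gives a
  term of the \<open>lower_sum\<close> of the shorter exponent.\<close>

lemma lower_sum_rec:
  "lower_sum z a = (\<Sum>i\<in>keys a. if 1 \<le> z \<and> z < int (lookup a i) then aug (expo_type (a - single i (nat z))) else 0) -
    (\<Sum>l\<in>keys a. of_nat (lookup a l - 1) *s EI (z - int (lookup a l)) (aug (expo_type (del a l)))) -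
    (\<Sum>l\<in>keys a. lower_sum (z - int (lookup a l)) (del a l))"
proof -
  let ?M = "\<lambda>a. aug (expo_type a)"
  let ?e = "\<lambda>l. EI (z - int (lookup a l)) (?M (del a l))"
  let ?h = "\<lambda>l i r. EI (z - int (lookup a l) - int r) (?M (del a l - single i r))"
  let ?T = "\<lambda>i r. \<Sum>l\<in>keys a - {i}. ?h l i r"
  let ?d = "\<lambda>i r. if z = int r then ?M (a - single i (nat z)) else 0"
  have 1: "EI (z - int r) (?M (a - single i r)) = (?d i r) -
      ?e i -
      ?T i r"
    if i: "i \<in> keys a" and r: "r \<in> {1..<lookup a i}" for i r
  proof -
    let ?b = "a - single i r"
    have "(\<Sum>l\<in>keys ?b. EI (z - int r - int (lookup ?b l)) (?M (del ?b l))) =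
        EI (z - int r - int (lookup ?b i)) (?M (del ?b i)) +
        (\<Sum>l\<in>keys a - {i}. EI (z - int r - int (lookup ?b l)) (?M (del ?b l)))"
      using i r by (subst keys_diff_single) (auto intro!: sum.remove)
    also have "del ?b i = del a i"
      by (rule poly_mapping_eqI) (simp add: lookup_del lookup_minus lookup_single)
    also have "z - int r - int (lookup ?b i) = z - int (lookup a i)"
      using r by (simp add: lookup_minus of_nat_diff)
    also have "(\<Sum>l\<in>keys a - {i}. EI (z - int r - int (lookup ?b l)) (?M (del ?b l))) =
        ?T i r"
    proof (rule sum.cong)
      fix l assume l: "l \<in> keys a - {i}"
      then have "del ?b l = del a l - single i r"
        by (intro poly_mapping_eqI) (auto simp: lookup_del lookup_minus lookup_single)
      moreover have "z - int r - int (lookup ?b l) = z - int (lookup a l) - int r"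
        using l by (simp add: lookup_minus lookup_single)
      ultimately show "EI (z - int r - int (lookup ?b l)) (?M (del ?b l)) = ?h l i r"
        by (simp only:)
    qed simp
    finally show ?thesis
      using EI_aug_eq[of "z - int r" ?b] by (simp add: diff_diff_eq)
  qed
  have "lower_sum z a = (\<Sum>i\<in>keys a. \<Sum>r=1..<lookup a i. (?d i r) -
      ?e i -
      ?T i r)"
    unfolding lower_sum_def by (intro sum.cong refl 1)
  also have "\<dots> = (\<Sum>i\<in>keys a. \<Sum>r=1..<lookup a i. ?d i r) -
      (\<Sum>i\<in>keys a. \<Sum>r=1..<lookup a i. ?e i) -
      (\<Sum>i\<in>keys a. \<Sum>r=1..<lookup a i. ?T i r)"
    by (simp only: sum_subtractf)
  also have "(\<Sum>i\<in>keys a. \<Sum>r=1..<lookup a i. ?d i r) =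
      (\<Sum>i\<in>keys a. if 1 \<le> z \<and> z < int (lookup a i) then ?M (a - single i (nat z)) else 0)"
  proof (rule sum.cong)
    fix i
    have "(\<Sum>r=1..<lookup a i. ?d i r) =
        (\<Sum>r=1..<lookup a i. if r = nat z then (if z \<ge> 0 then ?M (a - single i (nat z)) else 0) else 0)"
      by (rule sum.cong) auto
    then show "(\<Sum>r=1..<lookup a i. ?d i r) =
        (if 1 \<le> z \<and> z < int (lookup a i) then ?M (a - single i (nat z)) else 0)"
      by auto
  qed simp
  also have "(\<Sum>i\<in>keys a. \<Sum>r=1..<lookup a i. ?e i) =
      (\<Sum>l\<in>keys a. of_nat (lookup a l - 1) *s ?e l)"
    by (simp only: sum_constant card_atLeastLessThan of_nat_mult_eq_scale)
  also have "(\<Sum>i\<in>keys a. \<Sum>r=1..<lookup a i. ?T i r) =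
      (\<Sum>i\<in>keys a. \<Sum>l\<in>keys a. if l \<noteq> i then \<Sum>r=1..<lookup a i. ?h l i r else 0)"
    by (rule sum.cong, rule refl, subst sum.swap, rule sum.mono_neutral_cong_left) auto
  also have "\<dots> = (\<Sum>l\<in>keys a. \<Sum>i\<in>keys a. if l \<noteq> i then \<Sum>r=1..<lookup a i. ?h l i r else 0)"
    by (rule sum.swap)
  also have "\<dots> = (\<Sum>l\<in>keys a. lower_sum (z - int (lookup a l)) (del a l))"
    unfolding lower_sum_def keys_del
    by (intro sum.cong refl sum.mono_neutral_cong_right) (auto simp: lookup_del)
  finally show ?thesis .
qed

lemma total_degree_del: "i \<in> keys a \<Longrightarrow> total_degree a = lookup a i + total_degree (del a i)"
  using expo_type_del[of i a] by (metis sum_mset.add_mset sum_mset_expo_type)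

lemma lax_sum_rec:
  assumes "int (total_degree a) \<le> N"
  shows "lax_sum z N a = (if z = 0 then of_nat (card (keys a)) *s aug (expo_type a) else 0) +
    (if z < 0 then psum (nat (- z)) * aug (expo_type a) else 0) +
    (\<Sum>i\<in>keys a. if 1 \<le> z \<and> z < int (lookup a i) then aug (expo_type (a - single i (nat z))) else 0) -
    (\<Sum>l\<in>keys a. lax_sum (z - int (lookup a l)) (N - int (lookup a l)) (del a l))"
proof -
  let ?R = "\<lambda>l. raise_sum (z - int (lookup a l)) (N - int (lookup a l)) (del a l)"
  let ?L = "\<lambda>l. lower_sum (z - int (lookup a l)) (del a l)"
  let ?k = "int (card (keys a))"
  let ?e = "\<lambda>l. EI (z - int (lookup a l)) (aug (expo_type (del a l)))"
  have "of_int (?k - z) *s EI z (aug (expo_type a)) = (if z = 0 then of_nat (card (keys a)) *s aug (expo_type a) else 0) -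
      (\<Sum>l\<in>keys a. of_int (?k - z) *s ?e l)"
    by (subst EI_aug_eq) (simp add: symfun.scale_right_diff_distrib symfun.scale_sum_right)
  moreover have "(\<Sum>l\<in>keys a. lax_sum (z - int (lookup a l)) (N - int (lookup a l)) (del a l)) =
      (\<Sum>l\<in>keys a. of_int (?k - z) *s ?e l) + (\<Sum>l\<in>keys a. of_nat (lookup a l - 1) *s ?e l) +
      (\<Sum>l\<in>keys a. ?R l) +
      (\<Sum>l\<in>keys a. ?L l)"
    unfolding sum.distrib[symmetric]
  proof (rule sum.cong)
    fix l assume l: "l \<in> keys a"
    then have "lookup a l \<ge> 1" "card (keys a) \<ge> 1"
      by (auto simp: in_keys_iff card_gt_0_iff Suc_le_eq)
    \<comment> \<open>Passing to \<open>del a l\<close> changes \<open>card (keys a) - z\<close> by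
      \<open>lookup a l - 1\<close>, which is exactly the extra factor in
      \<open>lower_sum_rec\<close>.\<close>
    then have "int (card (keys a - {l})) - (z - int (lookup a l)) = (?k - z) + int (lookup a l - 1)"
      using l by (simp add: card_Diff_subset of_nat_diff)
    then have "(of_int (int (card (keys a - {l})) - (z - int (lookup a l))) :: qalpha) = of_int (?k - z) + of_nat (lookup a l - 1)"
      by (simp only: of_int_add of_int_of_nat_eq)
    then show "lax_sum (z - int (lookup a l)) (N - int (lookup a l)) (del a l) =
        of_int (?k - z) *s ?e l + of_nat (lookup a l - 1) *s ?e l +
        ?R l + ?L l"
      unfolding lax_sum_def keys_del by (simp only: symfun.scale_left_distrib)
  qed simp
  ultimately show ?thesis
    unfolding lax_sum_def[of z N a] raise_sum_rec[OF assms] lower_sum_rec[of z a] by simp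
qed

text \<open>By induction on the support, the inhomogeneous terms of \<open>lax_sum_rec\<close> are
  compared with the values for the shorter exponents. Only \<open>z < 0\<close> leaves a
  remainder.\<close>

lemma lax_sum_eq:
  assumes "int (total_degree a) \<le> N"
  shows "lax_sum z N a = (if z < 0 then aug (add_mset (nat (- z)) (expo_type a)) else 0)"
  using assms
proof (induction "card (keys a)" arbitrary: a z N)
  case 0
  then have "a = 0"
    by simp
  then show ?case
    by (subst lax_sum_rec[OF 0(2)]) (auto simp: psum_eq_aug expo_type_def)
next
  case (Suc k)
  let ?A = "expo_type a"
  let ?R = "\<Sum>l\<in>keys a. if z < int (lookup a l)
    then aug (add_mset (nat (int (lookup a l) - z)) (expo_type (del a l))) else 0"
  have IH: "lax_sum (z - int (lookup a l)) (N - int (lookup a l)) (del a l) =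
      (if z < int (lookup a l) then aug (add_mset (nat (int (lookup a l) - z)) (expo_type (del a l))) else 0)"
    if l: "l \<in> keys a" for l
    using Suc.hyps(1)[of "del a l" "N - int (lookup a l)" "z - int (lookup a l)"] Suc.hyps(2) Suc.prems l total_degree_del[OF l]
    by simp
  have pos: "lookup a l > 0" if "l \<in> keys a" for l
    using that by (simp add: in_keys_iff)
  have eq: "lax_sum z N a = (if z = 0 then of_nat (card (keys a)) *s aug (expo_type a) else 0) +
    (if z < 0 then psum (nat (- z)) * aug (expo_type a) else 0) +
    (\<Sum>i\<in>keys a. if 1 \<le> z \<and> z < int (lookup a i) then aug (expo_type (a - single i (nat z))) else 0) -
    ?R"
    using IH by (subst lax_sum_rec[OF Suc.prems]) simp
  consider "z = 0" | "z > 0" | "z < 0"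
    by linarith
  then show ?case
  proof cases
    case 1
    \<comment> \<open>Each removed entry is put back unchanged, so the sum consists of
      \<open>card (keys a)\<close> copies of \<open>aug ?A\<close>.\<close>
    have *: "?R =
        (\<Sum>l\<in>keys a. aug ?A)"
      by (rule sum.cong) (use 1 pos in \<open>auto simp: expo_type_del[symmetric]\<close>)
    show ?thesis
      unfolding eq * using 1 by (simp add: of_nat_mult_eq_scale)
  next
    case 2
    \<comment> \<open>The removed entry returns lowered by \<open>z\<close>, which gives the
      remaining sum in \<open>lax_sum_rec\<close>.\<close>
    have "?R =
        (\<Sum>i\<in>keys a. if 1 \<le> z \<and> z < int (lookup a i) then aug (expo_type (a - single i (nat z))) else 0)"
    proof (rule sum.cong)
      fix l assume l: "l \<in> keys a"
      show "(if z < int (lookup a l) then aug (add_mset (nat (int (lookup a l) - z)) (expo_type (del a l))) else 0) =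
          (if 1 \<le> z \<and> z < int (lookup a l) then aug (expo_type (a - single l (nat z))) else 0)"
      proof (cases "z < int (lookup a l)")
        case True
        then have "expo_type (a - single l (nat z)) = add_mset (lookup a l - nat z) (expo_type a - {#lookup a l#})"
          using 2 by (subst expo_type_diff_single) auto
        also have "expo_type a - {#lookup a l#} = expo_type (del a l)"
          using expo_type_del[OF l] by simp
        also have "lookup a l - nat z = nat (int (lookup a l) - z)"
          using 2 by simp
        finally show ?thesis
          using True 2 by simp
      qed simp
    qed simp
    then show ?thesis
      using 2 by (simp add: eq)
  next
    case 3
    define b where "b = nat (- z)"
    have b: "b \<ge> 1" "z = - int b"
      using 3 by (auto simp: b_def)
    \<comment> \<open>The removed entry returns raised by \<open>b = - z\<close>: this is the
      merging part of the product \<open>psum b * aug ?A\<close>, so the term with the new part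
      \<open>b\<close> is left.\<close>
    have "?R =
        (\<Sum>l\<in>keys a. aug (?A - {#lookup a l#} + {#lookup a l + b#}))"
    proof (rule sum.cong)
      fix l assume l: "l \<in> keys a"
      have "?A - {#lookup a l#} = expo_type (del a l)"
        using expo_type_del[OF l] by simp
      moreover have "nat (int (lookup a l) - z) = lookup a l + b"
        using b by simp
      ultimately show "(if z < int (lookup a l) then aug (add_mset (nat (int (lookup a l) - z)) (expo_type (del a l))) else 0) =
          aug (?A - {#lookup a l#} + {#lookup a l + b#})"
        using 3 by simp
    qed simp
    also have "\<dots> = (\<Sum>u\<in>#?A. aug (?A - {#u#} + {#u + b#}))"
      by (rule sum_keys_expo_type)
    also have "\<dots> = psum b * aug ?A - aug (add_mset b ?A)"
      by (simp only: psum_mult_aug[OF b(1) zero_notin_expo_type] add_diff_cancel_left')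
    finally have *: "?R =
        psum b * aug ?A - aug (add_mset b ?A)" .
    have "z \<noteq> 0" "\<not> 1 \<le> z"
      using 3 by auto
    then show ?thesis
      unfolding eq * b_def[symmetric] using 3 by (simp only: if_True if_False simp_thms sum.neutral_const) simp
  qed
qed

lemma lax_coefficient:
  assumes "n \<ge> 1" "total_degree a \<le> N"
  shows "(of_nat (card (keys a)) - of_nat n) *s Eop n (aug (expo_type a)) +
    (\<Sum>j=Suc n..N. psum (j - n) * Eop j (aug (expo_type a))) + lower_sum (int n) a = 0"
proof -
  have "raise_sum (int n) (int N) a = (\<Sum>j=Suc n..N. psum (j - n) * Eop j (aug (expo_type a)))"
    unfolding raise_sum_def
    by (rule sum.reindex_bij_witness[where i = int and j = nat]) (auto simp: EI_def nat_diff_distrib)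
  moreover have "lax_sum (int n) (int N) a = 0"
    using assms by (subst lax_sum_eq) auto
  ultimately show ?thesis
    using assms by (simp add: lax_sum_def EI_def)
qed

lemma EI_of_nat: "EI (int n) f = Eop n f"
  by (simp add: EI_def)

lemma Eop_aug_coefficient:
  assumes "n \<ge> 1"
  shows "Eop n (aug (expo_type a)) + (\<Sum>i\<in>keys a. EI (int n - int (lookup a i)) (aug (expo_type (del a i)))) = 0"
  using EI_aug_rec[of "int n" a] assms by (simp add: EI_of_nat)

text \<open>The index set is tied to the degree of \<open>f\<close> and not to that of
  \<open>g\<close>, so the same one serves all products with power sums. Partitions beyond either
  bound contribute 0.\<close>

lemma star_expansion:
  assumes "f \<in> pow_span N"
  shows "star g f = (\<Sum>B\<in>parts_upto N. mcoeff g (expo_of B) *s star (msym (mpart B)) f)"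
proof -
  obtain M where M: "mdeg_le g M"
    using ex_mdeg_le by blast
  have z: "star (msym (mpart B)) f = 0" if "B \<in> parts_upto M'" "B \<notin> parts_upto N" for B M'
    using that assms by (intro star_msym_eq_0(2)[where N = N]) (auto simp: parts_upto_def)
  have z': "mcoeff g (expo_of B) = 0" if "B \<in> parts_upto N" "B \<notin> parts_upto M" for B
    using that M expo_type_expo_of[of B] sum_mset_expo_type[of "expo_of B"]
    by (auto simp: parts_upto_def mdeg_le_def)
  have "star g f = (\<Sum>B\<in>parts_upto M. mcoeff g (expo_of B) *s star (msym (mpart B)) f)"
    by (subst mcoeff_expansion[OF M]) (simp add: lin_sum[OF lin_star_left] lin_scale[OF lin_star_left])
  also have "\<dots> = (\<Sum>B\<in>parts_upto M \<union> parts_upto N. mcoeff g (expo_of B) *s star (msym (mpart B)) f)"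
    by (rule sum.mono_neutral_left) (use z' in auto)
  also have "\<dots> = (\<Sum>B\<in>parts_upto N. mcoeff g (expo_of B) *s star (msym (mpart B)) f)"
    by (rule sum.mono_neutral_right) (use z in auto)
  finally show ?thesis .
qed

text \<open>This is where \<open>alpha\<close> leaves the recursion: Newton's identity yields a
  multiple of \<open>Eop n g\<close> that cancels the \<open>alpha\<close> in the diagonal entry of
  \<open>L\<close>.\<close>

lemma sum_p_star_Eop:
  "(\<Sum>j<n. p_star (n - j) (Eop j g)) = - ((alpha * of_nat n) *s Eop n g)"
proof -
  have "(\<Sum>j<n. p_star (n - j) (Eop j g)) = (\<Sum>r=1..n. p_star r (Eop (n - r) g))"
    by (rule sum.reindex_bij_witness[where i = "\<lambda>r. n - r" and j = "\<lambda>j. n - j"]) auto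
  also have "\<dots> = alpha *s (\<Sum>r=1..n. of_nat r *s p_diff r (Eop (n - r) g))"
    by (simp add: p_star_def symfun.scale_sum_right)
  also have "\<dots> = - (alpha *s (of_nat n *s Eop n g))"
    unfolding Eop_rec[of n g] by (simp add: symfun.scale_minus_right)
  finally show ?thesis
    by simp
qed

section \<open>The recursion for the coefficients and the theorem\<close>

text \<open>\<open>p_star r\<close> after the adjoint of a monomial function is the adjoint of their
  product, which is expanded in monomial functions again. With \<open>r = n - j\<close> this is the
  factor in front of the adjoint of type \<open>b\<close>; the original monomial function arises
  from \<open>b\<close> by lowering one entry by \<open>r\<close>.\<close>

definition conv_coeff :: "nat \<Rightarrow> nat \<Rightarrow> expo \<Rightarrow> symfun" where
  "conv_coeff n k b = (\<Sum>j<n. \<Sum>i | n - j \<le> lookup b i.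
    if card (keys (b - single i (n - j))) = k then Eop j (aug (expo_type (b - single i (n - j)))) else 0)"

text \<open>Lowering an entry either keeps it positive, which gives \<open>lower_sum\<close> on
  support size \<open>k\<close>, or erases it, which gives the sum of \<open>EI_aug_rec\<close> on
  support size \<open>k + 1\<close>.\<close>

lemma conv_coeff_eq:
  "conv_coeff n k b = (if card (keys b) = k then lower_sum (int n) b else 0) +
    (if card (keys b) = Suc k then \<Sum>i\<in>keys b. EI (int n - int (lookup b i)) (aug (expo_type (del b i))) else 0)"
proof -
  define h where "h i r = (if card (keys (b - single i r)) = k then EI (int n - int r) (aug (expo_type (b - single i r))) else 0)" for i r
  have "conv_coeff n k b = (\<Sum>j<n. \<Sum>i\<in>keys b. if n - j \<le> lookup b i then h i (n - j) else 0)"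
    unfolding conv_coeff_def
  proof (rule sum.cong)
    fix j assume j: "j \<in> {..<n}"
    then have "j < n" by simp
    then have e: "int n - int (n - j) = int j"
      by simp
    have "{i. n - j \<le> lookup b i} \<subseteq> keys b"
      using \<open>j < n\<close> by (auto simp: in_keys_iff simp del: lookup_not_eq_zero_eq_in_keys)
    then show "(\<Sum>i | n - j \<le> lookup b i. if card (keys (b - single i (n - j))) = k
          then Eop j (aug (expo_type (b - single i (n - j)))) else 0) =
        (\<Sum>i\<in>keys b. if n - j \<le> lookup b i then h i (n - j) else 0)"
      unfolding h_def e EI_of_nat by (intro sum.mono_neutral_cong_left) auto
  qed simp
  also have "\<dots> = (\<Sum>i\<in>keys b. \<Sum>j<n. if n - j \<le> lookup b i then h i (n - j) else 0)"
    by (rule sum.swap)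
  also have "\<dots> = (\<Sum>i\<in>keys b. (\<Sum>r=1..<lookup b i. h i r) + h i (lookup b i))"
  proof (rule sum.cong)
    fix i assume i: "i \<in> keys b"
    have "(\<Sum>j<n. if n - j \<le> lookup b i then h i (n - j) else 0) = (\<Sum>r=1..n. if r \<le> lookup b i then h i r else 0)"
      by (rule sum.reindex_bij_witness[where i = "\<lambda>r. n - r" and j = "\<lambda>j. n - j"]) auto
    also have "\<dots> = (\<Sum>r\<in>{1..n} \<inter> {1..lookup b i}. h i r)"
      by (rule sum.mono_neutral_cong_right) auto
    \<comment> \<open>Values \<open>r > n\<close> may be included, because \<open>EI\<close>
      vanishes at negative indices.\<close>
    also have "\<dots> = (\<Sum>r=1..lookup b i. h i r)"
      by (rule sum.mono_neutral_left) (auto simp: h_def EI_def)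
    also have "{1..lookup b i} = insert (lookup b i) {1..<lookup b i}"
      using i by (auto simp: in_keys_iff simp del: lookup_not_eq_zero_eq_in_keys)
    finally show "(\<Sum>j<n. if n - j \<le> lookup b i then h i (n - j) else 0) = (\<Sum>r=1..<lookup b i. h i r) + h i (lookup b i)"
      by simp
  qed simp
  also have "\<dots> = (\<Sum>i\<in>keys b. \<Sum>r=1..<lookup b i. h i r) + (\<Sum>i\<in>keys b. h i (lookup b i))"
    by (rule sum.distrib)
  also have "(\<Sum>i\<in>keys b. \<Sum>r=1..<lookup b i. h i r) = (if card (keys b) = k then lower_sum (int n) b else 0)"
    by (simp add: h_def lower_sum_def keys_diff_single)
  also have "(\<Sum>i\<in>keys b. h i (lookup b i)) =
      (if card (keys b) = Suc k then \<Sum>i\<in>keys b. EI (int n - int (lookup b i)) (aug (expo_type (del b i))) else 0)"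
  proof -
    have "card (keys (b - single i (lookup b i))) = k \<longleftrightarrow> card (keys b) = Suc k" if i: "i \<in> keys b" for i
      unfolding del_def[symmetric] keys_del using i card_Suc_Diff1[OF finite_keys i] by auto
    then show ?thesis
      by (simp add: h_def del_def)
  qed
  finally show ?thesis .
qed

lemma sum_parts_of: "(\<Sum>A\<in>parts_of N k. g A) = (\<Sum>A\<in>parts_upto N. if size A = k then g A else 0)"
  unfolding parts_of_def by (rule sum.inter_filter) simp

lemma sumop_conv:
  assumes f: "f \<in> pow_span N"
  shows "(\<Sum>j<n. \<Sum>A\<in>parts_of N k. Eop j (aug A) * p_star (n - j) (star (msym (mpart A)) f)) =
    (\<Sum>B\<in>parts_upto N. conv_coeff n k (expo_of B) * star (msym (mpart B)) f)"
proof -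
  let ?s = "\<lambda>B. star (msym (mpart B)) f"
  define c where "c j A B = (\<Sum>i | n - j \<le> lookup (expo_of B) i. if expo_type (expo_of B - single i (n - j)) = A then (1 :: qalpha) else 0)" for j A B
  have "(\<Sum>j<n. \<Sum>A\<in>parts_of N k. Eop j (aug A) * p_star (n - j) (?s A)) =
      (\<Sum>j<n. \<Sum>A\<in>parts_of N k. \<Sum>B\<in>parts_upto N. (c j A B *s Eop j (aug A)) * ?s B)"
  proof (intro sum.cong refl)
    fix j A assume j: "j \<in> {..<n}"
    have "p_star (n - j) (?s A) = star (psum (n - j) * msym (mpart A)) f"
      using j by (simp add: star_mult star_psum)
    also have "\<dots> = (\<Sum>B\<in>parts_upto N. c j A B *s ?s B)"
      unfolding star_expansion[OF f, of "psum (n - j) * msym (mpart A)"]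
      using j by (intro sum.cong refl) (simp add: mcoeff_psum_mult mcoeff_msym c_def)
    finally show "Eop j (aug A) * p_star (n - j) (?s A) = (\<Sum>B\<in>parts_upto N. (c j A B *s Eop j (aug A)) * ?s B)"
      by (simp add: sum_distrib_left)
  qed
  also have "\<dots> = (\<Sum>B\<in>parts_upto N. \<Sum>j<n. \<Sum>A\<in>parts_of N k. (c j A B *s Eop j (aug A)) * ?s B)"
    by (subst (2) sum.swap, subst sum.swap, rule refl)
  also have "\<dots> = (\<Sum>B\<in>parts_upto N. conv_coeff n k (expo_of B) * ?s B)"
  proof (rule sum.cong)
    fix B assume B: "B \<in> parts_upto N"
    let ?b = "expo_of B"
    let ?t = "\<lambda>i j. if card (keys (?b - single i (n - j))) = k
      then Eop j (aug (expo_type (?b - single i (n - j)))) else 0"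
    have "(\<Sum>A\<in>parts_of N k. c j A B *s Eop j (aug A)) =
        (\<Sum>i | n - j \<le> lookup ?b i. ?t i j)" for j
    proof -
      have "(\<Sum>A\<in>parts_of N k. c j A B *s Eop j (aug A)) =
          (\<Sum>i | n - j \<le> lookup ?b i. \<Sum>A\<in>parts_of N k. if expo_type (?b - single i (n - j)) = A then Eop j (aug A) else 0)"
        unfolding c_def symfun.scale_sum_left
        by (subst sum.swap) (intro sum.cong refl, simp)
      also have "\<dots> = (\<Sum>i | n - j \<le> lookup ?b i. ?t i j)"
      proof (rule sum.cong)
        fix i assume i: "i \<in> {i. n - j \<le> lookup ?b i}"
        have "?b = (?b - single i (n - j)) + single i (n - j)"
          using i by (intro poly_mapping_eqI) (auto simp: lookup_simps)
        then have "total_degree (?b - single i (n - j)) \<le> total_degree ?b"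
          using total_degree_add[of "?b - single i (n - j)" "single i (n - j)"] by simp
        also have "total_degree ?b \<le> N"
          using B sum_mset_expo_type[of ?b] by (simp add: parts_upto_def)
        finally have "expo_type (?b - single i (n - j)) \<in> parts_of N k \<longleftrightarrow> card (keys (?b - single i (n - j))) = k"
          by (simp add: parts_of_def parts_upto_def sum_mset_expo_type size_expo_type)
        then show "(\<Sum>A\<in>parts_of N k. if expo_type (?b - single i (n - j)) = A then Eop j (aug A) else 0) =
            ?t i j"
          by simp
      qed simp
      finally show ?thesis .
    qed
    then show "(\<Sum>j<n. \<Sum>A\<in>parts_of N k. (c j A B *s Eop j (aug A)) * ?s B) = conv_coeff n k ?b * ?s B"
      by (simp only: conv_coeff_def sum_distrib_right[symmetric])
  qed simp
  finally show ?thesis .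
qed

text \<open>As a derivation, \<open>p_star\<close> acts on \<open>Eop j (aug A)\<close>, where
  \<open>sum_p_star_Eop\<close> applies, and on the adjoint, where \<open>sumop_conv\<close>
  applies. The result is sorted by the adjoints of \<open>msym (mpart B)\<close>: their factors
  vanish by \<open>lax_coefficient\<close> if \<open>size B = k\<close> and by
  \<open>Eop_aug_coefficient\<close> if \<open>size B = k + 1\<close>.\<close>

lemma sumop_recursion:
  assumes n: "n \<ge> 1" and f: "f \<in> pow_span N"
  shows "sumop (Eop n) (Suc k) f + (of_nat k + of_nat n * (alpha - 1)) *s sumop (Eop n) k f +
    (\<Sum>j=Suc n..N. psum (j - n) * sumop (Eop j) k f) + (\<Sum>j<n. p_star (n - j) (sumop (Eop j) k f)) = 0"
proof -
  let ?s = "\<lambda>B. star (msym (mpart B)) f"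
  let ?U = "\<Sum>j=Suc n..N. psum (j - n) * sumop (Eop j) k f"
  let ?P = "\<lambda>k g. (\<Sum>B\<in>parts_upto N. if size B = k then g B * ?s B else 0)"
  have Q: "sumop (Eop j) k f = ?P k (\<lambda>B. Eop j (aug B))" for j k
    unfolding sumop_eq[OF lin_Eop f] sum_parts_of ..
  have 1: "?U = ?P k (\<lambda>B. \<Sum>j=Suc n..N. psum (j - n) * Eop j (aug B))"
  proof -
    have "?U =
        (\<Sum>j=Suc n..N. \<Sum>B\<in>parts_upto N. if size B = k then (psum (j - n) * Eop j (aug B)) * ?s B else 0)"
      unfolding Q sum_distrib_left by (intro sum.cong refl) (auto simp: mult.assoc)
    also have "\<dots> = (\<Sum>B\<in>parts_upto N. \<Sum>j=Suc n..N. if size B = k then (psum (j - n) * Eop j (aug B)) * ?s B else 0)"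
      by (rule sum.swap)
    also have "\<dots> = ?P k (\<lambda>B. \<Sum>j=Suc n..N. psum (j - n) * Eop j (aug B))"
      by (intro sum.cong refl) (auto simp: sum_distrib_right)
    finally show ?thesis .
  qed
  have "(\<Sum>j<n. p_star (n - j) (sumop (Eop j) k f)) =
      (\<Sum>j<n. \<Sum>A\<in>parts_of N k. p_star (n - j) (Eop j (aug A)) * ?s A) +
      (\<Sum>j<n. \<Sum>A\<in>parts_of N k. Eop j (aug A) * p_star (n - j) (?s A))"
    unfolding sumop_eq[OF lin_Eop f] lin_sum[OF lin_p_star] p_star_mult sum.distrib ..
  also have "(\<Sum>j<n. \<Sum>A\<in>parts_of N k. p_star (n - j) (Eop j (aug A)) * ?s A) =
      (\<Sum>A\<in>parts_of N k. (\<Sum>j<n. p_star (n - j) (Eop j (aug A))) * ?s A)"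
    unfolding sum_distrib_right by (rule sum.swap)
  also have "\<dots> = - ((alpha * of_nat n) *s sumop (Eop n) k f)"
    unfolding sum_p_star_Eop sumop_eq[OF lin_Eop f] by (simp add: sum_negf symfun.scale_sum_right)
  also note sumop_conv[OF f]
  finally have 2: "(\<Sum>j<n. p_star (n - j) (sumop (Eop j) k f)) =
      - ((alpha * of_nat n) *s sumop (Eop n) k f) + (\<Sum>B\<in>parts_upto N. conv_coeff n k (expo_of B) * ?s B)" .
  have "sumop (Eop n) (Suc k) f + (of_nat k + of_nat n * (alpha - 1)) *s sumop (Eop n) k f +
      ?U + (\<Sum>j<n. p_star (n - j) (sumop (Eop j) k f)) =
      sumop (Eop n) (Suc k) f + (of_nat k - of_nat n) *s sumop (Eop n) k f +
      ?U + (\<Sum>B\<in>parts_upto N. conv_coeff n k (expo_of B) * ?s B)"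
    unfolding 2 by (simp add: right_diff_distrib symfun.scale_left_distrib symfun.scale_left_diff_distrib mult.commute)
  also have "\<dots> = (\<Sum>B\<in>parts_upto N. (if size B = Suc k then Eop n (aug B) * ?s B else 0) +
      (if size B = k then ((of_nat k - of_nat n) *s Eop n (aug B)) * ?s B else 0) +
      (if size B = k then (\<Sum>j=Suc n..N. psum (j - n) * Eop j (aug B)) * ?s B else 0) + conv_coeff n k (expo_of B) * ?s B)"
    unfolding 1 unfolding Q sum.distrib symfun.scale_sum_right
    by (intro arg_cong2[of _ _ _ _ "(+)"] sum.cong refl) auto
  also have "\<dots> = 0"
  proof (rule sum.neutral, rule ballI)
    fix B assume B: "B \<in> parts_upto N"
    let ?b = "expo_of B"
    have b: "expo_type ?b = B" "card (keys ?b) = size B" "total_degree ?b \<le> N"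
      using B sum_mset_expo_type[of ?b] size_expo_type[of ?b] by (auto simp: parts_upto_def)
    have "(if size B = Suc k then Eop n (aug B) else 0) + (if size B = k then (of_nat k - of_nat n) *s Eop n (aug B) else 0) +
        (if size B = k then (\<Sum>j=Suc n..N. psum (j - n) * Eop j (aug B)) else 0) + conv_coeff n k ?b = 0"
      using lax_coefficient[OF n b(3)] Eop_aug_coefficient[OF n, of ?b] unfolding conv_coeff_eq b(1,2) by auto
    then have "((if size B = Suc k then Eop n (aug B) else 0) + (if size B = k then (of_nat k - of_nat n) *s Eop n (aug B) else 0) +
        (if size B = k then (\<Sum>j=Suc n..N. psum (j - n) * Eop j (aug B)) else 0) + conv_coeff n k ?b) * ?s B = 0"
      by simp
    then show "(if size B = Suc k then Eop n (aug B) * ?s B else 0) +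
      (if size B = k then ((of_nat k - of_nat n) *s Eop n (aug B)) * ?s B else 0) +
      (if size B = k then (\<Sum>j=Suc n..N. psum (j - n) * Eop j (aug B)) * ?s B else 0) + conv_coeff n k ?b * ?s B = 0"
      unfolding distrib_right by (simp add: if_distrib[of "\<lambda>x. x * ?s B"] cong: if_cong)
  qed
  finally show ?thesis .
qed

section \<open>Degrees along the powers of \<open>L\<close>\<close>

lemma psum_mult_pow_span:
  assumes "m \<ge> 1" "f \<in> pow_span N"
  shows "psum m * f \<in> pow_span (N + m)"
  unfolding pow_span_def
proof (rule lin_span[OF lin_mult _ assms(2)[unfolded pow_span_def]])
  fix y assume "y \<in> power_prod ` parts_upto N"
  then obtain A where A: "y = power_prod A" "A \<in> parts_upto N"
    by auto
  then have "psum m * y = power_prod (add_mset m A)" "add_mset m A \<in> parts_upto (N + m)"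
    using assms(1) by (auto simp: parts_upto_def)
  then show "psum m * y \<in> symfun.span (power_prod ` parts_upto (N + m))"
    by (metis imageI symfun.span_base)
qed

lemma lin_Lmat: "lin (Lmat i j)"
  by (rule linI) (auto simp: Lmat_def distrib_left distrib_right symfun.scale_right_distrib lin_add[OF lin_p_star]
      lin_scale[OF lin_p_star] mult.commute)

text \<open>Entry \<open>j\<close> of the column lowers the degree by \<open>j\<close>, and
  \<open>L_ij\<close> changes it by \<open>j - i\<close>, so every power of \<open>L\<close>
  preserves this grading. Hence on \<open>f\<close> of degree at most \<open>N\<close> only the
  indices up to \<open>N\<close> matter.\<close>

lemma Lmat_degree:
  assumes "i \<ge> 1" "j \<ge> 1" "j \<le> N" "f \<in> pow_span (N - j)"
  shows "if i \<le> N then Lmat i j f \<in> pow_span (N - i) else Lmat i j f = 0"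
proof -
  consider "i = j" | "i < j" | "j < i"
    by linarith
  then show ?thesis
  proof cases
    case 1
    then show ?thesis
      using assms by (simp add: Lmat_def pow_span_def symfun.span_scale)
  next
    case 2
    have "psum (j - i) * f \<in> pow_span (N - j + (j - i))"
      using 2 assms by (intro psum_mult_pow_span) auto
    moreover have "N - j + (j - i) = N - i"
      using 2 assms by simp
    ultimately show ?thesis
      using 2 assms by (simp add: Lmat_def)
  next
    case 3
    have "if i - j \<le> N - j then p_star (i - j) f \<in> pow_span (N - j - (i - j)) else p_star (i - j) f = 0"
      using 3 assms by (intro p_star_pow_span) auto
    then show ?thesis
      using 3 assms by (auto simp: Lmat_def split: if_splits)
  qed
qed

lemma L_power_degree:
  assumes "i \<ge> 1" "f \<in> pow_span N"
  shows "if i \<le> N then L_power_p_star r i f \<in> pow_span (N - i) else L_power_p_star r i f = 0"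
  using assms(1)
proof (induction r arbitrary: i)
  case 0
  then show ?case
    using p_star_pow_span[OF 0 assms(2)] by simp
next
  case (Suc r)
  have "L_power_p_star (Suc r) i f = (\<Sum>j=1..N. Lmat i j (L_power_p_star r j f))"
    unfolding L_power_p_star.simps
  proof (rule sum'_eq_sum)
    fix j assume "j \<in> {1..}" "j \<notin> {1..N}"
    then show "Lmat i j (L_power_p_star r j f) = 0"
      using Suc.IH[of j] by (simp add: lin_zero[OF lin_Lmat])
  qed auto
  moreover have "if i \<le> N then Lmat i j (L_power_p_star r j f) \<in> pow_span (N - i) else Lmat i j (L_power_p_star r j f) = 0"
    if "j \<in> {1..N}" for j
    using that Suc by (intro Lmat_degree) (auto split: if_splits)
  ultimately show ?case
    by (auto simp: pow_span_def intro!: symfun.span_sum split: if_splits)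
qed

lemma L_power_p_star_Suc:
  assumes "f \<in> pow_span N"
  shows "L_power_p_star (Suc r) i f = (\<Sum>j=1..N. Lmat i j (L_power_p_star r j f))"
  unfolding L_power_p_star.simps
proof (rule sum'_eq_sum)
  fix j assume "j \<in> {1..}" "j \<notin> {1..N}"
  then show "Lmat i j (L_power_p_star r j f) = 0"
    using L_power_degree[of j f N r] assms by (simp add: lin_zero[OF lin_Lmat])
qed auto

lemma Psi_nth:
  "Psi A n $ t = (\<lambda>f. \<Sum>r<t. L_power_p_star r n ((shift_u A $ (t - Suc r)) f))"
proof
  fix f
  have "Psi A n $ t = (\<lambda>f. \<Sum>x\<in>{(r, s). r + 1 + s = t}. case x of (r, s) \<Rightarrow> L_power_p_star r n ((shift_u A $ s) f))"
    by (simp add: Psi_def case_prod_beta)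
  moreover have "(\<Sum>x\<in>{(r, s). r + 1 + s = t}. case x of (r, s) \<Rightarrow> L_power_p_star r n ((shift_u A $ s) f)) =
      (\<Sum>r<t. L_power_p_star r n ((shift_u A $ (t - Suc r)) f))"
    by (rule sum.reindex_bij_witness[where i = "\<lambda>r. (r, t - Suc r)" and j = fst]) auto
  ultimately show "(Psi A n $ t) f = (\<Sum>r<t. L_power_p_star r n ((shift_u A $ (t - Suc r)) f))"
    by simp
qed

text \<open>The coefficient form of \<open>u \<Psi>(u) = p^* A(u + 1) + L \<Psi>(u)\<close>; a
  common bound \<open>N\<close> for the images of \<open>f\<close> cuts the matrix product to a
  finite sum.\<close>

lemma Psi_Suc:
  assumes "\<And>s. s \<le> t \<Longrightarrow> (shift_u A $ s) f \<in> pow_span N"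
  shows "(Psi A n $ Suc t) f = p_star n ((shift_u A $ t) f) + (\<Sum>j=1..N. Lmat n j ((Psi A j $ t) f))"
proof -
  have "(Psi A n $ Suc t) f = p_star n ((shift_u A $ t) f) + (\<Sum>r<t. L_power_p_star (Suc r) n ((shift_u A $ (t - Suc r)) f))"
    unfolding Psi_nth sum.lessThan_Suc_shift by simp
  also have "(\<Sum>r<t. L_power_p_star (Suc r) n ((shift_u A $ (t - Suc r)) f)) =
      (\<Sum>r<t. \<Sum>j=1..N. Lmat n j (L_power_p_star r j ((shift_u A $ (t - Suc r)) f)))"
    by (rule sum.cong, rule refl, rule L_power_p_star_Suc, rule assms) simp
  also have "\<dots> = (\<Sum>j=1..N. \<Sum>r<t. Lmat n j (L_power_p_star r j ((shift_u A $ (t - Suc r)) f)))"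
    by (rule sum.swap)
  also have "\<dots> = (\<Sum>j=1..N. Lmat n j ((Psi A j $ t) f))"
    by (simp add: Psi_nth lin_sum[OF lin_Lmat])
  finally show ?thesis .
qed

text \<open>The sign \<open>(-1)^n\<close> of the claim is already part of \<open>Eop n\<close>. The
  index \<open>n = 0\<close> is included and gives the coefficients of
  \<open>A(u + 1)\<close>.\<close>

definition Psi_term :: "nat \<Rightarrow> nat \<Rightarrow> symfun \<Rightarrow> symfun" where
  "Psi_term n k f = (- 1) ^ k *s sumop (Eop n) k f"

text \<open>Only the empty partition has length 0, and skewing the constant 1 gives 0. So the
  expansion starts with \<open>k = 1\<close>.\<close>

lemma Psi_term_0_right:
  assumes "n \<ge> 1"
  shows "Psi_term n 0 f = 0"
proof -
  obtain N where N: "f \<in> pow_span N"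
    using ex_pow_span by blast
  have "Eop n (aug A) = 0" if "A \<in> parts_of N 0" for A
    using that Eop_one[OF assms] by (simp add: parts_of_def)
  then show ?thesis
    by (simp add: Psi_term_def sumop_eq[OF lin_Eop N])
qed

lemma Psi_term_0: "Psi_term 0 k f = (- 1) ^ k *s Dop k f"
  by (simp add: Psi_term_def sumop_def)

text \<open>As \<open>u / (u + 1)_(k+1) = 1 / (u + 1)_k - (k + 1) / (u + 1)_(k+1)\<close>, the left
  side is the coefficient of \<open>1 / (u + 1)_k\<close> in \<open>u \<Psi>_n(u)\<close>. So this
  is the defining equation of \<open>\<Psi>(u)\<close> for the claimed coefficients.\<close>

lemma Psi_term_recursion:
  assumes n: "1 \<le> n" "n \<le> N" and f: "f \<in> pow_span N"
  shows "Psi_term n (Suc k) f - of_nat k *s Psi_term n k f =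
    p_star n (Psi_term 0 k f) + (\<Sum>j=1..N. Lmat n j (Psi_term j k f))"
proof -
  let ?s = "(- 1) ^ k :: qalpha"
  let ?L = "\<Sum>j=1..N. Lmat n j (Psi_term j k f)"
  let ?U = "\<Sum>j=Suc n..N. psum (j - n) * Psi_term j k f"
  let ?D = "\<Sum>j=1..<n. p_star (n - j) (Psi_term j k f)"
  have "?L = (\<Sum>j=1..<n. Lmat n j (Psi_term j k f)) + Lmat n n (Psi_term n k f) +
      (\<Sum>j=Suc n..N. Lmat n j (Psi_term j k f))"
  proof -
    have "{1..N} = {1..<n} \<union> {n} \<union> {Suc n..N}"
      using n by auto
    moreover have "{1..<n} \<inter> {Suc n..N} = {}"
      by auto
    ultimately show ?thesis
      by (simp add: sum.union_disjoint)
  qed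
  also have "(\<Sum>j=1..<n. Lmat n j (Psi_term j k f)) = ?D"
    by (rule sum.cong) (auto simp: Lmat_def)
  also have "(\<Sum>j=Suc n..N. Lmat n j (Psi_term j k f)) = ?U"
    by (rule sum.cong) (auto simp: Lmat_def)
  finally have split: "?L = ?D +
      Lmat n n (Psi_term n k f) + ?U" .
  have "p_star n (Psi_term 0 k f) + ?L =
      (\<Sum>j<n. p_star (n - j) (Psi_term j k f)) + (of_nat n * (alpha - 1)) *s Psi_term n k f + ?U"
  proof -
    \<comment> \<open>The term \<open>j = 0\<close> in \<open>sumop_recursion\<close> comes from
      \<open>p^* A(u + 1)\<close>; the terms \<open>j \<ge> 1\<close> belong to
      \<open>L\<close>.\<close>
    have "{..<n} = insert 0 {1..<n}"
      using n by auto
    then have "(\<Sum>j<n. p_star (n - j) (Psi_term j k f)) = p_star n (Psi_term 0 k f) + ?D"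
      by simp
    then show ?thesis
      unfolding split by (simp add: Lmat_def add_ac)
  qed
  also have "\<dots> = ?s *s ((\<Sum>j<n. p_star (n - j) (sumop (Eop j) k f)) + (of_nat n * (alpha - 1)) *s sumop (Eop n) k f +
      (\<Sum>j=Suc n..N. psum (j - n) * sumop (Eop j) k f))"
    by (simp add: Psi_term_def lin_scale[OF lin_p_star] symfun.scale_right_distrib symfun.scale_sum_right mult.commute)
  also have "\<dots> = ?s *s (- sumop (Eop n) (Suc k) f - of_nat k *s sumop (Eop n) k f)"
  proof -
    have "(\<Sum>j<n. p_star (n - j) (sumop (Eop j) k f)) + (of_nat n * (alpha - 1)) *s sumop (Eop n) k f +
      (\<Sum>j=Suc n..N. psum (j - n) * sumop (Eop j) k f) = - sumop (Eop n) (Suc k) f - of_nat k *s sumop (Eop n) k f"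
    proof -
      have "s + b + p = - x - a" if "x + (a + b) + p + s = 0" for x a b p s :: symfun
      proof -
        have "s + b + p = (x + (a + b) + p + s) - x - a"
          by simp
        then show ?thesis
          unfolding that by simp
      qed
      then show ?thesis
        using sumop_recursion[OF n(1) f, of k] unfolding symfun.scale_left_distrib by blast
    qed
    then show ?thesis
      by simp
  qed
  also have "\<dots> = Psi_term n (Suc k) f - of_nat k *s Psi_term n k f"
    by (simp add: Psi_term_def symfun.scale_right_diff_distrib symfun.scale_minus_left symfun.scale_minus_right mult.commute)
  finally show ?thesis ..
qed

lemma inv_poch_Suc_mult: "inv_poch v (Suc k) * (1 + fps_const (v + of_nat k) * fps_X) = fps_X * inv_poch v k"
proof -
  have "inverse (1 + fps_const (v + of_nat k) * fps_X) * (1 + fps_const (v + of_nat k) * fps_X) = 1"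
    by (rule inverse_mult_eq_1) simp
  moreover have "inv_poch v (Suc k) * (1 + fps_const (v + of_nat k) * fps_X) =
      fps_X * inv_poch v k * (inverse (1 + fps_const (v + of_nat k) * fps_X) * (1 + fps_const (v + of_nat k) * fps_X))"
    by (simp add: inv_poch_def mult_ac)
  ultimately show ?thesis
    by simp
qed

lemma inv_poch_1_Suc_nth: "inv_poch 1 (Suc k) $ Suc t = inv_poch 1 k $ t - of_nat (Suc k) * inv_poch 1 (Suc k) $ t"
proof -
  have "inv_poch 1 (Suc k) * (1 + fps_const (1 + of_nat k) * fps_X) =
      inv_poch 1 (Suc k) + fps_X * (fps_const (of_nat (Suc k)) * inv_poch 1 (Suc k))"
    by (simp add: distrib_left mult_ac)
  then have "fps_X * inv_poch 1 k = inv_poch 1 (Suc k) + fps_X * (fps_const (of_nat (Suc k)) * inv_poch 1 (Suc k))"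
    unfolding inv_poch_Suc_mult .
  from arg_cong[where f = "\<lambda>F. F $ Suc t", OF this]
  have "inv_poch 1 k $ t = inv_poch 1 (Suc k) $ Suc t + of_nat (Suc k) * inv_poch 1 (Suc k) $ t"
    by (simp del: of_nat_Suc)
  then show ?thesis
    by simp
qed

lemma inv_poch_nth_diag: "inv_poch v k $ k = 1"
  by (simp add: inv_poch_eq fps_X_power_mult_nth) (induction k, simp_all)

definition Psi_series :: "nat \<Rightarrow> nat \<Rightarrow> symfun \<Rightarrow> symfun" where
  "Psi_series n t f = (\<Sum>k\<le>t. (inv_poch 1 k $ t) *s Psi_term n k f)"

lemma Psi_series_Suc:
  assumes n: "1 \<le> n" "n \<le> N" and f: "f \<in> pow_span N"
  shows "Psi_series n (Suc t) f = p_star n (Psi_series 0 t f) + (\<Sum>j=1..N. Lmat n j (Psi_series j t f))"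
proof -
  let ?c = "\<lambda>k. inv_poch 1 k $ t"
  have "Psi_series n (Suc t) f = (\<Sum>k\<le>t. (inv_poch 1 (Suc k) $ Suc t) *s Psi_term n (Suc k) f)"
    unfolding Psi_series_def by (subst sum.atMost_Suc_shift) (simp add: Psi_term_0_right[OF n(1)])
  also have "\<dots> = (\<Sum>k\<le>t. ?c k *s Psi_term n (Suc k) f) - (\<Sum>k\<le>t. (of_nat (Suc k) * ?c (Suc k)) *s Psi_term n (Suc k) f)"
    by (simp only: inv_poch_1_Suc_nth symfun.scale_left_diff_distrib sum_subtractf)
  also have "(\<Sum>k\<le>t. (of_nat (Suc k) * ?c (Suc k)) *s Psi_term n (Suc k) f) = (\<Sum>k\<le>Suc t. (of_nat k * ?c k) *s Psi_term n k f)"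
    by (subst sum.atMost_Suc_shift) simp
  \<comment> \<open>The index \<open>k = t + 1\<close> drops out, since \<open>1 / (u + 1)_k\<close>
    has no coefficient below the power \<open>k\<close> of \<open>u^-1\<close>.\<close>
  also have "\<dots> = (\<Sum>k\<le>t. (of_nat k * ?c k) *s Psi_term n k f)"
    by (simp add: inv_poch_nth_eq_0)
  also have "(\<Sum>k\<le>t. ?c k *s Psi_term n (Suc k) f) - \<dots> = (\<Sum>k\<le>t. ?c k *s (Psi_term n (Suc k) f - of_nat k *s Psi_term n k f))"
    by (simp add: symfun.scale_right_diff_distrib sum_subtractf mult.commute)
  also have "\<dots> = (\<Sum>k\<le>t. p_star n (?c k *s Psi_term 0 k f) + (\<Sum>j=1..N. Lmat n j (?c k *s Psi_term j k f)))"
    by (simp add: Psi_term_recursion[OF n f] symfun.scale_right_distrib symfun.scale_sum_right lin_scale[OF lin_p_star] lin_scale[OF lin_Lmat])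
  also have "\<dots> = p_star n (Psi_series 0 t f) + (\<Sum>k\<le>t. \<Sum>j=1..N. Lmat n j (?c k *s Psi_term j k f))"
    by (simp add: Psi_series_def lin_sum[OF lin_p_star] sum.distrib)
  also have "(\<Sum>k\<le>t. \<Sum>j=1..N. Lmat n j (?c k *s Psi_term j k f)) = (\<Sum>j=1..N. \<Sum>k\<le>t. Lmat n j (?c k *s Psi_term j k f))"
    by (rule sum.swap)
  also have "\<dots> = (\<Sum>j=1..N. Lmat n j (Psi_series j t f))"
    by (simp add: Psi_series_def lin_sum[OF lin_Lmat])
  finally show ?thesis .
qed

lemma ex_pow_span_finite: "\<exists>N\<ge>M. \<forall>s\<le>t. g s \<in> pow_span N" for t :: nat
proof (induction t)
  case 0
  obtain K where "g 0 \<in> pow_span K"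
    using ex_pow_span by blast
  then show ?case
    using pow_span_mono[of K "max K M"] by (intro exI[of _ "max K M"]) auto
next
  case (Suc t)
  then obtain N where N: "N \<ge> M" "\<forall>s\<le>t. g s \<in> pow_span N"
    by blast
  obtain K where "g (Suc t) \<in> pow_span K"
    using ex_pow_span by blast
  then show ?case
    using N pow_span_mono[of K "max K N"] pow_span_mono[of N "max K N"]
    by (intro exI[of _ "max K N"]) (auto simp: le_Suc_eq)
qed

text \<open>\<open>Psi\<close> and \<open>Psi_series\<close> satisfy the same recursion in the power
  \<open>t\<close> of \<open>u^-1\<close>, and both vanish at \<open>t = 0\<close>. The index
  \<open>n\<close> varies in the induction because \<open>L\<close> mixes the components.\<close>

lemma Psi_eq_series:
  assumes J: "jack_family J" and A: "diagonal_in J A_eigenvalue A" and n: "n \<ge> 1"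
  shows "(Psi A n $ t) f = Psi_series n t f"
  using n
proof (induction t arbitrary: n)
  case 0
  then show ?case
    by (simp add: Psi_nth Psi_series_def Psi_term_0_right)
next
  case (Suc t)
  have sh: "(shift_u A $ s) f = Psi_series 0 s f" for s
    by (simp add: shift_u_nth[OF J A] Psi_series_def Psi_term_0 mult.commute)
  obtain K where "f \<in> pow_span K"
    using ex_pow_span by blast
  \<comment> \<open>\<open>N\<close> has to bound \<open>f\<close> and finitely many of its images
    under the coefficients of \<open>A(u + 1)\<close>, and \<open>Psi_series_Suc\<close> asks for
    \<open>n \<le> N\<close>.\<close>
  moreover obtain N where N: "N \<ge> max K n" "\<forall>s\<le>t. (shift_u A $ s) f \<in> pow_span N"
    using ex_pow_span_finite[of "max K n" t "\<lambda>s. (shift_u A $ s) f"] by blast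
  ultimately have f: "f \<in> pow_span N"
    using pow_span_mono[of K N] by auto
  have "(Psi A n $ Suc t) f = p_star n ((shift_u A $ t) f) + (\<Sum>j=1..N. Lmat n j ((Psi A j $ t) f))"
    using N by (intro Psi_Suc) auto
  also have "\<dots> = p_star n (Psi_series 0 t f) + (\<Sum>j=1..N. Lmat n j (Psi_series j t f))"
    using Suc.IH by (simp add: sh)
  also have "\<dots> = Psi_series n (Suc t) f"
    using Suc.prems N f by (intro Psi_series_Suc[symmetric]) auto
  finally show ?case .
qed

text \<open>The expansion is unitriangular: \<open>1 / (u + 1)_k\<close> has coefficient 1 at the
  power \<open>k\<close> of \<open>u^-1\<close>, so the coefficients are determined one after
  another.\<close>

lemma pochhammer_expansion_unique:
  assumes F: "pochhammer_expansion F G" "pochhammer_expansion F H" and "k \<ge> 1"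
  shows "G k f = H k f"
  using \<open>k \<ge> 1\<close>
proof (induction k rule: less_induct)
  case (less k)
  have split: "(\<Sum>i=1..k. (inverse_shifted_pochhammer i $ k) *s g i) =
      g k + (\<Sum>i\<in>{1..<k}. (inverse_shifted_pochhammer i $ k) *s g i)" for g :: "nat \<Rightarrow> symfun"
  proof -
    have "{1..k} = insert k {1..<k}"
      using less.prems by auto
    then show ?thesis
      by (simp add: inverse_shifted_pochhammer_eq inv_poch_nth_diag)
  qed
  have "(\<Sum>i=1..k. (inverse_shifted_pochhammer i $ k) *s G i f) = (\<Sum>i=1..k. (inverse_shifted_pochhammer i $ k) *s H i f)"
    using F by (simp add: pochhammer_expansion_def)
  moreover have "(\<Sum>i\<in>{1..<k}. (inverse_shifted_pochhammer i $ k) *s G i f) = (\<Sum>i\<in>{1..<k}. (inverse_shifted_pochhammer i $ k) *s H i f)"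
    by (rule sum.cong) (use less.IH in auto)
  ultimately show ?case
    unfolding split by simp
qed

lemma pochhammer_expansion_Psi:
  assumes "jack_family J" "diagonal_in J A_eigenvalue A" "n \<ge> 1"
  shows "pochhammer_expansion (Psi A n) (Psi_term n)"
  unfolding pochhammer_expansion_def
proof (intro allI)
  fix t f
  have "(Psi A n $ t) f = (\<Sum>k\<in>{..t}. (inv_poch 1 k $ t) *s Psi_term n k f)"
    by (simp add: Psi_eq_series[OF assms] Psi_series_def)
  also have "\<dots> = (\<Sum>k=1..t. (inv_poch 1 k $ t) *s Psi_term n k f)"
    by (rule sum.mono_neutral_right) (auto simp: Psi_term_0_right[OF assms(3)] not_less_eq_eq)
  finally show "(Psi A n $ t) f = (\<Sum>k=1..t. (inverse_shifted_pochhammer k $ t) *s Psi_term n k f)"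
    by (simp add: inverse_shifted_pochhammer_eq)
qed

theorem theorem3:
  fixes J :: "partition \<Rightarrow> symfun"
    and A :: "(symfun \<Rightarrow> symfun) fps"
    and Psi_coeff :: "nat \<Rightarrow> nat \<Rightarrow> symfun \<Rightarrow> symfun"
    and k n :: nat
  assumes "jack_family J"
    and "diagonal_in J A_eigenvalue A"
    and "\<And>n. n \<ge> 1 \<Longrightarrow> pochhammer_expansion (Psi A n) (\<lambda>k. Psi_coeff n k)"
    and "k \<ge> 1" and "n \<ge> 1"
  shows "Psi_coeff n k =
    (\<lambda>f. (- 1) ^ (n + k) *
      sum' (\<lambda>lam. of_nat (d_coeff lam) * perp (esym n) (msym lam) * star (msym lam) f)
           {lam \<in> partitions. length lam = k})"
proof
  fix f
  let ?S = "{lam \<in> partitions. length lam = k}"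
  let ?g = "\<lambda>lam. of_nat (d_coeff lam) * perp (esym n) (msym lam) * star (msym lam) f"
  have g: "of_nat (d_coeff lam) *s (perp (esym n) (msym lam) * star (msym lam) f) = ?g lam" for lam
    by (simp add: of_nat_mult_eq_scale)
  have "Psi_coeff n k f = Psi_term n k f"
    using assms(3)[OF assms(5)] pochhammer_expansion_Psi[OF assms(1,2,5)] assms(4)
    by (rule pochhammer_expansion_unique)
  also have "\<dots> = (- 1) ^ k *s ((- 1) ^ n *s sumop (perp (esym n)) k f)"
  proof -
    obtain N where N: "f \<in> pow_span N"
      using ex_pow_span by blast
    show ?thesis
      by (simp add: Psi_term_def sumop_eq[OF lin_Eop N] sumop_eq[OF lin_perp N] Eop_eq symfun.scale_sum_right)
  qed
  also have "sumop (perp (esym n)) k f = sum' ?g ?S"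
    unfolding sumop_def g ..
  also have "(- 1) ^ k *s ((- 1) ^ n *s sum' ?g ?S) = (- 1) ^ (n + k) * sum' ?g ?S"
    by (simp add: minus_one_mult_eq_scale power_add mult.commute)
  finally show "Psi_coeff n k f = (- 1) ^ (n + k) * sum' ?g ?S" .
qed

end
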